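(* Let $\Phi$ be the random dynamical system on $M=\mathbb{R}^N/\mathbb{Z}\cdot 2\pi\mathbf{e}$ obtained from the unidirectionally coupled stochastic system with coupling coefficient $k>0$ (see context). Then $\Phi$ possesses a global random attractor $\mathcal{A}$. Moreover, if (with $N$, $\alpha_i$, $\epsilon_i$ fixed) the coupling coefficient $k$ is sufficiently large, then the following hold: (i) $\mathcal{A}$ admits a one-dimensional topological structure, i.e. $\mathcal{A}(\omega)$ is a one-dimensional topological manifold for each $\omega\in\Omega$; (ii) $\mathcal{A}$ is a closed random conal curve on $M$ with respect to the random cone field $\mathcal{C}_M$, i.e. there is a closed random conal curve $\eta\colon[s_0,s_1]\times\Omega\to M$ with respect to $\mathcal{C}_M$ such that $\mathcal{A}(\omega)=\{\eta(s,\omega)\mid s\in[s_0,s_1]\}$ for each $\omega\in\Omega$.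
   Context: **Stochastic system.** Let $N\ge 2$, $k>0$, $\alpha_i\in\mathbb{R}$, $\epsilon_i>0$ ($1\le i\le N$). Let $L$ be the $N\times N$ matrix with $L_{11}=0$, $L_{ii}=-1$ and $L_{i,i-1}=1$ for $2\le i\le N$, all other entries $0$. The stochastic system is $\mathrm{d}\psi=kL\psi\,\mathrm{d}t+(\alpha_i-\sin\psi_i)_{i=1}^N\,\mathrm{d}t+(\epsilon_i\,\mathrm{d}W_i(t))_{i=1}^N$, with $(W_i)_{i=1}^N$ a standard $N$-dimensional two-sided Brownian motion. **Probability space.** $\bar\Omega=\{\omega=(\omega_1,\dots,\omega_N)\colon\mathbb{R}\to\mathbb{R}^N \text{ continuous},\ \omega(0)=0\}$ with the compact-open topology, its Borel $\sigma$-algebra $\bar{\mathcal{F}}$, the Wiener measure $\mathbb{P}$, and the shift $\theta_t\omega(\cdot)=\omega(\cdot+t)-\omega(t)$. Let $\Omega\subset\bar\Omega$ be a fixed $\theta_t$-invariant set with $\mathbb{P}(\Omega)=1$ such that, for every $\omega\in\Omega$ and $1\le i\le N$, $z_i(\omega)=-\epsilon_i\int_{-\infty}^0e^{\tau}\omega_i(\tau)\,\mathrm{d}\tau$ exists, $t\mapsto z_i(\theta_t\omega)$ is continuous (it is the stationary solution of $\mathrm{d}z_i+z_i\,\mathrm{d}t=\epsilon_i\,\mathrm{d}W_i$), and $|z_i(\theta_t\omega)|/t\to0$ as $t\to\pm\infty$. Put $\mathcal{F}=\{F\cap\Omega\mid F\in\bar{\mathcal{F}}\}$. **The random system $\phi$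 on $\mathbb{R}^N$.** $\phi(t,\phi_0,\omega)$ ($t\in\mathbb{R}$) is the solution with $\phi(0,\phi_0,\omega)=\phi_0$ of $$\frac{\mathrm{d}\phi}{\mathrm{d}t}=kL\phi+\big(\alpha_i-\sin(\phi_i+z_i(\theta_t\omega))+H_i(\theta_t\omega)\big)_{i=1}^N,$$ where $H_1=z_1$ and $H_i=k(z_{i-1}-z_i)+z_i$ for $2\le i\le N$. (It results from $\phi=\psi-z$.) **The random system $\Phi$ on $M$.** $\mathbf{e}=(1,\dots,1)^\top$, $M=\mathbb{R}^N/\mathbb{Z}\cdot2\pi\mathbf{e}$ (diffeomorphic to $\mathbb{S}^1\times\mathbb{R}^{N-1}$) with metric $d_M(x_1\bmod2\pi\mathbf{e},\,x_2\bmod2\pi\mathbf{e})=\inf_{n\in\mathbb{Z}}\|x_1-x_2-2\pi n\mathbf{e}\|$. Since $\phi(t,\phi_0+2\pi\mathbf{e},\omega)=\phi(t,\phi_0,\omega)+2\pi\mathbf{e}$, the formula $\Phi(t,\phi_0\bmod2\pi\mathbf{e},\omega)=\phi(t,\phi_0,\omega)\bmod2\pi\mathbf{e}$ defines a $C^1$-random dynamical system on $M$ over $(\Omega,\mathcal{F},\mathbb{P},(\theta_t))$. **Random sets and attractors.** $\operatorname{dist}(B_1,B_2)=\sup_{x\in B_1}\inf_{y\in B_2}d_M(x,y)$. A random set is a map $B\colon\Omega\to2^M$ with nonempty values such that $\omega\mapsto d_M(x,B(\omega))$ is measurable for all $x\in M$; it is a random compact set if all $B(\omega)$ are compact. It is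 tempered if there are $q\in M$ and a random variable $r\ge0$ with $B(\omega)\subset\{x\mid d_M(x,q)\le r(\omega)\}$ and $\sup_{t\in\mathbb{R}}e^{-\lambda|t|}r(\theta_t\omega)<\infty$ for all $\lambda>0$, $\omega\in\Omega$. A global random attractor of $\Phi$ is a tempered random compact set $\mathcal{A}$ with $\Phi(t,\mathcal{A}(\omega),\omega)=\mathcal{A}(\theta_t\omega)$ for all $t\in\mathbb{R}$, $\omega\in\Omega$, and $\operatorname{dist}(\Phi(t,D(\theta_{-t}\omega),\theta_{-t}\omega),\mathcal{A}(\omega))\to0$ as $t\to\infty$ for every $\omega\in\Omega$ and every tempered random set $D$. **Cone field.** Identify each $T_yM$ with $\mathbb{R}^N$. For $k>2(N-1)$, with $\gamma_i^{-1}=1+2i/k$ and $\beta_i^{-1}=1-2i/k$ ($1\le i\le N-1$), $\mathcal{C}_M$ assigns to $(\omega,y)\in\Omega\times M$ the closed convex cone $\mathcal{C}_M^\omega(y)=\{\delta y\in T_yM\mid\gamma_i\,\delta y_i\le\delta y_{i+1}\le\beta_i\,\delta y_i,\ i=1,\dots,N-1\}$. **Random conal curve.** For an interval $[s_0,s_1]$, a map $\eta\colon[s_0,s_1]\times\Omega\to M$ is a random conal curve with respect to $\mathcal{C}_M$ if (1) $\eta(\cdot,\omega)$ is continuously differentiable for each $\omega$; (2) $\frac{\mathrm{d}}{\mathrm{d}s}\eta(s,\omega)\in\mathcal{C}_M^\omega(\eta(s,\omega))$ for all $s,\omega$; (3) $\omega\mapsto\eta([s_0,s_1],\omega)$ is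 a random set. It is closed if $\eta(s_0,\omega)=\eta(s_1,\omega)$ for each $\omega$. *)

theory Defs
  imports "HOL-Probability.Probability"
begin

section \<open>The driving noise\<close>

text \<open>
  \<open>'n rvec\<close> is \<open>real^'n\<close>; that notation forces the sort \<open>finite\<close> on every occurrence of
  \<open>'n\<close>, whereas some definitions below also need \<open>linorder\<close>.
\<close>

type_synonym 'n rvec = "(real, 'n) vec"
type_synonym 'n sample = "real \<Rightarrow> (real, 'n) vec"

text \<open>
  The two-sided path space of continuous paths vanishing at time 0, with the compact-open
  topology and its Borel sigma-algebra.
\<close>

definition path_space :: "'n::finite sample set" where
  "path_space = {\<omega>. continuous_on UNIV \<omega> \<and> \<omega> 0 = 0}"

definition compact_open_topology :: "'n::finite sample topology" where
  "compact_open_topology =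
     topology_generated_by {{\<omega> \<in> path_space. \<omega> ` K \<subseteq> U} | K U. compact K \<and> open U}"

definition path_borel :: "'n::finite sample measure" where
  "path_borel = sigma path_space {U. openin compact_open_topology U}"

text \<open>
  Wiener measure is the law under which the coordinate process is a standard two-sided Brownian
  motion: paths start at 0, and the scalar increments of the components over consecutive time
  intervals are jointly independent, centred Gaussian, with variance the length of the interval.
  The times range over all of the real line, which gives the two-sided process.
\<close>

definition wiener_measure :: "'n::finite sample measure \<Rightarrow> bool" where
  "wiener_measure P \<longleftrightarrow>
     prob_space P \<and> space P = path_space \<and> sets P = sets path_borel \<and>
     (\<forall>s t i. s < t \<longrightarrow>
        distributed P lborel (\<lambda>\<omega>. \<omega> t $ i - \<omega> s $ i) (normal_density 0 (sqrt (t - s)))) \<and>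
     (\<forall>(\<tau> :: nat \<Rightarrow> real) m. strict_mono \<tau> \<longrightarrow>
        prob_space.indep_vars P (\<lambda>_. borel)
          (\<lambda>(l, i) \<omega>. \<omega> (\<tau> (Suc l)) $ i - \<omega> (\<tau> l) $ i) ({..<m} \<times> UNIV))"

definition path_shift :: "real \<Rightarrow> 'n::finite sample \<Rightarrow> 'n sample" where
  "path_shift t \<omega> = (\<lambda>s. \<omega> (s + t) - \<omega> t)"

text \<open>
  The Ornstein-Uhlenbeck variables.  The Henstock-Kurzweil integral over the half line also
  covers the improper Riemann integral, so no absolute integrability is required below.
\<close>

definition ou :: "'n::finite rvec \<Rightarrow> 'n \<Rightarrow> 'n sample \<Rightarrow> real" where
  "ou \<epsilon> i \<omega> = - \<epsilon> $ i * integral {..0} (\<lambda>\<tau>. exp \<tau> * \<omega> \<tau> $ i)"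

definition admissible_noise_set ::
    "'n::finite sample measure \<Rightarrow> 'n rvec \<Rightarrow> 'n sample set \<Rightarrow> bool" where
  "admissible_noise_set P \<epsilon> \<Omega> \<longleftrightarrow>
     \<Omega> \<in> sets P \<and> measure P \<Omega> = 1 \<and> (\<forall>t. path_shift t ` \<Omega> = \<Omega>) \<and>
     (\<forall>\<omega>\<in>\<Omega>. \<forall>i.
        (\<lambda>\<tau>. exp \<tau> * \<omega> \<tau> $ i) integrable_on {..0} \<and>
        continuous_on UNIV (\<lambda>t. ou \<epsilon> i (path_shift t \<omega>)) \<and>
        ((\<lambda>t. \<bar>ou \<epsilon> i (path_shift t \<omega>)\<bar> / t) \<longlongrightarrow> 0) at_top \<and>
        ((\<lambda>t. \<bar>ou \<epsilon> i (path_shift t \<omega>)\<bar> / t) \<longlongrightarrow> 0) at_bot)"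


section \<open>The random system on Euclidean space\<close>

text \<open>
  Coordinates of \<open>real^'n\<close> are numbered 1, ..., N along the linear order of the index type,
  where \<open>N = CARD('n)\<close>; finite linearly ordered types of every positive cardinality exist.
\<close>

definition coord_no :: "'n::{finite,linorder} \<Rightarrow> nat" where
  "coord_no i = card {j. j \<le> i}"

definition prev_coord :: "'n::{finite,linorder} \<Rightarrow> 'n" where
  "prev_coord i = (THE j. coord_no i = Suc (coord_no j))"

lemma coord_no_bij: "bij_betw coord_no (UNIV :: 'n::{finite,linorder} set) {1..CARD('n)}"
proof -
  have less: "coord_no i < coord_no j" if "i < j" for i j :: 'n
  proof -
    have "{l. l \<le> i} \<subset> {l. l \<le> j}"
    proof (rule psubsetI)
      show "{l. l \<le> i} \<subseteq> {l. l \<le> j}" using that by auto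
      have "j \<notin> {l. l \<le> i}" "j \<in> {l. l \<le> j}" using that by simp_all
      then show "{l. l \<le> i} \<noteq> {l. l \<le> j}" by blast
    qed
    then show ?thesis unfolding coord_no_def by (simp add: psubset_card_mono)
  qed
  have inj: "inj (coord_no :: 'n \<Rightarrow> nat)"
    by (rule injI) (metis less less_irrefl linorder_neqE)
  have "coord_no ` (UNIV :: 'n set) \<subseteq> {1..CARD('n)}"
    unfolding coord_no_def by (auto simp: Suc_le_eq card_gt_0_iff intro!: card_mono)
  moreover have "card (coord_no ` (UNIV :: 'n set)) = card {1..CARD('n)}"
    using inj by (simp add: card_image)
  ultimately have "coord_no ` (UNIV :: 'n set) = {1..CARD('n)}"
    by (intro card_subset_eq) auto
  with inj show ?thesis by (simp add: bij_betw_def)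
qed

definition coupling_matrix :: "((real, 'n) vec, 'n::{finite,linorder}) vec" where
  "coupling_matrix = (\<chi> i j.
     if coord_no i = 1 then 0
     else if j = i then - 1
     else if coord_no i = Suc (coord_no j) then 1
     else 0)"

definition drift_corr ::
    "real \<Rightarrow> 'n rvec \<Rightarrow> 'n sample \<Rightarrow> 'n::{finite,linorder} rvec" where
  "drift_corr k \<epsilon> \<omega> = (\<chi> i.
     if coord_no i = 1 then ou \<epsilon> i \<omega>
     else k * (ou \<epsilon> (prev_coord i) \<omega> - ou \<epsilon> i \<omega>) + ou \<epsilon> i \<omega>)"

definition rde_field ::
    "real \<Rightarrow> 'n rvec \<Rightarrow> 'n rvec \<Rightarrow> 'n sample \<Rightarrow> 'n rvec \<Rightarrow> 'n::{finite,linorder} rvec" where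
  "rde_field k \<alpha> \<epsilon> \<omega> x =
     k *\<^sub>R (coupling_matrix *v x) +
     (\<chi> i. \<alpha> $ i - sin (x $ i + ou \<epsilon> i \<omega>) + drift_corr k \<epsilon> \<omega> $ i)"

definition flow ::
    "real \<Rightarrow> 'n rvec \<Rightarrow> 'n rvec \<Rightarrow> real \<Rightarrow> 'n rvec \<Rightarrow> 'n sample \<Rightarrow> 'n::{finite,linorder} rvec" where
  "flow k \<alpha> \<epsilon> t x \<omega> =
     (THE u. u 0 = x \<and>
        (\<forall>s. (u has_vector_derivative rde_field k \<alpha> \<epsilon> (path_shift s \<omega>) (u s)) (at s))) t"


section \<open>The quotient manifold\<close>

definition diag_vec :: "real^'n" where
  "diag_vec = (\<chi> i. 1)"

definition cyl_rel :: "real^'n \<Rightarrow> real^'n \<Rightarrow> bool" where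
  "cyl_rel x y \<longleftrightarrow> (\<exists>m::int. x - y = (2 * pi * of_int m) *\<^sub>R diag_vec)"

lemma equivp_cyl_rel: "equivp (cyl_rel :: real^'n \<Rightarrow> real^'n \<Rightarrow> bool)"
proof (rule equivpI)
  show "reflp (cyl_rel :: real^'n \<Rightarrow> _)"
    unfolding cyl_rel_def by (rule reflpI) (auto intro!: exI[of _ 0])
  show "symp (cyl_rel :: real^'n \<Rightarrow> _)"
  proof (rule sympI)
    fix x y :: "real^'n" assume "cyl_rel x y"
    then obtain m :: int where "x - y = (2 * pi * of_int m) *\<^sub>R diag_vec"
      unfolding cyl_rel_def by blast
    then have "y - x = (2 * pi * of_int (- m)) *\<^sub>R diag_vec"
      by (metis minus_diff_eq mult_minus_right of_int_minus scaleR_minus_left)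
    then show "cyl_rel y x" unfolding cyl_rel_def by blast
  qed
  show "transp (cyl_rel :: real^'n \<Rightarrow> _)"
  proof (rule transpI)
    fix x y z :: "real^'n" assume "cyl_rel x y" "cyl_rel y z"
    then obtain m m' :: int where "x - y = (2 * pi * of_int m) *\<^sub>R diag_vec"
        "y - z = (2 * pi * of_int m') *\<^sub>R diag_vec"
      unfolding cyl_rel_def by blast
    then have "x - z = (2 * pi * of_int (m + m')) *\<^sub>R diag_vec"
      by (simp add: algebra_simps)
    then show "cyl_rel x z" unfolding cyl_rel_def by blast
  qed
qed

quotient_type (overloaded) 'n cylinder = "real^'n" / "cyl_rel :: real^'n \<Rightarrow> real^'n \<Rightarrow> bool"
  morphisms cyl_rep cyl_proj
  by (rule equivp_cyl_rel)

abbreviation cyl_norm :: "real^'n \<Rightarrow> int \<Rightarrow> real" where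
  "cyl_norm x m \<equiv> norm (x - (2 * pi * of_int m) *\<^sub>R diag_vec)"

lemma cyl_norm_bdd: "bdd_below (range (cyl_norm x))"
  by (rule bdd_belowI[of _ 0]) auto

lemma norm_diag_vec_ge: "norm (diag_vec :: real^'n) \<ge> 1"
  using component_le_norm_cart[of "diag_vec :: real^'n" undefined] by (simp add: diag_vec_def)

lemma cyl_norm_unique:
  fixes x :: "real^'n"
  assumes "cyl_norm x m < 1" "cyl_norm x m' < 1"
  shows "m = m'"
proof (rule ccontr)
  assume "m \<noteq> m'"
  then have "1 \<le> \<bar>real_of_int (m' - m)\<bar>" by linarith
  moreover have "2 \<le> 2 * pi" using pi_ge_two by linarith
  ultimately have "2 * 1 \<le> (2 * pi) * \<bar>real_of_int (m' - m)\<bar>"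
    by (intro mult_mono) auto
  then have "2 * 1 \<le> ((2 * pi) * \<bar>real_of_int (m' - m)\<bar>) * norm (diag_vec :: real^'n)"
    using norm_diag_vec_ge by (intro mult_mono) auto
  also have "\<dots> = norm ((2 * pi * of_int (m' - m)) *\<^sub>R (diag_vec :: real^'n))"
    by (simp add: abs_mult)
  also have "\<dots> = norm ((x - (2 * pi * of_int m) *\<^sub>R diag_vec) - (x - (2 * pi * of_int m') *\<^sub>R diag_vec))"
    by (simp add: algebra_simps)
  also have "\<dots> \<le> cyl_norm x m + cyl_norm x m'"
    by (rule norm_triangle_ineq4)
  also have "\<dots> < 2" using assms by linarith
  finally show False by simp
qed

lemma cyl_norm_INF_shift:
  "(INF m. cyl_norm (x + (2 * pi * of_int l) *\<^sub>R diag_vec) m) = (INF m. cyl_norm x m)"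
proof -
  have "range (cyl_norm (x + (2 * pi * of_int l) *\<^sub>R diag_vec)) = range (cyl_norm x)"
  proof safe
    fix m
    have "cyl_norm (x + (2 * pi * of_int l) *\<^sub>R diag_vec) m = cyl_norm x (m - l)"
      by (simp add: algebra_simps)
    then show "cyl_norm (x + (2 * pi * of_int l) *\<^sub>R diag_vec) m \<in> range (cyl_norm x)"
      by (rule image_eqI) simp
    have "cyl_norm x m = cyl_norm (x + (2 * pi * of_int l) *\<^sub>R diag_vec) (m + l)"
      by (simp add: algebra_simps)
    then show "cyl_norm x m \<in> range (cyl_norm (x + (2 * pi * of_int l) *\<^sub>R diag_vec))"
      by (rule image_eqI) simp
  qed
  then show ?thesis by simp
qed

instantiation cylinder :: (finite) metric_space
begin

lift_definition dist_cylinder :: "'a cylinder \<Rightarrow> 'a cylinder \<Rightarrow> real" is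
  "\<lambda>x y. INF m. norm (x - y - (2 * pi * of_int m) *\<^sub>R diag_vec)"
proof -
  fix x x' y y' :: "real^'a"
  assume "cyl_rel x x'" "cyl_rel y y'"
  then obtain m m' :: int where "x - x' = (2 * pi * of_int m) *\<^sub>R diag_vec"
      "y - y' = (2 * pi * of_int m') *\<^sub>R diag_vec"
    unfolding cyl_rel_def by blast
  then have "x - y = (x' - y') + (2 * pi * of_int (m - m')) *\<^sub>R diag_vec"
    by (simp add: algebra_simps)
  then show "(INF m. cyl_norm (x - y) m) = (INF m. cyl_norm (x' - y') m)"
    by (simp only: cyl_norm_INF_shift)
qed

definition uniformity_cylinder :: "('a cylinder \<times> 'a cylinder) filter" where
  "uniformity_cylinder = (INF e\<in>{0<..}. principal {(x, y). dist x y < e})"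

definition open_cylinder :: "'a cylinder set \<Rightarrow> bool" where
  "open_cylinder U \<longleftrightarrow> (\<forall>x\<in>U. \<forall>\<^sub>F (x', y) in uniformity. x' = x \<longrightarrow> y \<in> U)"

instance
proof
  show "uniformity = (INF e\<in>{0<..}. principal {(x, y :: 'a cylinder). dist x y < e})"
    by (rule uniformity_cylinder_def)
  show "open U \<longleftrightarrow> (\<forall>x\<in>U. \<forall>\<^sub>F (x', y) in uniformity. x' = x \<longrightarrow> y \<in> U)" for U :: "'a cylinder set"
    by (rule open_cylinder_def)
  show "dist p q = 0 \<longleftrightarrow> p = q" for p q :: "'a cylinder"
  proof transfer
    fix x y :: "real^'a"
    show "(INF m. cyl_norm (x - y) m) = 0 \<longleftrightarrow> cyl_rel x y"
    proof
      assume "cyl_rel x y"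
      then obtain m where "cyl_norm (x - y) m = 0" unfolding cyl_rel_def by auto
      moreover have "(INF m. cyl_norm (x - y) m) \<le> cyl_norm (x - y) m"
        by (rule cINF_lower[OF cyl_norm_bdd]) simp
      moreover have "0 \<le> (INF m. cyl_norm (x - y) m)"
        by (rule cINF_greatest) auto
      ultimately show "(INF m. cyl_norm (x - y) m) = 0" by linarith
    next
      assume inf: "(INF m. cyl_norm (x - y) m) = 0"
      have ex: "\<exists>m. cyl_norm (x - y) m < d" if "0 < d" for d
        using that inf cINF_less_iff[OF _ cyl_norm_bdd, of "x - y" d] by auto
      obtain m where m: "cyl_norm (x - y) m < 1" using ex[of 1] by auto
      have "cyl_norm (x - y) m \<le> d" if d: "0 < d" for d
      proof -
        obtain m' where m': "cyl_norm (x - y) m' < min d 1" using ex[of "min d 1"] d by auto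
        then have "m' = m" using m by (intro cyl_norm_unique[of "x - y"]) auto
        then show ?thesis using m' by simp
      qed
      then have "cyl_norm (x - y) m \<le> 0" by (rule field_le_epsilon[of _ 0, simplified])
      then have "x - y = (2 * pi * of_int m) *\<^sub>R diag_vec" by simp
      then show "cyl_rel x y" unfolding cyl_rel_def by blast
    qed
  qed
  show "dist p q \<le> dist p r + dist q r" for p q r :: "'a cylinder"
  proof transfer
    fix x y z :: "real^'a"
    have step: "(INF m. cyl_norm (x - y) m) \<le> cyl_norm (x - z) a + cyl_norm (y - z) b" for a b
    proof -
      have "(INF m. cyl_norm (x - y) m) \<le> cyl_norm (x - y) (a - b)"
        by (rule cINF_lower[OF cyl_norm_bdd]) simp
      also have "\<dots> = norm ((x - z - (2 * pi * of_int a) *\<^sub>R diag_vec)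
          - (y - z - (2 * pi * of_int b) *\<^sub>R diag_vec))"
        by (simp add: algebra_simps)
      also have "\<dots> \<le> cyl_norm (x - z) a + cyl_norm (y - z) b"
        by (rule norm_triangle_ineq4)
      finally show ?thesis .
    qed
    have "(INF m. cyl_norm (x - y) m) - cyl_norm (x - z) a \<le> (INF m. cyl_norm (y - z) m)" for a
      by (rule cINF_greatest) (use step in \<open>auto simp: algebra_simps\<close>)
    then have "(INF m. cyl_norm (x - y) m) - (INF m. cyl_norm (y - z) m) \<le> (INF m. cyl_norm (x - z) m)"
      by (intro cINF_greatest) (auto simp: algebra_simps)
    then show "(INF m. cyl_norm (x - y) m) \<le> (INF m. cyl_norm (x - z) m) + (INF m. cyl_norm (y - z) m)"
      by linarith
  qed
qed

end

text \<open>The flow induced on the quotient; the value does not depend on the representative.\<close>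

definition cyl_flow ::
    "real \<Rightarrow> 'n rvec \<Rightarrow> 'n rvec \<Rightarrow> real \<Rightarrow> 'n cylinder \<Rightarrow> 'n sample \<Rightarrow> 'n::{finite,linorder} cylinder" where
  "cyl_flow k \<alpha> \<epsilon> t p \<omega> =
     (THE q. \<forall>x. cyl_proj x = p \<longrightarrow> q = cyl_proj (flow k \<alpha> \<epsilon> t x \<omega>))"


section \<open>Random sets and attractors\<close>

text \<open>
  The measure \<open>Q\<close> carries the set of sample points as its space; families of sets are
  constrained on that space only.
\<close>

definition random_set :: "'w measure \<Rightarrow> ('w \<Rightarrow> 'x::metric_space set) \<Rightarrow> bool" where
  "random_set Q B \<longleftrightarrow>
     (\<forall>\<omega>\<in>space Q. B \<omega> \<noteq> {}) \<and> (\<forall>x. (\<lambda>\<omega>. infdist x (B \<omega>)) \<in> borel_measurable Q)"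

definition random_compact_set :: "'w measure \<Rightarrow> ('w \<Rightarrow> 'x::metric_space set) \<Rightarrow> bool" where
  "random_compact_set Q B \<longleftrightarrow> random_set Q B \<and> (\<forall>\<omega>\<in>space Q. compact (B \<omega>))"

definition tempered ::
    "'w measure \<Rightarrow> (real \<Rightarrow> 'w \<Rightarrow> 'w) \<Rightarrow> ('w \<Rightarrow> 'x::metric_space set) \<Rightarrow> bool" where
  "tempered Q \<theta> B \<longleftrightarrow>
     (\<exists>q r. r \<in> borel_measurable Q \<and>
        (\<forall>\<omega>\<in>space Q. 0 \<le> r \<omega> \<and> B \<omega> \<subseteq> cball q (r \<omega>) \<and>
           (\<forall>\<delta>>0. bdd_above (range (\<lambda>t::real. exp (- \<delta> * \<bar>t\<bar>) * r (\<theta> t \<omega>))))))"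

definition semidist :: "'x::metric_space set \<Rightarrow> 'x set \<Rightarrow> ennreal" where
  "semidist B1 B2 = (SUP x\<in>B1. ennreal (infdist x B2))"

definition global_random_attractor ::
    "'w measure \<Rightarrow> (real \<Rightarrow> 'w \<Rightarrow> 'w) \<Rightarrow> (real \<Rightarrow> 'x \<Rightarrow> 'w \<Rightarrow> 'x::metric_space) \<Rightarrow> ('w \<Rightarrow> 'x set) \<Rightarrow> bool" where
  "global_random_attractor Q \<theta> \<Phi> A \<longleftrightarrow>
     random_compact_set Q A \<and> tempered Q \<theta> A \<and>
     (\<forall>t. \<forall>\<omega>\<in>space Q. (\<lambda>p. \<Phi> t p \<omega>) ` A \<omega> = A (\<theta> t \<omega>)) \<and>
     (\<forall>D. random_set Q D \<and> tempered Q \<theta> D \<longrightarrow>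
        (\<forall>\<omega>\<in>space Q.
           ((\<lambda>t. semidist ((\<lambda>p. \<Phi> t p (\<theta> (- t) \<omega>)) ` D (\<theta> (- t) \<omega>)) (A \<omega>)) \<longlongrightarrow> 0) at_top))"


section \<open>Cone field, conal curves, one-dimensional manifolds\<close>

definition cone_gamma :: "real \<Rightarrow> nat \<Rightarrow> real" where
  "cone_gamma k i = inverse (1 + 2 * real i / k)"

definition cone_beta :: "real \<Rightarrow> nat \<Rightarrow> real" where
  "cone_beta k i = inverse (1 - 2 * real i / k)"

text \<open>The cone does not in fact depend on the base point \<open>(\<omega>, p)\<close>.\<close>

definition cone_field ::
    "real \<Rightarrow> 'n sample \<Rightarrow> 'n cylinder \<Rightarrow> 'n::{finite,linorder} rvec set" where
  "cone_field k \<omega> p =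
     {v. \<forall>i j. coord_no j = Suc (coord_no i) \<longrightarrow>
          cone_gamma k (coord_no i) * v $ i \<le> v $ j \<and> v $ j \<le> cone_beta k (coord_no i) * v $ i}"

text \<open>
  Derivative of a curve in the quotient, with the tangent spaces identified with \<open>real^'n\<close>
  through the covering projection: near \<open>s\<close> the curve is compared with a lift that is
  differentiable at \<open>s\<close>.
\<close>

definition cyl_has_derivative ::
    "(real \<Rightarrow> 'n::finite cylinder) \<Rightarrow> 'n rvec \<Rightarrow> real \<Rightarrow> real set \<Rightarrow> bool" where
  "cyl_has_derivative c v s S \<longleftrightarrow>
     (\<exists>g. cyl_proj (g s) = c s \<and> (\<forall>\<^sub>F r in at s within S. cyl_proj (g r) = c r) \<and>
          (g has_vector_derivative v) (at s within S))"

definition random_conal_curve ::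
    "'w measure \<Rightarrow> ('w \<Rightarrow> 'n::finite cylinder \<Rightarrow> 'n rvec set) \<Rightarrow> real \<Rightarrow> real \<Rightarrow>
     (real \<Rightarrow> 'w \<Rightarrow> 'n cylinder) \<Rightarrow> bool" where
  "random_conal_curve Q C s0 s1 \<eta> \<longleftrightarrow>
     s0 < s1 \<and>
     (\<forall>\<omega>\<in>space Q. \<exists>\<eta>'. continuous_on {s0..s1} \<eta>' \<and>
        (\<forall>s\<in>{s0..s1}. cyl_has_derivative (\<lambda>s. \<eta> s \<omega>) (\<eta>' s) s {s0..s1})) \<and>
     (\<forall>\<omega>\<in>space Q. \<forall>s\<in>{s0..s1}. \<forall>v.
        cyl_has_derivative (\<lambda>s. \<eta> s \<omega>) v s {s0..s1} \<longrightarrow> v \<in> C \<omega> (\<eta> s \<omega>)) \<and>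
     random_set Q (\<lambda>\<omega>. (\<lambda>s. \<eta> s \<omega>) ` {s0..s1})"

definition closed_random_conal_curve ::
    "'w measure \<Rightarrow> ('w \<Rightarrow> 'n::finite cylinder \<Rightarrow> 'n rvec set) \<Rightarrow> real \<Rightarrow> real \<Rightarrow>
     (real \<Rightarrow> 'w \<Rightarrow> 'n cylinder) \<Rightarrow> bool" where
  "closed_random_conal_curve Q C s0 s1 \<eta> \<longleftrightarrow>
     random_conal_curve Q C s0 s1 \<eta> \<and> (\<forall>\<omega>\<in>space Q. \<eta> s0 \<omega> = \<eta> s1 \<omega>)"

definition one_dim_manifold :: "'a topology \<Rightarrow> bool" where
  "one_dim_manifold X \<longleftrightarrow>
     Hausdorff_space X \<and> second_countable X \<and>
     (\<forall>x\<in>topspace X. \<exists>U V. openin X U \<and> x \<in> U \<and> open (V :: real set) \<and>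
        subtopology X U homeomorphic_space top_of_set V)"

end

theory Submission
  imports Defs
begin

text \<open>
  The first coordinate obeys a scalar equation of its own, and the gap between each later
  coordinate and its predecessor is damped at rate \<open>k\<close>; hence gaps are eventually controlled by a
  tempered radius, and the attractor consists of the initial values of the entire solutions all of
  whose gaps stay below that radius.  Every value of the first coordinate is attained by such a
  solution (pull back solutions with vanishing gaps).

  If \<open>k > 2 * (N - 1)\<close>, differences \<open>d\<close> of entire solutions satisfy a linear cascade
  \<open>d\<^sub>i' = k * (d\<^sub>i\<^sub>-\<^sub>1 - d\<^sub>i) - c\<^sub>i * d\<^sub>i\<close> with \<open>\<bar>c\<^sub>i\<bar> \<le> 1\<close>, whose decay rate \<open>k - 1 > 1\<close> exceeds the
  backward growth rate of \<open>d\<close>.  So \<open>d\<close> is determined by its first coordinate, the attractor is a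
  graph over the circle, and \<open>d\<^sub>i\<^sub>+\<^sub>1 - \<gamma>\<^sub>i * d\<^sub>i\<close> and \<open>\<beta>\<^sub>i * d\<^sub>i - d\<^sub>i\<^sub>+\<^sub>1\<close>, being supersolutions of the damped
  equation, are nonnegative.  Difference quotients solve cascades with converging coefficients, which
  makes the graph continuously differentiable with derivative in the cone.
\<close>

section \<open>Differential equations, differentiability and measurability\<close>

text \<open>The dynamics is studied along one fixed path, for a deterministic pair \<open>z\<close>,
  \<open>R\<close> obeying the inequalities of \<open>coupled_rde\<close>; randomness returns only
  for measurability and temperedness. The obstacle there is that entire solutions refer to all
  times, so measurable dependence of the attractor on the noise is not visible. The distance to it
  is therefore expressed by countably many pullback images \<open>stage n\<close> of the absorbing
  set, each the image of one deterministic set under a flow that is a limit of measurable Picard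
  iterates. The variational equation is never solved: difference quotients of entire solutions,
  normalised to first coordinate 1 at time 0, are bounded by the constant \<open>spread\<close>, and
  any two sequences of them with labels tending to the same point approach each other, so
  compactness supplies the derivative. The threshold \<open>2 * (N - 1)\<close> keeps every
  \<open>cone_beta\<close> finite and positive, and for \<open>N \<ge> 2\<close> it also gives the
  rate \<open>k - 1 > 1\<close>. The second half of the theorem concerns every attractor, hence
  uniqueness is proved as well.\<close>

definition prim :: "(real \<Rightarrow> 'a::euclidean_space) \<Rightarrow> real \<Rightarrow> 'a" where
  "prim g t = integral {0..t} g - integral {t..0} g"

lemma prim_has_vector_derivative:
  fixes g :: "real \<Rightarrow> 'a::euclidean_space"
  assumes g: "continuous_on UNIV g"
  shows "(prim g has_vector_derivative g t) (at t)"
proof -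
  \<comment> \<open>\<open>prim\<close> is the oriented integral from 0: one of its two intervals is
    empty or degenerate, which settles backward times as well. The base point \<open>a\<close> lies
    to the left of both 0 and \<open>t\<close>, so near \<open>t\<close> the function
    \<open>prim g\<close> differs from an ordinary integral by a constant.\<close>
  define a where "a = - \<bar>t\<bar> - 1"
  have gi: "g integrable_on {x..y}" for x y
    by (rule integrable_continuous_interval) (rule continuous_on_subset[OF g], simp)
  have eq: "prim g s = integral {a..s} g - integral {a..0} g" if "a \<le> s" for s
  proof (cases "0 \<le> s")
    case True
    have "integral {a..0} g + integral {0..s} g = integral {a..s} g"
      by (rule Henstock_Kurzweil_Integration.integral_combine) (use True gi in \<open>auto simp: a_def\<close>)
    moreover have "integral {s..0} g = 0" using True by (cases "s = 0") auto
    ultimately show ?thesis unfolding prim_def by (simp add: algebra_simps)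
  next
    case False
    have "integral {a..s} g + integral {s..0} g = integral {a..0} g"
      by (rule Henstock_Kurzweil_Integration.integral_combine) (use False that gi in auto)
    moreover have "integral {0..s} g = 0" using False by auto
    ultimately show ?thesis unfolding prim_def by (simp add: algebra_simps)
  qed
  have "((\<lambda>s. integral {a..s} g) has_vector_derivative g t) (at t within {a..\<bar>t\<bar>+1})"
    by (rule integral_has_vector_derivative)
      (use g in \<open>auto simp: a_def intro: continuous_on_subset\<close>)
  moreover have "at t within {a..\<bar>t\<bar>+1} = at t"
    by (rule at_within_interior) (auto simp: a_def)
  ultimately have "((\<lambda>s. integral {a..s} g) has_vector_derivative g t) (at t)" by simp
  then have "((\<lambda>s. integral {a..s} g - integral {a..0} g) has_vector_derivative g t) (at t)"
    by (auto intro!: derivative_eq_intros)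
  then show ?thesis
  proof (rule has_vector_derivative_transform_within_open)
    show "open {a<..}" "t \<in> {a<..}" by (auto simp: a_def)
  qed (use eq in auto)
qed

lemma prim_0 [simp]: "prim g 0 = 0"
  by (simp add: prim_def)

lemma prim_has_real_derivative:
  fixes g :: "real \<Rightarrow> real"
  assumes "continuous_on UNIV g"
  shows "(prim g has_real_derivative g t) (at t)"
  using prim_has_vector_derivative[OF assms, of t] by (simp add: has_real_derivative_iff_has_vector_derivative)

lemma norm_diff_le_of_deriv:
  fixes f :: "real \<Rightarrow> 'a::euclidean_space"
  assumes f: "\<And>t. (f has_vector_derivative f' t) (at t)"
    and g: "\<And>t. (g has_real_derivative g' t) (at t)"
    and b: "\<And>t. a \<le> t \<Longrightarrow> t \<le> b \<Longrightarrow> norm (f' t) \<le> g' t"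
    and ab: "a \<le> b"
  shows "norm (f b - f a) \<le> g b - g a"
proof (cases "a = b")
  case False
  then have "a < b" using ab by simp
  then show ?thesis
  proof (rule differentiable_bound_general)
    show "continuous_on {a..b} f" using f
      by (meson continuous_at_imp_continuous_on has_vector_derivative_continuous)
    show "continuous_on {a..b} g" using g
      by (meson continuous_at_imp_continuous_on DERIV_isCont)
    show "(f has_vector_derivative f' x) (at x)" for x by (rule f)
    show "(g has_vector_derivative g' x) (at x)" for x
      using g[of x] by (simp add: has_real_derivative_iff_has_vector_derivative)
  qed (use b in auto)
qed auto

text \<open>The weight \<open>exp (2 * L * \<bar>t\<bar>)\<close> makes the Picard operator a contraction with factor one half.\<close>

lemma prim_weighted_bound:
  fixes f :: "real \<Rightarrow> 'a::euclidean_space"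
  assumes f: "continuous_on UNIV f" and L: "0 < L" and M: "0 \<le> M"
    and b: "\<And>s. \<bar>s\<bar> \<le> \<bar>t\<bar> \<Longrightarrow> norm (f s) \<le> L * M * exp (2 * L * \<bar>s\<bar>)"
  shows "norm (prim f t) \<le> M / 2 * exp (2 * L * \<bar>t\<bar>)"
proof (cases "0 \<le> t")
  case True
  have "norm (prim f t - prim f 0) \<le> M / 2 * exp (2 * L * t) - M / 2 * exp (2 * L * 0)"
  proof (rule norm_diff_le_of_deriv)
    show "(prim f has_vector_derivative f s) (at s)" for s
      by (rule prim_has_vector_derivative[OF f])
    show "((\<lambda>s. M / 2 * exp (2 * L * s)) has_real_derivative L * M * exp (2 * L * s)) (at s)" for s
      by (auto intro!: derivative_eq_intros)
    show "norm (f s) \<le> L * M * exp (2 * L * s)" if "0 \<le> s" "s \<le> t" for s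
      using b[of s] that by simp
  qed (use True in simp)
  then show ?thesis using True M by simp
next
  case False
  have "norm (prim f 0 - prim f t) \<le> - M / 2 * exp (- 2 * L * 0) - (- M / 2 * exp (- 2 * L * t))"
  proof (rule norm_diff_le_of_deriv)
    show "(prim f has_vector_derivative f s) (at s)" for s
      by (rule prim_has_vector_derivative[OF f])
    show "((\<lambda>s. - M / 2 * exp (- 2 * L * s)) has_real_derivative L * M * exp (- 2 * L * s)) (at s)" for s
      by (auto intro!: derivative_eq_intros)
    show "norm (f s) \<le> L * M * exp (- 2 * L * s)" if "t \<le> s" "s \<le> 0" for s
      using b[of s] that by simp
  qed (use False in simp)
  then show ?thesis using False M by simp
qed

section \<open>Global existence by Picard iteration\<close>

primrec picard :: "(real \<Rightarrow> 'a \<Rightarrow> 'a::euclidean_space) \<Rightarrow> 'a \<Rightarrow> nat \<Rightarrow> real \<Rightarrow> 'a" where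
  "picard F x 0 = (\<lambda>t. x)"
| "picard F x (Suc n) = (\<lambda>t. x + prim (\<lambda>s. F s (picard F x n s)) t)"

lemma continuous_on_field_compose:
  assumes "continuous_on UNIV (\<lambda>(t, x). F t x)" "continuous_on UNIV u"
  shows "continuous_on UNIV (\<lambda>s. F s (u s))"
proof -
  have "continuous_on UNIV ((\<lambda>(t, x). F t x) \<circ> (\<lambda>s. (s, u s)))"
    by (rule continuous_on_compose) (auto intro!: continuous_intros assms continuous_on_subset[OF assms(1)])
  then show ?thesis by (simp add: o_def)
qed

lemma continuous_picard:
  assumes F: "continuous_on UNIV (\<lambda>(t, x). F t x)"
  shows "continuous_on UNIV (picard F x n)"
proof (induction n)
  case (Suc n)
  have "continuous_on UNIV (prim (\<lambda>s. F s (picard F x n s)))"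
    using prim_has_vector_derivative[OF continuous_on_field_compose[OF F Suc.IH]]
    by (meson continuous_at_imp_continuous_on has_vector_derivative_continuous)
  then show ?case by (auto intro!: continuous_intros)
qed simp

text \<open>The Lipschitz constant is uniform in time and state, so the solution exists on the whole
  line. Convergence of the iterates is part of the conclusion because \<open>flow_measurable\<close>
  inherits measurability in the noise from them.\<close>

lemma picard_lindeloef:
  fixes F :: "real \<Rightarrow> 'a \<Rightarrow> 'a::euclidean_space"
  assumes F: "continuous_on UNIV (\<lambda>(t, x). F t x)"
    and lip: "\<And>t x y. norm (F t x - F t y) \<le> L * norm (x - y)" and L: "0 < L"
  obtains u where "u 0 = x" "\<And>t. (u has_vector_derivative F t (u t)) (at t)"
    "\<And>t. (\<lambda>n. picard F x n t) \<longlonglongrightarrow> u t"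
proof -
  let ?P = "picard F x"
  have cP: "continuous_on UNIV (?P n)" for n by (rule continuous_picard[OF F])
  have cF: "continuous_on UNIV (\<lambda>s. F s (u s))" if "continuous_on UNIV u" for u
    by (rule continuous_on_field_compose[OF F that])
  have prim_diff: "prim f t - prim g t = prim (\<lambda>s. f s - g s) t"
    if "continuous_on UNIV f" "continuous_on UNIV g" for f g :: "real \<Rightarrow> 'a" and t
  proof -
    have i: "f integrable_on {a..b}" "g integrable_on {a..b}" for a b
      using that by (auto intro!: integrable_continuous_interval intro: continuous_on_subset)
    show ?thesis unfolding prim_def by (simp add: Henstock_Kurzweil_Integration.integral_diff i)
  qed
  \<comment> \<open>Geometric decay in the weighted norm; only the constant \<open>M\<close>, taken
    from the first increment, depends on the window \<open>[-T, T]\<close>.\<close>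
  have step: "\<exists>M\<ge>0. \<forall>n t. \<bar>t\<bar> \<le> T \<longrightarrow> norm (?P (Suc n) t - ?P n t) \<le> M * (1/2)^n * exp (2 * L * \<bar>t\<bar>)" for T
  proof -
    have "continuous_on {-T..T} (\<lambda>t. ?P 1 t - ?P 0 t)"
      by (intro continuous_intros continuous_on_subset[OF cP]) auto
    then have "bounded ((\<lambda>t. ?P 1 t - ?P 0 t) ` {-T..T})"
      by (intro compact_imp_bounded compact_continuous_image) auto
    then obtain M where M: "0 < M" "\<And>t. \<bar>t\<bar> \<le> T \<Longrightarrow> norm (?P 1 t - ?P 0 t) \<le> M"
      unfolding bounded_pos by (auto simp: abs_le_iff minus_le_iff)
    have "\<bar>t\<bar> \<le> T \<Longrightarrow> norm (?P (Suc n) t - ?P n t) \<le> M * (1/2)^n * exp (2 * L * \<bar>t\<bar>)" for n t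
    proof (induction n arbitrary: t)
      case 0
      have "M * 1 \<le> M * exp (2 * L * \<bar>t\<bar>)" using M(1) L by (intro mult_left_mono) auto
      then show ?case using M(2)[OF 0] by simp
    next
      case (Suc n)
      have "?P (Suc (Suc n)) t - ?P (Suc n) t = prim (\<lambda>s. F s (?P (Suc n) s) - F s (?P n s)) t"
        using prim_diff[OF cF[OF cP[of "Suc n"]] cF[OF cP[of n]], of t] by simp
      also have "norm \<dots> \<le> M * (1/2)^n / 2 * exp (2 * L * \<bar>t\<bar>)"
      proof (rule prim_weighted_bound)
        show "continuous_on UNIV (\<lambda>s. F s (?P (Suc n) s) - F s (?P n s))"
          by (intro continuous_on_diff cF cP)
        fix s assume "\<bar>s\<bar> \<le> \<bar>t\<bar>"
        then have "norm (?P (Suc n) s - ?P n s) \<le> M * (1/2)^n * exp (2 * L * \<bar>s\<bar>)"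
          using Suc by auto
        then have "L * norm (?P (Suc n) s - ?P n s) \<le> L * (M * (1/2)^n * exp (2 * L * \<bar>s\<bar>))"
          using L by (intro mult_left_mono) auto
        then show "norm (F s (?P (Suc n) s) - F s (?P n s)) \<le> L * (M * (1/2)^n) * exp (2 * L * \<bar>s\<bar>)"
          using lip[of s "?P (Suc n) s" "?P n s"] by (simp only: mult.assoc)
      qed (use L M in auto)
      finally show ?case by (simp add: mult_ac)
    qed
    then show ?thesis using M(1) by (intro exI[of _ M]) auto
  qed
  have ex: "\<exists>u. uniform_limit {-T..T} ?P u sequentially" for T :: real
  proof -
    obtain M where M: "0 \<le> M" "\<And>n t. \<bar>t\<bar> \<le> T \<Longrightarrow> norm (?P (Suc n) t - ?P n t) \<le> M * (1/2)^n * exp (2 * L * \<bar>t\<bar>)"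
      using step[of T] by auto
    have "uniformly_convergent_on {-T..T} (\<lambda>n t. \<Sum>i<n. ?P (Suc i) t - ?P i t)"
    proof (rule Weierstrass_m_test')
      show "summable (\<lambda>n. M * (1/2)^n * exp (2 * L * T))"
        by (intro summable_mult2 summable_mult summable_geometric) auto
      fix n t assume "t \<in> {-T..T}"
      then have t: "\<bar>t\<bar> \<le> T" by auto
      have "M * (1/2)^n * exp (2 * L * \<bar>t\<bar>) \<le> M * (1/2)^n * exp (2 * L * T)"
        using M(1) L t by (intro mult_left_mono) auto
      then show "norm (?P (Suc n) t - ?P n t) \<le> M * (1/2)^n * exp (2 * L * T)"
        using M(2)[OF t, of n] by linarith
    qed
    moreover have "(\<Sum>i<n. ?P (Suc i) t - ?P i t) = ?P n t - x" for n t
      using sum_lessThan_telescope[of "\<lambda>i. ?P i t" n] by simp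
    ultimately obtain v where "uniform_limit {-T..T} (\<lambda>n t. ?P n t - x) v sequentially"
      unfolding uniformly_convergent_on_def by auto
    then have "uniform_limit {-T..T} (\<lambda>n t. (?P n t - x) + x) (\<lambda>t. v t + x) sequentially"
      by (intro uniform_limit_add uniform_limit_const)
    then show ?thesis by auto
  qed
  \<comment> \<open>A pointwise limit does not depend on the window, so the uniform limits on all
    \<open>[-T, T]\<close> fit together.\<close>
  define u where "u = (\<lambda>t. lim (\<lambda>n. ?P n t))"
  have ul: "uniform_limit {-T..T} ?P u sequentially" for T
  proof -
    obtain v where v: "uniform_limit {-T..T} ?P v sequentially" using ex by auto
    have "u t = v t" if "t \<in> {-T..T}" for t
      unfolding u_def using tendsto_uniform_limitI[OF v that] by (rule limI)
    then show ?thesis using v by (subst uniform_limit_cong[of _ _ ?P _ _ v]) auto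
  qed
  have pt: "(\<lambda>n. ?P n t) \<longlonglongrightarrow> u t" for t
    by (rule tendsto_uniform_limitI[OF ul[of "\<bar>t\<bar>"]]) auto
  have "continuous_on {-T<..<T} u" for T
  proof -
    have "continuous_on {-T..T} u"
    proof (rule uniform_limit_theorem[OF _ ul])
      have "continuous_on {-T..T} (?P n)" for n
        by (rule continuous_on_subset[OF cP]) simp
      then show "\<forall>\<^sub>F n in sequentially. continuous_on {-T..T} (?P n)"
        by (rule always_eventually[OF allI])
    qed simp
    then show ?thesis by (rule continuous_on_subset) auto
  qed
  then have "isCont u t" for t
    by (rule continuous_on_interior[of "{- (\<bar>t\<bar>+1)<..<\<bar>t\<bar>+1}"]) auto
  then have cu: "continuous_on UNIV u" by (simp add: continuous_at_imp_continuous_on)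
  have fp: "u t = x + prim (\<lambda>s. F s (u s)) t" for t
  proof -
    have "(\<lambda>n. prim (\<lambda>s. F s (?P n s)) t) \<longlonglongrightarrow> prim (\<lambda>s. F s (u s)) t"
    proof (rule LIMSEQ_I)
      fix r :: real assume r: "0 < r"
      \<comment> \<open>Undoes the weight at \<open>t\<close>: the weighted bound then gives
        \<open>r / 2\<close>.\<close>
      define e where "e = r / exp (2 * L * \<bar>t\<bar>)"
      have e: "0 < e" using r by (simp add: e_def)
      have "\<forall>\<^sub>F n in sequentially. \<forall>s\<in>{-\<bar>t\<bar>..\<bar>t\<bar>}. dist (?P n s) (u s) < e"
        by (rule uniform_limitD[OF ul e])
      then obtain n0 where n0': "\<forall>n\<ge>n0. \<forall>s\<in>{-\<bar>t\<bar>..\<bar>t\<bar>}. dist (?P n s) (u s) < e"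
        unfolding eventually_sequentially by auto
      have n0: "dist (?P n s) (u s) < e" if "n \<ge> n0" "\<bar>s\<bar> \<le> \<bar>t\<bar>" for n s
        using n0' that by (simp add: abs_le_iff minus_le_iff)
      show "\<exists>no. \<forall>n\<ge>no. norm (prim (\<lambda>s. F s (?P n s)) t - prim (\<lambda>s. F s (u s)) t) < r"
      proof (intro exI allI impI)
        fix n assume n: "n0 \<le> n"
        have "prim (\<lambda>s. F s (?P n s)) t - prim (\<lambda>s. F s (u s)) t = prim (\<lambda>s. F s (?P n s) - F s (u s)) t"
          by (intro prim_diff cF cP cu)
        also have "norm \<dots> \<le> e / 2 * exp (2 * L * \<bar>t\<bar>)"
        proof (rule prim_weighted_bound)
          show "continuous_on UNIV (\<lambda>s. F s (?P n s) - F s (u s))"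
            by (intro continuous_on_diff cF cP cu)
          fix s assume s: "\<bar>s\<bar> \<le> \<bar>t\<bar>"
          have "e * 1 \<le> e * exp (2 * L * \<bar>s\<bar>)" using L e by (intro mult_left_mono) auto
          then have "norm (?P n s - u s) \<le> e * exp (2 * L * \<bar>s\<bar>)"
            using n0[OF n s] by (simp add: dist_norm)
          then have "L * norm (?P n s - u s) \<le> L * (e * exp (2 * L * \<bar>s\<bar>))"
            using L by (intro mult_left_mono) auto
          then show "norm (F s (?P n s) - F s (u s)) \<le> L * e * exp (2 * L * \<bar>s\<bar>)"
            using lip[of s "?P n s" "u s"] by simp
        qed (use L e in auto)
        also have "\<dots> < r" using r by (simp add: e_def)
        finally show "norm (prim (\<lambda>s. F s (?P n s)) t - prim (\<lambda>s. F s (u s)) t) < r" .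
      qed
    qed
    then have "(\<lambda>n. ?P (Suc n) t) \<longlonglongrightarrow> x + prim (\<lambda>s. F s (u s)) t"
      by (auto intro!: tendsto_intros)
    then show ?thesis using LIMSEQ_Suc[OF pt[of t]] LIMSEQ_unique by blast
  qed
  show thesis
  proof
    show "u 0 = x" using fp[of 0] by simp
    show "(u has_vector_derivative F t (u t)) (at t)" for t
    proof -
      have "((\<lambda>t. x + prim (\<lambda>s. F s (u s)) t) has_vector_derivative F t (u t)) (at t)"
        using prim_has_vector_derivative[OF cF[OF cu], of t] by (auto intro!: derivative_eq_intros)
      then show ?thesis by (subst ext[of u, OF fp])
    qed
  qed (rule pt)
qed

section \<open>Scalar linear differential inequalities\<close>

lemma linear_diff_ineq_nonneg:
  fixes w :: "real \<Rightarrow> real"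
  assumes w: "\<And>t. s \<le> t \<Longrightarrow> t \<le> T \<Longrightarrow> (w has_real_derivative w' t) (at t)"
    and ineq: "\<And>t. s \<le> t \<Longrightarrow> t \<le> T \<Longrightarrow> - a t * w t \<le> w' t"
    and a: "continuous_on UNIV a" and s: "0 \<le> w s" "s \<le> T"
  shows "0 \<le> w T"
proof -
  \<comment> \<open>\<open>exp (prim a)\<close> is the integrating factor; the inequality makes its
    product with \<open>w\<close> nondecreasing.\<close>
  have "exp (prim a s) * w s \<le> exp (prim a T) * w T"
  proof (rule DERIV_nonneg_imp_nondecreasing[OF \<open>s \<le> T\<close>])
    fix x assume x: "s \<le> x" "x \<le> T"
    have "((\<lambda>t. exp (prim a t) * w t) has_real_derivative exp (prim a x) * (w' x + a x * w x)) (at x)"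
      by (auto intro!: derivative_eq_intros prim_has_real_derivative[OF a] w[OF x] simp: algebra_simps)
    moreover have "0 \<le> w' x + a x * w x" using ineq[OF x] by linarith
    ultimately show "\<exists>y. ((\<lambda>t. exp (prim a t) * w t) has_real_derivative y) (at x) \<and> 0 \<le> y"
      by (meson exp_ge_zero mult_nonneg_nonneg)
  qed
  then have "0 \<le> exp (prim a T) * w T" using s(1) by (smt (verit) exp_ge_zero mult_nonneg_nonneg)
  then show ?thesis by (simp add: zero_le_mult_iff)
qed

text \<open>The squared norm is differentiable even where the solutions meet. The bound on its
  derivative is two-sided, hence survives time reversal, which yields the estimate backwards in
  time.\<close>

lemma gronwall_solutions:
  fixes u v :: "real \<Rightarrow> 'a::euclidean_space"
  assumes u: "\<And>t. (u has_vector_derivative F t (u t)) (at t)"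
    and v: "\<And>t. (v has_vector_derivative F t (v t)) (at t)"
    and lip: "\<And>t x y. norm (F t x - F t y) \<le> L * norm (x - y)"
  shows "norm (u t - v t) \<le> exp (L * \<bar>t - s\<bar>) * norm (u s - v s)"
proof -
  define g where "g = (\<lambda>t. (u t - v t) \<bullet> (u t - v t))"
  define g' where "g' = (\<lambda>t. 2 * ((u t - v t) \<bullet> (F t (u t) - F t (v t))))"
  have g: "(g has_real_derivative g' t) (at t)" for t
  proof -
    have "((\<lambda>t. u t - v t) has_vector_derivative (F t (u t) - F t (v t))) (at t)"
      by (intro derivative_intros u v)
    then have "((\<lambda>t. (u t - v t) \<bullet> (u t - v t)) has_derivative
       (\<lambda>h. (u t - v t) \<bullet> (h *\<^sub>R (F t (u t) - F t (v t))) + (h *\<^sub>R (F t (u t) - F t (v t))) \<bullet> (u t - v t))) (at t)"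
      unfolding has_vector_derivative_def by (intro has_derivative_inner)
    then show ?thesis unfolding g_def g'_def has_field_derivative_def
      by (rule has_derivative_eq_rhs) (auto simp: fun_eq_iff inner_commute algebra_simps)
  qed
  have g': "\<bar>g' t\<bar> \<le> 2 * L * g t" for t
  proof -
    have "\<bar>(u t - v t) \<bullet> (F t (u t) - F t (v t))\<bar> \<le> norm (u t - v t) * norm (F t (u t) - F t (v t))"
      by (rule Cauchy_Schwarz_ineq2)
    also have "\<dots> \<le> norm (u t - v t) * (L * norm (u t - v t))"
      by (intro mult_left_mono lip) auto
    also have "\<dots> = L * g t" by (simp add: g_def power2_norm_eq_inner flip: power2_eq_square)
    finally show ?thesis by (simp add: g'_def)
  qed
  have fwd: "f t \<le> exp (2 * L * (t - s)) * f s" if "\<And>t. (f has_real_derivative f' t) (at t)"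
    "\<And>t. \<bar>f' t\<bar> \<le> 2 * L * f t" "s \<le> t" for f f' s t
  proof -
    have "0 \<le> exp (2 * L * (t - s)) * f s - f t"
    proof (rule linear_diff_ineq_nonneg[where w = "\<lambda>x. exp (2 * L * (x - s)) * f s - f x" and a = "\<lambda>_. - 2 * L" and s = s])
      fix x
      show "((\<lambda>x. exp (2 * L * (x - s)) * f s - f x) has_real_derivative 2 * L * exp (2 * L * (x - s)) * f s - f' x) (at x)"
        by (auto intro!: derivative_eq_intros that)
      show "- (- 2 * L) * (exp (2 * L * (x - s)) * f s - f x) \<le> 2 * L * exp (2 * L * (x - s)) * f s - f' x"
        using that(2)[of x] by (simp add: algebra_simps abs_le_iff)
    qed (use that in auto)
    then show ?thesis by simp
  qed
  have "g t \<le> exp (2 * L * \<bar>t - s\<bar>) * g s"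
  proof (cases "s \<le> t")
    case True
    then show ?thesis using fwd[OF g g', of s t] by simp
  next
    case False
    have "((\<lambda>x. g (- x)) has_real_derivative - g' (- x)) (at x)" for x
    proof -
      have "(uminus has_real_derivative - 1) (at x)" by (auto intro!: derivative_eq_intros)
      from DERIV_chain2[where f = g and g = uminus, OF g[of "- x"] this] show ?thesis by simp
    qed
    from fwd[OF this, of "- s" "- t"] show ?thesis using g' False by simp
  qed
  moreover have "exp (2 * L * \<bar>t - s\<bar>) = (exp (L * \<bar>t - s\<bar>))\<^sup>2"
    by (simp add: power2_eq_square flip: exp_add)
  ultimately have "(norm (u t - v t))\<^sup>2 \<le> (exp (L * \<bar>t - s\<bar>) * norm (u s - v s))\<^sup>2"
    by (simp add: g_def power2_norm_eq_inner power_mult_distrib)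
  then show ?thesis by (rule power2_le_imp_le) simp
qed

lemma linear_ode_solution:
  fixes f :: "real \<Rightarrow> real"
  assumes f: "\<And>t. (f has_real_derivative - c t * f t) (at t)" and c: "continuous_on UNIV c"
  shows "f t = f 0 * exp (- prim c t)"
proof -
  have "((\<lambda>t. exp (prim c t) * f t) has_real_derivative 0) (at x)" for x
    by (auto intro!: derivative_eq_intros prim_has_real_derivative[OF c] f)
  then have "exp (prim c t) * f t = exp (prim c 0) * f 0"
    by (rule DERIV_isconst_all[rule_format])
  then show ?thesis by (simp add: exp_minus field_simps)
qed

lemma abs_prim_le:
  assumes c: "continuous_on UNIV c" and b: "\<And>t. \<bar>c t\<bar> \<le> (1::real)"
  shows "\<bar>prim c t\<bar> \<le> \<bar>t\<bar>"
proof (cases "0 \<le> t")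
  case True
  have "norm (prim c t - prim c 0) \<le> t - 0"
    by (rule norm_diff_le_of_deriv[of _ c _ "\<lambda>_. 1"])
      (use True b in \<open>auto intro!: prim_has_vector_derivative[OF c]\<close>)
  then show ?thesis using True by simp
next
  case False
  have "norm (prim c 0 - prim c t) \<le> 0 - t"
    by (rule norm_diff_le_of_deriv[of _ c _ "\<lambda>_. 1"])
      (use False b in \<open>auto intro!: prim_has_vector_derivative[OF c]\<close>)
  then show ?thesis using False by simp
qed

text \<open>A decay rate larger than the admissible backward growth rate leaves no room for negative values.\<close>

lemma backward_growth_nonneg:
  fixes p :: "real \<Rightarrow> real"
  assumes p: "\<And>t. t \<le> 0 \<Longrightarrow> (p has_real_derivative p' t) (at t)"
    and ineq: "\<And>t. t \<le> 0 \<Longrightarrow> - a t * p t \<le> p' t"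
    and a: "continuous_on UNIV a" "\<And>t. \<kappa> \<le> a t" and \<kappa>: "1 < \<kappa>"
    and growth: "\<And>t. t \<le> 0 \<Longrightarrow> - M * exp (- t) \<le> p t" and t0: "t0 \<le> 0"
  shows "0 \<le> p t0"
proof -
  \<comment> \<open>\<open>M\<close> may be negative; the comparison function below must not
    be.\<close>
  define M' where "M' = max M 0"
  have growth': "- M' * exp (- t) \<le> p t" if "t \<le> 0" for t
  proof -
    have "M * exp (- t) \<le> M' * exp (- t)" by (intro mult_right_mono) (auto simp: M'_def)
    then show ?thesis using growth[OF that] by linarith
  qed
  \<comment> \<open>Started at \<open>s\<close> from the worst admissible value, the negative part
    decays at rate \<open>\<kappa>\<close>; what is left at \<open>t0\<close> is of order
    \<open>exp ((\<kappa> - 1) * s)\<close> and vanishes as the starting time recedes.\<close>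
  have lower: "- (M' * exp (- \<kappa> * t0)) * exp ((\<kappa> - 1) * s) \<le> p t0" if s: "s \<le> t0" for s
  proof -
    define m where "m = (\<lambda>t. M' * exp (- s) * exp (- \<kappa> * (t - s)))"
    have m: "(m has_real_derivative - \<kappa> * m t) (at t)" for t
      unfolding m_def by (auto intro!: derivative_eq_intros)
    have m0: "0 \<le> m t" for t by (simp add: m_def M'_def)
    have "0 \<le> p t0 + m t0"
    proof (rule linear_diff_ineq_nonneg[OF _ _ a(1) _ s])
      fix t assume t: "s \<le> t" "t \<le> t0"
      show "((\<lambda>t. p t + m t) has_real_derivative (p' t + - \<kappa> * m t)) (at t)"
        using p[of t] m t t0 by (intro DERIV_add) auto
      have "\<kappa> * m t \<le> a t * m t" using a(2) m0 by (intro mult_right_mono)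
      then show "- a t * (p t + m t) \<le> p' t + - \<kappa> * m t"
        using ineq[of t] t t0 by (simp add: algebra_simps)
    next
      show "0 \<le> p s + m s" using growth'[of s] s t0 by (simp add: m_def)
    qed
    moreover have "m t0 = M' * exp (- \<kappa> * t0) * exp ((\<kappa> - 1) * s)"
      by (simp add: m_def algebra_simps flip: exp_add)
    ultimately show ?thesis by simp
  qed
  have "((\<lambda>s. exp ((\<kappa> - 1) * s)) \<longlongrightarrow> 0) at_bot"
    using \<kappa> by (intro filterlim_compose[OF exp_at_bot] filterlim_tendsto_pos_mult_at_bot[OF tendsto_const]) (auto simp: filterlim_ident)
  then have lim: "((\<lambda>s. - (M' * exp (- \<kappa> * t0)) * exp ((\<kappa> - 1) * s)) \<longlongrightarrow> - (M' * exp (- \<kappa> * t0)) * 0) at_bot"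
    by (intro tendsto_intros)
  have "- (M' * exp (- \<kappa> * t0)) * 0 \<le> p t0"
    by (rule tendsto_upperbound[OF lim]) (use lower in \<open>auto intro!: eventually_mono[OF eventually_le_at_bot[of t0]]\<close>)
  then show ?thesis by simp
qed

lemma abs_le_supersolution:
  fixes e :: "real \<Rightarrow> real"
  assumes e: "\<And>t. s \<le> t \<Longrightarrow> t \<le> T \<Longrightarrow> (e has_real_derivative f t - a t * e t) (at t)"
    and m: "\<And>t. (m has_real_derivative m' t) (at t)"
    and f: "\<And>t. s \<le> t \<Longrightarrow> t \<le> T \<Longrightarrow> \<bar>f t\<bar> \<le> m' t + a t * m t"
    and a: "continuous_on UNIV a" and s: "\<bar>e s\<bar> \<le> m s" "s \<le> T"
  shows "\<bar>e T\<bar> \<le> m T"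
proof -
  have "0 \<le> m T - e T"
  proof (rule linear_diff_ineq_nonneg[where w = "\<lambda>t. m t - e t", OF _ _ a _ s(2)])
    fix t assume t: "s \<le> t" "t \<le> T"
    show "((\<lambda>t. m t - e t) has_real_derivative (m' t - (f t - a t * e t))) (at t)"
      by (intro DERIV_diff m e t)
    show "- a t * (m t - e t) \<le> m' t - (f t - a t * e t)"
      using f[OF t] by (simp add: algebra_simps)
  qed (use s in simp)
  moreover have "0 \<le> m T + e T"
  proof (rule linear_diff_ineq_nonneg[where w = "\<lambda>t. m t + e t", OF _ _ a _ s(2)])
    fix t assume t: "s \<le> t" "t \<le> T"
    show "((\<lambda>t. m t + e t) has_real_derivative (m' t + (f t - a t * e t))) (at t)"
      by (intro DERIV_add m e t)
    show "- a t * (m t + e t) \<le> m' t + (f t - a t * e t)"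
      using f[OF t] by (simp add: algebra_simps)
  qed (use s in simp)
  ultimately show ?thesis by simp
qed

lemma linear_forced_bound:
  fixes e :: "real \<Rightarrow> real"
  assumes e: "\<And>t. s \<le> t \<Longrightarrow> t \<le> T \<Longrightarrow> (e has_real_derivative f t - a t * e t) (at t)"
    and f: "\<And>t. s \<le> t \<Longrightarrow> t \<le> T \<Longrightarrow> \<bar>f t\<bar> \<le> F"
    and a: "continuous_on UNIV a" "\<And>t. \<kappa> \<le> a t" and \<kappa>: "0 < \<kappa>" and sT: "s \<le> T"
  shows "\<bar>e T\<bar> \<le> \<bar>e s\<bar> * exp (- \<kappa> * (T - s)) + F / \<kappa>"
proof -
  have F: "0 \<le> F / \<kappa>" using f[of s] sT \<kappa> abs_ge_zero order_trans by (intro divide_nonneg_pos) blast+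
  \<comment> \<open>Solves \<open>m' = F - \<kappa> * m\<close>; as it is nonnegative, a rate
    \<open>a\<close> larger than \<open>\<kappa>\<close> only helps.\<close>
  define m where "m = (\<lambda>t. \<bar>e s\<bar> * exp (- \<kappa> * (t - s)) + F / \<kappa>)"
  have "\<bar>e T\<bar> \<le> m T"
  proof (rule abs_le_supersolution[OF e _ _ a(1) _ sT])
    show "(m has_real_derivative - \<kappa> * (\<bar>e s\<bar> * exp (- \<kappa> * (t - s)))) (at t)" for t
      unfolding m_def by (auto intro!: derivative_eq_intros)
    fix t assume t: "s \<le> t" "t \<le> T"
    have "\<kappa> * m t \<le> a t * m t" using a(2) F by (intro mult_right_mono) (auto simp: m_def)
    moreover have "\<kappa> * m t = \<kappa> * (\<bar>e s\<bar> * exp (- \<kappa> * (t - s))) + F" using \<kappa> by (simp add: m_def distrib_left)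
    ultimately show "\<bar>f t\<bar> \<le> - \<kappa> * (\<bar>e s\<bar> * exp (- \<kappa> * (t - s))) + a t * m t" using f[OF t] by linarith
  qed (use F in \<open>auto simp: m_def\<close>)
  then show ?thesis by (simp only: m_def)
qed

lemma backward_forced_bound:
  fixes e :: "real \<Rightarrow> real"
  assumes e: "\<And>t. (e has_real_derivative f t - c t * e t) (at t)" and e0: "e 0 = 0"
    and f: "\<And>t. - S \<le> t \<Longrightarrow> t \<le> 0 \<Longrightarrow> \<bar>f t\<bar> \<le> F"
    and c: "continuous_on UNIV c" "\<And>t. \<bar>c t\<bar> \<le> 1" and t: "- S \<le> t" "t \<le> 0"
  shows "\<bar>e t\<bar> \<le> F * exp S"
proof -
  have F: "0 \<le> F" using f[OF t] by linarith
  \<comment> \<open>After time reversal the rate is at worst -1; \<open>m\<close> solves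
    \<open>m' = m + F\<close> with \<open>m 0 = 0\<close>.\<close>
  define m where "m = (\<lambda>t. F * (exp t - 1))"
  have "\<bar>e (- (- t))\<bar> \<le> m (- t)"
  proof (rule abs_le_supersolution[where e = "\<lambda>x. e (- x)" and f = "\<lambda>x. - f (- x)" and a = "\<lambda>x. - c (- x)" and s = 0])
    show "((\<lambda>t. e (- t)) has_real_derivative - f (- x) - - c (- x) * e (- x)) (at x)" for x
    proof -
      have "(uminus has_real_derivative - 1) (at x)" by (auto intro!: derivative_eq_intros)
      from DERIV_chain2[where f = e and g = uminus, OF e[of "- x"] this] show ?thesis by simp
    qed
    show "(m has_real_derivative F * exp x) (at x)" for x
      unfolding m_def by (auto intro!: derivative_eq_intros)
    show "continuous_on UNIV (\<lambda>x. - c (- x))"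
      by (intro continuous_intros continuous_on_compose2[OF c(1)]) auto
    fix x assume x: "0 \<le> x" "x \<le> - t"
    have "0 \<le> m x" using F x by (simp add: m_def)
    then have "c (- x) * m x \<le> 1 * m x" using c(2)[of "-x"] by (intro mult_right_mono) auto
    moreover have "\<bar>f (- x)\<bar> \<le> F" using f[of "-x"] x t by simp
    ultimately show "\<bar>- f (- x)\<bar> \<le> F * exp x + - c (- x) * m x" by (simp add: m_def algebra_simps)
  qed (use t e0 in \<open>auto simp: m_def\<close>)
  moreover have "m (- t) \<le> F * exp S"
    unfolding m_def using F t by (intro mult_left_mono) (auto intro: order_trans[of _ "exp (- t)"])
  ultimately show ?thesis by simp
qed

text \<open>The divided difference of the sine, in the form given by the sum-to-product formula.
  Writing it with \<open>sinc\<close> keeps it continuous at \<open>x = y\<close>, where it is the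
  cosine. It is the coefficient that makes the difference of two solutions satisfy a linear
  equation.\<close>

definition sin_slope :: "real \<Rightarrow> real \<Rightarrow> real" where
  "sin_slope x y = sinc ((x - y) / 2) * cos ((x + y) / 2)"

lemma sin_slope_mult: "sin_slope x y * (x - y) = sin x - sin y"
proof -
  have "sinc ((x - y) / 2) * ((x - y) / 2) = sin ((x - y) / 2)"
    by simp
  then have "sinc ((x - y) / 2) * (x - y) = 2 * sin ((x - y) / 2)" by linarith
  then have "sin_slope x y * (x - y) = 2 * sin ((x - y) / 2) * cos ((x + y) / 2)"
    unfolding sin_slope_def by (metis mult.assoc mult.commute)
  then show ?thesis by (simp add: sin_diff_sin)
qed

lemma sin_slope_self: "sin_slope x x = cos x"
  by (simp add: sin_slope_def)

lemma abs_sin_slope_le: "\<bar>sin_slope x y\<bar> \<le> 1"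
proof -
  have "\<bar>sinc z\<bar> \<le> 1" for z
    using abs_sin_x_le_abs_x[of z] by (auto simp: divide_simps)
  then have "\<bar>sinc ((x - y) / 2)\<bar> * \<bar>cos ((x + y) / 2)\<bar> \<le> 1 * 1"
    by (intro mult_mono) (simp_all only: abs_cos_le_one abs_ge_zero zero_le_one)
  then show ?thesis by (simp only: sin_slope_def abs_mult mult_1)
qed

lemma continuous_sin_slope:
  fixes f g :: "real \<Rightarrow> real"
  assumes "continuous_on UNIV f" "continuous_on UNIV g"
  shows "continuous_on UNIV (\<lambda>t. sin_slope (f t) (g t))"
  unfolding sin_slope_def
  by (rule continuous_on_mult[OF continuous_on_sinc]) (auto intro!: continuous_intros assms)

text \<open>By the mean value theorem the slope is the cosine of a point between \<open>x\<close>
  and \<open>y\<close>, and the cosine is 1-Lipschitz.\<close>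

lemma sin_slope_near_cos: "\<bar>sin_slope x y - cos w\<bar> \<le> \<bar>x - w\<bar> + \<bar>y - w\<bar>"
proof -
  have *: "\<bar>cos a - cos b\<bar> \<le> \<bar>a - b\<bar>" for a b :: real
  proof (induction a b rule: linorder_wlog)
    case (le a b)
    have "norm (cos b - cos a) \<le> b - a"
      by (rule norm_diff_le_of_deriv[of cos "\<lambda>t. - sin t" "\<lambda>t. t" "\<lambda>_. 1"])
        (use le in \<open>auto intro!: derivative_eq_intros simp: has_real_derivative_iff_has_vector_derivative[symmetric]\<close>)
    then show ?case using le by simp
  qed (simp add: abs_minus_commute)
  have lt: "\<exists>\<xi>. y \<le> \<xi> \<and> \<xi> \<le> x \<and> sin_slope x y = cos \<xi>" if "y < x" for x y
  proof -
    have "\<exists>\<xi>>y. \<xi> < x \<and> sin x - sin y = (x - y) * cos \<xi>"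
      by (rule MVT2[OF that]) (rule DERIV_sin)
    then obtain \<xi> where "y < \<xi>" "\<xi> < x" "sin x - sin y = (x - y) * cos \<xi>" by blast
    moreover from this have "(x - y) * sin_slope x y = (x - y) * cos \<xi>"
      using sin_slope_mult[of x y] by (simp only: mult.commute)
    then have "sin_slope x y = cos \<xi>" using that by simp
    ultimately show ?thesis by (intro exI[of _ \<xi>]) auto
  qed
  have sym: "sin_slope x y = sin_slope y x"
  proof -
    have "sinc ((x - y) / 2) = sinc (- ((x - y) / 2))" by (simp only: sinc_neg)
    also have "- ((x - y) / 2) = (y - x) / 2" by (simp only: minus_divide_left minus_diff_eq)
    finally show ?thesis by (simp only: sin_slope_def add.commute)
  qed
  have "\<exists>\<xi>. min x y \<le> \<xi> \<and> \<xi> \<le> max x y \<and> sin_slope x y = cos \<xi>"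
    using lt[of y x] lt[of x y] sym sin_slope_self[of x]
    by (cases x y rule: linorder_cases) (auto simp: min_def max_def)
  then obtain \<xi> where \<xi>: "min x y \<le> \<xi>" "\<xi> \<le> max x y" "sin_slope x y = cos \<xi>" by blast
  have "\<bar>\<xi> - w\<bar> \<le> \<bar>x - w\<bar> + \<bar>y - w\<bar>" using \<xi>(1,2) by (auto simp: min_def max_def split: if_splits)
  then show ?thesis using *[of \<xi> w] \<xi>(3) by linarith
qed

text \<open>Sampled on a grid of mesh \<open>1 / (n + 1)\<close>, time takes only countably many
  values, so the sampled function is jointly measurable; continuity of the paths gives the
  limit.\<close>

lemma measurable_of_continuous_paths:
  fixes f :: "'w \<Rightarrow> real \<Rightarrow> 'a::euclidean_space"
  assumes meas: "\<And>t. (\<lambda>\<omega>. f \<omega> t) \<in> borel_measurable M"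
    and cont: "\<And>\<omega>. \<omega> \<in> space M \<Longrightarrow> continuous_on UNIV (f \<omega>)"
  shows "(\<lambda>(\<omega>, t). f \<omega> t) \<in> borel_measurable (M \<Otimes>\<^sub>M borel)"
proof (rule borel_measurable_LIMSEQ_metric)
  fix n :: nat
  show "(\<lambda>(\<omega>, t). f \<omega> (of_int \<lfloor>real (Suc n) * t\<rfloor> / real (Suc n))) \<in> borel_measurable (M \<Otimes>\<^sub>M borel)"
    unfolding split_beta
    by (rule measurable_compose_countable[where f = "\<lambda>i x. f (fst x) (of_int i / real (Suc n))"])
      (auto intro!: measurable_compose[OF measurable_fst meas])
next
  fix x assume "x \<in> space (M \<Otimes>\<^sub>M (borel :: real measure))"
  then obtain \<omega> t where x: "x = (\<omega>, t)" "\<omega> \<in> space M" by (auto simp: space_pair_measure)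
  have "(\<lambda>n. of_int \<lfloor>real (Suc n) * t\<rfloor> / real (Suc n)) \<longlonglongrightarrow> t"
  proof (rule LIM_zero_cancel, rule Lim_null_comparison[OF always_eventually LIMSEQ_inverse_real_of_nat], rule allI)
    fix n
    have "of_int \<lfloor>real (Suc n) * t\<rfloor> / real (Suc n) - t = (of_int \<lfloor>real (Suc n) * t\<rfloor> - real (Suc n) * t) / real (Suc n)"
      by (simp add: diff_divide_distrib)
    moreover have "\<bar>of_int \<lfloor>real (Suc n) * t\<rfloor> - real (Suc n) * t\<bar> \<le> 1" by linarith
    ultimately show "norm (of_int \<lfloor>real (Suc n) * t\<rfloor> / real (Suc n) - t) \<le> inverse (real (Suc n))"
      by (simp only: real_norm_def abs_divide inverse_eq_divide abs_of_nat) (rule divide_right_mono, auto)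
  qed
  moreover have "isCont (f \<omega>) t" using cont[OF x(2)] by (simp add: continuous_on_eq_continuous_at)
  ultimately show "(\<lambda>n. (case x of (\<omega>, t) \<Rightarrow> f \<omega> (of_int \<lfloor>real (Suc n) * t\<rfloor> / real (Suc n)))) \<longlonglongrightarrow> (case x of (\<omega>, t) \<Rightarrow> f \<omega> t)"
    unfolding x prod.case by (intro isCont_tendsto_compose[where g = "f \<omega>"])
qed

text \<open>For continuous integrands the gauge integral agrees with the Lebesgue integral, whose
  dependence on a parameter is measurable by joint measurability of the integrand.\<close>

lemma measurable_integral_of_continuous_paths:
  fixes f :: "'w \<Rightarrow> real \<Rightarrow> 'a::euclidean_space"
  assumes meas: "\<And>t. (\<lambda>\<omega>. f \<omega> t) \<in> borel_measurable M"
    and cont: "\<And>\<omega>. \<omega> \<in> space M \<Longrightarrow> continuous_on UNIV (f \<omega>)"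
  shows "(\<lambda>\<omega>. integral {a..b} (f \<omega>)) \<in> borel_measurable M"
proof -
  have "(\<lambda>\<omega>. LINT t|lborel. indicator {a..b} t *\<^sub>R f \<omega> t) \<in> borel_measurable M"
  proof (rule lborel.borel_measurable_lebesgue_integral)
    have [measurable]: "(\<lambda>(\<omega>, t). f \<omega> t) \<in> borel_measurable (M \<Otimes>\<^sub>M borel)"
      by (rule measurable_of_continuous_paths[OF meas cont])
    have "(\<lambda>x. indicator {a..b} (snd x) *\<^sub>R (case x of (\<omega>, t) \<Rightarrow> f \<omega> t)) \<in> borel_measurable (M \<Otimes>\<^sub>M borel)"
      by measurable
    then show "(\<lambda>(\<omega>, t). indicator {a..b} t *\<^sub>R f \<omega> t) \<in> borel_measurable (M \<Otimes>\<^sub>M lborel)"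
      by (simp add: split_beta' cong: measurable_cong_sets)
  qed
  moreover have "integral {a..b} (f \<omega>) = (LINT t|lborel. indicator {a..b} t *\<^sub>R f \<omega> t)" if "\<omega> \<in> space M" for \<omega>
  proof -
    have "set_integrable lborel {a..b} (f \<omega>)"
      using borel_integrable_atLeastAtMost'[of a b "f \<omega>"] cont[OF that]
      by (auto intro: continuous_on_subset)
    then show ?thesis using set_borel_integral_eq_integral(2) by (metis set_lebesgue_integral_def)
  qed
  ultimately show ?thesis by (simp cong: measurable_cong)
qed

lemma measurable_prim_of_continuous_paths:
  fixes f :: "'w \<Rightarrow> real \<Rightarrow> 'a::euclidean_space"
  assumes meas: "\<And>t. (\<lambda>\<omega>. f \<omega> t) \<in> borel_measurable M"
    and cont: "\<And>\<omega>. \<omega> \<in> space M \<Longrightarrow> continuous_on UNIV (f \<omega>)"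
  shows "(\<lambda>\<omega>. prim (f \<omega>) t) \<in> borel_measurable M"
  unfolding prim_def by (intro borel_measurable_diff measurable_integral_of_continuous_paths assms)

lemma has_vector_derivative_iff_quotient:
  "(f has_vector_derivative v) (at b) \<longleftrightarrow> ((\<lambda>a. (f a - f b) /\<^sub>R (a - b)) \<longlongrightarrow> v) (at b)"
proof -
  have "(f has_vector_derivative v) (at b) \<longleftrightarrow>
      ((\<lambda>a. norm ((f a - f b - (a - b) *\<^sub>R v) /\<^sub>R (a - b))) \<longlongrightarrow> 0) (at b)"
    by (simp add: has_vector_derivative_def has_derivative_iff_norm divide_inverse_commute bounded_linear_scaleR_left)
  also have "\<dots> \<longleftrightarrow> ((\<lambda>a. (f a - f b) /\<^sub>R (a - b) - v) \<longlongrightarrow> 0) (at b)"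
    unfolding tendsto_norm_zero_iff
    by (rule tendsto_cong) (auto simp: eventually_at_filter scaleR_diff_right)
  finally show ?thesis by (simp only: LIM_zero_iff)
qed

text \<open>Letting both endpoints vary is what makes the derivative continuous.\<close>

lemma C1_of_difference_quotients:
  fixes h :: "real \<Rightarrow> 'a::real_normed_vector"
  assumes conv: "\<And>b0 a b. a \<longlonglongrightarrow> b0 \<Longrightarrow> b \<longlonglongrightarrow> b0 \<Longrightarrow> (\<And>n::nat. a n \<noteq> b n) \<Longrightarrow>
      (\<lambda>n. (h (a n) - h (b n)) /\<^sub>R (a n - b n)) \<longlonglongrightarrow> h' b0"
  shows "continuous_on UNIV h'" "(h has_vector_derivative h' b) (at b)"
proof -
  define q where "q = (\<lambda>a b. (h a - h b) /\<^sub>R (a - b))"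
  have q: "((\<lambda>a. q a b) \<longlongrightarrow> h' b) (at b)" for b
    unfolding q_def using conv[OF _ tendsto_const] by (subst LIMSEQ_SEQ_conv[symmetric]) blast
  then show "(h has_vector_derivative h' b) (at b)"
    by (simp add: has_vector_derivative_iff_quotient q_def)
  have "(h' \<longlongrightarrow> h' b) (at b)" for b
    unfolding LIMSEQ_SEQ_conv[symmetric]
  proof (intro allI impI)
    fix S :: "nat \<Rightarrow> real" assume "(\<forall>n. S n \<noteq> b) \<and> S \<longlonglongrightarrow> b"
    then have S: "S \<longlonglongrightarrow> b" by simp
    let ?e = "\<lambda>n. inverse (real (Suc n))"
    \<comment> \<open>Diagonal choice: next to \<open>S n\<close> a point at which the quotient
      nearly equals \<open>h' (S n)\<close>; the hypothesis on two moving endpoints then applies to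
      these pairs.\<close>
    have "\<exists>a. a \<noteq> S n \<and> norm (a - S n) \<le> ?e n \<and> norm (q a (S n) - h' (S n)) \<le> ?e n" for n
    proof -
      have e: "0 < ?e n" by simp
      have "\<forall>\<^sub>F a in at (S n). a \<noteq> S n" "\<forall>\<^sub>F a in at (S n). dist a (S n) < ?e n"
        unfolding eventually_at using e by blast+
      then have "\<forall>\<^sub>F a in at (S n). a \<noteq> S n \<and> dist a (S n) < ?e n \<and> dist (q a (S n)) (h' (S n)) < ?e n"
        by (intro eventually_conj tendstoD[OF q e])
      from eventually_happens'[OF _ this] show ?thesis by (force simp: dist_norm)
    qed
    then obtain a where a: "\<And>n. a n \<noteq> S n" "\<And>n. norm (a n - S n) \<le> ?e n"
      "\<And>n. norm (q (a n) (S n) - h' (S n)) \<le> ?e n" by metis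
    have null: "x \<longlonglongrightarrow> 0" if "\<And>n. norm (x n) \<le> ?e n" for x :: "nat \<Rightarrow> 'b::real_normed_vector"
      by (rule Lim_null_comparison[OF always_eventually LIMSEQ_inverse_real_of_nat]) (use that in blast)
    have "a \<longlonglongrightarrow> b" using tendsto_add[OF S null[OF a(2)]] by simp
    from conv[OF this S a(1)] have "(\<lambda>n. q (a n) (S n)) \<longlonglongrightarrow> h' b" by (simp add: q_def)
    from tendsto_diff[OF this null[OF a(3)]] show "(\<lambda>n. h' (S n)) \<longlonglongrightarrow> h' b" by simp
  qed
  then show "continuous_on UNIV h'" by (simp add: continuous_on_def)
qed

section \<open>The coupled system along a fixed noise path\<close>

definition coord1 :: "'n::{finite,linorder}" where
  "coord1 = (THE i. coord_no i = 1)"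

text \<open>
  Letting the first coordinate be its own predecessor absorbs the exceptional first row of
  \<open>coupling_matrix\<close> and \<open>drift_corr\<close>.
\<close>

definition pred_coord :: "'n::{finite,linorder} \<Rightarrow> 'n" where
  "pred_coord i = (if coord_no i = 1 then i else prev_coord i)"

lemma coord_no_inj: "coord_no i = coord_no j \<longleftrightarrow> i = j"
  using coord_no_bij by (auto simp: bij_betw_def dest: injD)

lemma coord_no_range: "1 \<le> coord_no i" "coord_no (i :: 'n::{finite,linorder}) \<le> CARD('n)"
proof -
  have "coord_no i \<in> {1..CARD('n)}" using coord_no_bij[where ?'n = 'n] by (auto simp: bij_betw_def)
  then show "1 \<le> coord_no i" "coord_no i \<le> CARD('n)" by auto
qed

lemma coord_no_surj:
  assumes "1 \<le> m" "m \<le> CARD('n)"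
  shows "\<exists>i :: 'n::{finite,linorder}. coord_no i = m"
proof -
  have "m \<in> range (coord_no :: 'n \<Rightarrow> nat)" using coord_no_bij[where ?'n = 'n] assms by (auto simp: bij_betw_def)
  then show ?thesis by auto
qed

lemma coord_no_first: "coord_no (coord1 :: 'n::{finite,linorder}) = 1"
proof -
  obtain i :: 'n where "coord_no i = 1" using coord_no_surj[of 1] by (auto simp: Suc_le_eq)
  then show ?thesis unfolding coord1_def by (rule theI) (metis \<open>coord_no i = 1\<close> coord_no_inj)
qed

lemma coord_no_eq_1_iff: "coord_no i = 1 \<longleftrightarrow> i = coord1"
  by (metis coord_no_first coord_no_inj)

lemma coord_no_prev: "i \<noteq> coord1 \<Longrightarrow> coord_no i = Suc (coord_no (prev_coord i))"
proof -
  assume i: "i \<noteq> coord1"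
  then have "1 \<le> coord_no i - 1" using coord_no_range(1)[of i] coord_no_eq_1_iff[of i] by linarith
  then obtain j :: 'a where "coord_no j = coord_no i - 1"
    using coord_no_surj[of "coord_no i - 1"] coord_no_range(2)[of i] by (metis diff_le_self le_trans)
  then have j: "coord_no i = Suc (coord_no j)" using coord_no_range(1)[of i] by linarith
  show ?thesis unfolding prev_coord_def
    by (rule theI[of "\<lambda>j. coord_no i = Suc (coord_no j)"]) (use j in \<open>auto simp: coord_no_inj\<close>)
qed

lemma pred_first [simp]: "pred_coord coord1 = coord1"
  by (simp add: pred_coord_def coord_no_first)

lemma coord_no_pred: "i \<noteq> coord1 \<Longrightarrow> coord_no i = Suc (coord_no (pred_coord i))"
  using coord_no_prev[of i] coord_no_eq_1_iff[of i] by (auto simp: pred_coord_def)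

lemma coord_induct [case_names first pred]:
  assumes "P coord1" "\<And>i. i \<noteq> coord1 \<Longrightarrow> P (pred_coord i) \<Longrightarrow> P i"
  shows "P (i :: 'n::{finite,linorder})"
proof (induction "coord_no i" arbitrary: i rule: less_induct)
  case less
  show ?case
  proof (cases "i = coord1")
    case False
    have "P (pred_coord i)" using less[of "pred_coord i"] coord_no_pred[OF False] by simp
    then show ?thesis by (rule assms(2)[OF False])
  qed (simp add: assms(1))
qed

section \<open>The drift and its Lipschitz constant\<close>

definition drift :: "real \<Rightarrow> 'n rvec \<Rightarrow> 'n rvec \<Rightarrow> 'n rvec \<Rightarrow> 'n::{finite,linorder} rvec" where
  "drift k \<alpha> z x = (\<chi> i. k * ((x $ pred_coord i + z $ pred_coord i) - (x $ i + z $ i)) + \<alpha> $ i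
     - sin (x $ i + z $ i) + z $ i)"

lemma coupling_matrix_mult:
  "(coupling_matrix *v x) $ i = x $ pred_coord i - (x $ i :: real)"
proof (cases "i = coord1")
  case True
  then show ?thesis by (simp add: matrix_vector_mult_def coupling_matrix_def coord_no_first)
next
  case False
  have c: "coord_no i \<noteq> 1" using False coord_no_eq_1_iff by blast
  have p: "coord_no i = Suc (coord_no j) \<longleftrightarrow> j = pred_coord i" for j
    using coord_no_pred[OF False] by (metis coord_no_inj nat.inject)
  have "(coupling_matrix *v x) $ i = (\<Sum>j\<in>UNIV. (if j = i then - x $ j else if j = pred_coord i then x $ j else 0))"
    unfolding matrix_vector_mult_def coupling_matrix_def using c p
    by (auto intro!: sum.cong)
  also have "\<dots> = (\<Sum>j\<in>UNIV. (if j = pred_coord i then x $ j else 0) - (if j = i then x $ j else 0))"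
    using coord_no_pred[OF False] by (intro sum.cong) auto
  also have "\<dots> = x $ pred_coord i - x $ i" by (simp add: sum_subtractf)
  finally show ?thesis .
qed

text \<open>The coupling part of \<open>drift_corr\<close> merges with the matrix term, so that the
  drift couples the components of \<open>x + z\<close>. For \<open>coord1\<close> this contribution
  cancels, the coordinate being its own predecessor.\<close>

lemma rde_field_eq_drift: "rde_field k \<alpha> \<epsilon> \<omega> x = drift k \<alpha> (\<chi> i. ou \<epsilon> i \<omega>) x"
  by (auto simp: vec_eq_iff rde_field_def drift_def coupling_matrix_mult drift_corr_def
      pred_coord_def coord_no_eq_1_iff algebra_simps)

lemma norm_le_of_components:
  fixes x :: "real^'n"
  assumes "\<And>i. \<bar>x $ i\<bar> \<le> B"
  shows "norm x \<le> real CARD('n) * B"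
  using norm_le_l1_cart[of x] sum_bounded_above[of UNIV "\<lambda>i. \<bar>x $ i\<bar>" B] assms by simp

lemma abs_sin_diff_le: "\<bar>sin x - sin y\<bar> \<le> \<bar>x - y\<bar>" for x y :: real
proof -
  have "\<bar>sin_slope x y\<bar> * \<bar>x - y\<bar> \<le> 1 * \<bar>x - y\<bar>"
    by (intro mult_right_mono abs_sin_slope_le) auto
  then show ?thesis by (simp add: abs_mult[symmetric] sin_slope_mult)
qed

text \<open>\<open>z\<close> enters only additively or inside the sine, so the constant is the same
  for all noise values; this gives global solutions and the time-independent constant
  \<open>lip\<close>.\<close>

lemma drift_lipschitz:
  "norm (drift k \<alpha> z x - drift k \<alpha> z y) \<le> real CARD('n) * (2 * \<bar>k\<bar> + 1) * norm (x - y :: 'n::{finite,linorder} rvec)"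
proof -
  have "\<bar>(drift k \<alpha> z x - drift k \<alpha> z y) $ i\<bar> \<le> (2 * \<bar>k\<bar> + 1) * norm (x - y)" for i
  proof -
    let ?d = "\<lambda>i. (x - y) $ i"
    have "(drift k \<alpha> z x - drift k \<alpha> z y) $ i = k * (?d (pred_coord i) - ?d i)
        - (sin (x $ i + z $ i) - sin (y $ i + z $ i))"
      by (simp add: drift_def algebra_simps)
    also have "\<bar>\<dots>\<bar> \<le> \<bar>k\<bar> * \<bar>?d (pred_coord i) - ?d i\<bar> + \<bar>?d i\<bar>"
      using abs_sin_diff_le[of "x $ i + z $ i" "y $ i + z $ i"]
        abs_triangle_ineq4[of "k * (?d (pred_coord i) - ?d i)" "sin (x $ i + z $ i) - sin (y $ i + z $ i)"]
      by (simp add: abs_mult)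
    also have "\<dots> \<le> \<bar>k\<bar> * (2 * norm (x - y)) + norm (x - y)"
      using component_le_norm_cart[of "x - y" "pred_coord i"] component_le_norm_cart[of "x - y" i]
      by (intro add_mono mult_left_mono) (auto intro: order_trans[OF abs_triangle_ineq4])
    finally show ?thesis by (simp add: algebra_simps)
  qed
  from norm_le_of_components[OF this] show ?thesis by (simp only: mult.assoc)
qed

lemma continuous_drift:
  fixes f :: "'a::t2_space \<Rightarrow> 'n::{finite,linorder} rvec"
  assumes "continuous_on S f" "continuous_on S g"
  shows "continuous_on S (\<lambda>x. drift k \<alpha> (f x) (g x))"
  unfolding drift_def by (intro continuous_on_vec_lambda continuous_intros assms)

text \<open>\<open>R\<close> is the radius of the absorbing set at each time.\<close>

locale coupled_rde =
  fixes k :: real and \<alpha> :: "'n::{finite,linorder} rvec" and z :: "real \<Rightarrow> 'n rvec" and R :: "real \<Rightarrow> real"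
  assumes k_pos: "0 < k" and z_cont: "continuous_on UNIV z"
    and R_ge: "\<And>t. 2 * norm \<alpha> + 2 + (4 * k + 2) * norm (z t) \<le> R t"
    and R_growth: "\<And>s t. s \<le> t \<Longrightarrow> R s \<le> exp (k / 2 * (t - s)) * R t"
    and R_tempered: "\<And>\<delta>. 0 < \<delta> \<Longrightarrow> \<exists>M. \<forall>t. R t \<le> M * exp (\<delta> * \<bar>t\<bar>)"
begin

definition solves :: "(real \<Rightarrow> 'n rvec) \<Rightarrow> bool" where
  "solves u \<longleftrightarrow> (\<forall>t. (u has_vector_derivative drift k \<alpha> (z t) (u t)) (at t))"

text \<open>With ratio 3, half of the damping, \<open>k / 2 * width i\<close>, equals
  \<open>k * width j + k / 2 * width j\<close> for the predecessor \<open>j\<close>: the first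
  summand pays for the gap of \<open>j\<close>, the second, at least 1 thanks to
  \<open>2 / k\<close>, for the forcing by \<open>R\<close>. The summand 1 makes every width at
  least 1.\<close>

definition width :: "'n \<Rightarrow> real" where
  "width i = (1 + 2 / k) * 3 ^ coord_no i"

text \<open>Only gaps are constrained, so the set is invariant under translations along
  \<open>diag_vec\<close> and descends to a bounded set on the cylinder; at \<open>coord1\<close>
  the condition holds automatically.\<close>

definition absorbing :: "real \<Rightarrow> 'n rvec set" where
  "absorbing t = {x. \<forall>i. \<bar>x $ i - x $ pred_coord i\<bar> \<le> width i * R t}"

definition entire :: "(real \<Rightarrow> 'n rvec) set" where
  "entire = {u. solves u \<and> (\<forall>t. u t \<in> absorbing t)}"

definition lip :: real where "lip = real CARD('n) * (2 * \<bar>k\<bar> + 1)"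

lemma lip_pos: "0 < lip"
  using k_pos by (simp add: lip_def)

lemma R_pos: "0 < R t"
proof -
  have "0 \<le> (4 * k + 2) * norm (z t)" using k_pos by simp
  then show ?thesis using R_ge[of t] norm_ge_zero[of \<alpha>] by linarith
qed

lemma width_ge_1: "1 \<le> width i"
proof -
  have "1 * 1 \<le> (1 + 2 / k) * 3 ^ coord_no i" using k_pos by (intro mult_mono) auto
  then show ?thesis by (simp add: width_def)
qed

lemma solvesD: "solves u \<Longrightarrow> (u has_vector_derivative drift k \<alpha> (z t) (u t)) (at t)"
  by (simp add: solves_def)

lemma solves_continuous: "solves u \<Longrightarrow> continuous_on UNIV u"
  by (meson continuous_at_imp_continuous_on has_vector_derivative_continuous solvesD)

lemma solves_component:
  assumes "solves u"
  shows "((\<lambda>t. u t $ i) has_real_derivative drift k \<alpha> (z t) (u t) $ i) (at t)"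
  using bounded_linear.has_vector_derivative[OF bounded_linear_vec_nth solvesD[OF assms], of i t]
  by (simp add: has_real_derivative_iff_has_vector_derivative)

lemma solution_exists: "\<exists>u. solves u \<and> u s = x"
proof -
  let ?F = "\<lambda>t x. drift k \<alpha> (z (t + s)) x"
  have "continuous_on UNIV (\<lambda>(t, x). ?F t x)"
    unfolding split_beta
    by (intro continuous_drift continuous_on_compose2[OF z_cont] continuous_intros) auto
  moreover have "norm (?F t x - ?F t y) \<le> lip * norm (x - y)" for t x y
    unfolding lip_def by (rule drift_lipschitz)
  ultimately obtain v where v: "v 0 = x" "\<And>t. (v has_vector_derivative ?F t (v t)) (at t)"
    using picard_lindeloef[of ?F lip x] lip_pos by blast
  have "((\<lambda>t. v (t - s)) has_vector_derivative drift k \<alpha> (z t) (v (t - s))) (at t)" for t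
  proof -
    have "((\<lambda>t. t - s) has_vector_derivative 1) (at t)" by (auto intro!: derivative_eq_intros)
    from vector_diff_chain_at[OF this, of v] v(2)[of "t - s"] show ?thesis by (simp add: o_def)
  qed
  then have "solves (\<lambda>t. v (t - s)) \<and> v (s - s) = x" using v(1) by (simp add: solves_def)
  then show ?thesis by (rule exI[of _ "\<lambda>t. v (t - s)"])
qed

lemma solutions_close:
  assumes "solves u" "solves v"
  shows "norm (u t - v t) \<le> exp (lip * \<bar>t - s\<bar>) * norm (u s - v s)"
  by (rule gronwall_solutions[where F = "\<lambda>t x. drift k \<alpha> (z t) x"])
    (use assms in \<open>auto simp: solves_def lip_def drift_lipschitz\<close>)

lemma solution_unique:
  assumes "solves u" "solves v" "u s = v s"
  shows "u = v"
proof
  fix t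
  show "u t = v t" using solutions_close[OF assms(1,2), of t s] assms(3) by simp
qed

section \<open>Damping of the gaps\<close>

lemma solution_gap_derivative:
  assumes u: "solves u"
  obtains g where "\<And>t. ((\<lambda>t. u t $ i - u t $ pred_coord i) has_real_derivative
      - k * (u t $ i - u t $ pred_coord i) + k * (u t $ pred_coord i - u t $ pred_coord (pred_coord i)) + g t) (at t)"
    "\<And>t. \<bar>g t\<bar> \<le> R t"
proof
  let ?j = "pred_coord i" and ?l = "pred_coord (pred_coord i)"
  \<comment> \<open>The forcing that remains once damping and the preceding gap are split off: two
    entries of \<open>\<alpha>\<close>, two sines, four entries of \<open>z\<close> with factor
    \<open>k\<close> and two without. This is the origin of the constants in
    \<open>R_ge\<close>.\<close>
  define g where "g = (\<lambda>t. \<alpha> $ i - \<alpha> $ ?j - (sin (u t $ i + z t $ i) - sin (u t $ ?j + z t $ ?j))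
    + (k * ((z t $ ?j - z t $ i) - (z t $ ?l - z t $ ?j)) + (z t $ i - z t $ ?j)))"
  show "((\<lambda>t. u t $ i - u t $ ?j) has_real_derivative
      - k * (u t $ i - u t $ ?j) + k * (u t $ ?j - u t $ ?l) + g t) (at t)" for t
    using DERIV_diff[OF solves_component[OF u, of i t] solves_component[OF u, of ?j t]]
    by (rule DERIV_cong) (simp add: drift_def g_def algebra_simps)
  show "\<bar>g t\<bar> \<le> R t" for t
  proof -
    have "\<bar>g t\<bar> \<le> \<bar>\<alpha> $ i\<bar> + \<bar>\<alpha> $ ?j\<bar> + \<bar>sin (u t $ i + z t $ i)\<bar> + \<bar>sin (u t $ ?j + z t $ ?j)\<bar>
       + \<bar>k * ((z t $ ?j - z t $ i) - (z t $ ?l - z t $ ?j))\<bar> + \<bar>z t $ i\<bar> + \<bar>z t $ ?j\<bar>"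
      unfolding g_def by linarith
    also have "\<dots> \<le> norm \<alpha> + norm \<alpha> + 1 + 1 + k * (4 * norm (z t)) + norm (z t) + norm (z t)"
    proof (intro add_mono component_le_norm_cart abs_sin_le_one)
      have "\<bar>(z t $ ?j - z t $ i) - (z t $ ?l - z t $ ?j)\<bar> \<le> 4 * norm (z t)"
        using component_le_norm_cart[of "z t" i] component_le_norm_cart[of "z t" ?j] component_le_norm_cart[of "z t" ?l]
        by linarith
      then show "\<bar>k * ((z t $ ?j - z t $ i) - (z t $ ?l - z t $ ?j))\<bar> \<le> k * (4 * norm (z t))"
        using k_pos by (simp add: abs_mult)
    qed
    also have "\<dots> = 2 * norm \<alpha> + 2 + (4 * k + 2) * norm (z t)" by (simp add: algebra_simps)
    finally show ?thesis using R_ge[of t] by linarith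
  qed
qed

text \<open>
  \<open>width\<close> grows geometrically so that the forcing of each gap by the preceding one is dominated;
  half of the decay rate \<open>k\<close> is spent on the growth of \<open>R\<close>.
\<close>

lemma gap_estimate:
  assumes u: "solves u" and K: "0 \<le> K"
    and R: "\<And>t. s \<le> t \<Longrightarrow> t \<le> T \<Longrightarrow> R t \<le> K * exp (- k / 2 * t)"
    and init: "\<And>i. \<bar>u s $ i - u s $ pred_coord i\<bar> \<le> width i * K * exp (- k / 2 * s)"
    and t: "s \<le> t" "t \<le> T"
  shows "\<bar>u t $ i - u t $ pred_coord i\<bar> \<le> width i * K * exp (- k / 2 * t)"
  using t
proof (induction i arbitrary: t rule: coord_induct)
  case first
  then show ?case using width_ge_1[of coord1] K by simp
next
  case (pred i)
  let ?j = "pred_coord i" and ?l = "pred_coord (pred_coord i)"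
  obtain g where g: "\<And>t. ((\<lambda>t. u t $ i - u t $ ?j) has_real_derivative
      - k * (u t $ i - u t $ ?j) + k * (u t $ ?j - u t $ ?l) + g t) (at t)" "\<And>t. \<bar>g t\<bar> \<le> R t"
    using solution_gap_derivative[OF u] by blast
  let ?y = "\<lambda>t. u t $ i - u t $ ?j" and ?x = "\<lambda>t. u t $ ?j - u t $ ?l"
  define m where "m = (\<lambda>t. width i * K * exp (- k / 2 * t))"
  define m' where "m' = (\<lambda>t. - k / 2 * (width i * K * exp (- k / 2 * t)))"
  have m: "(m has_real_derivative m' t) (at t)" for t
    unfolding m_def m'_def by (auto intro!: derivative_eq_intros)
  have force: "\<bar>k * ?x x + g x\<bar> \<le> m' x + k * m x" if x: "s \<le> x" "x \<le> T" for x
  proof -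
    have w: "width i = 3 * width ?j" using coord_no_pred[OF pred(1)] by (simp add: width_def)
    have "3 * (2 / k) \<le> width ?j"
    proof -
      have "(3::real) ^ 1 \<le> 3 ^ coord_no ?j" using coord_no_range(1)[of ?j] by (intro power_increasing) auto
      then have "2 / k * 3 \<le> (1 + 2 / k) * 3 ^ coord_no ?j" using k_pos by (intro mult_mono) auto
      then show ?thesis by (simp add: width_def)
    qed
    then have "1 \<le> k / 2 * width ?j" using k_pos by (simp add: field_simps)
    then have "1 * (K * exp (- k / 2 * x)) \<le> k / 2 * width ?j * (K * exp (- k / 2 * x))"
      using K by (intro mult_right_mono) auto
    moreover have "k * \<bar>?x x\<bar> \<le> k * (width ?j * K * exp (- k / 2 * x))"
      using pred.IH[OF x] k_pos by (intro mult_left_mono) auto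
    moreover have "\<bar>k * ?x x + g x\<bar> \<le> k * \<bar>?x x\<bar> + R x"
      using g(2)[of x] k_pos abs_triangle_ineq[of "k * ?x x" "g x"] by (simp add: abs_mult)
    moreover have "m' x + k * m x = 3 / 2 * (k * (width ?j * K * exp (- k / 2 * x)))"
      by (simp add: m_def m'_def w algebra_simps)
    ultimately show ?thesis using R[OF x] by (simp add: algebra_simps)
  qed
  have "\<bar>?y t\<bar> \<le> m t"
  proof (rule abs_le_supersolution[where e = ?y and f = "\<lambda>x. k * ?x x + g x" and a = "\<lambda>_. k" and s = s])
    show "(?y has_real_derivative k * ?x x + g x - k * ?y x) (at x)" for x
      by (rule DERIV_cong[OF g(1)]) simp
  qed (use init[of i] pred.prems m force in \<open>auto simp: m_def\<close>)
  then show ?case by (simp add: m_def)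
qed

lemma absorbing_forward:
  assumes u: "solves u" and us: "u s \<in> absorbing s" and st: "s \<le> t"
  shows "u t \<in> absorbing t"
proof -
  \<comment> \<open>By \<open>R_growth\<close> this gives an exponential majorant of
    \<open>R\<close> before \<open>t\<close> that touches it at \<open>t\<close>;
    \<open>gap_estimate\<close> then returns exactly the radius \<open>R t\<close>.\<close>
  define K where "K = R t * exp (k / 2 * t)"
  have K0: "0 \<le> K" using R_pos[of t] by (simp add: K_def)
  have RK: "R x \<le> K * exp (- k / 2 * x)" if "x \<le> t" for x
    using R_growth[OF that] by (simp add: K_def mult_ac right_diff_distrib diff_divide_distrib flip: exp_add)
  have "\<bar>u t $ i - u t $ pred_coord i\<bar> \<le> width i * K * exp (- k / 2 * t)" for i
  proof (rule gap_estimate[OF u K0 _ _ st order_refl])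
    fix i
    have "width i * R s \<le> width i * (K * exp (- k / 2 * s))"
      using RK[OF st] width_ge_1[of i] by (intro mult_left_mono) auto
    then show "\<bar>u s $ i - u s $ pred_coord i\<bar> \<le> width i * K * exp (- k / 2 * s)"
      using us by (auto simp: absorbing_def mult.assoc intro: order_trans)
  qed (use RK in auto)
  then show ?thesis by (simp add: absorbing_def K_def mult.assoc flip: exp_add)
qed

lemma approach_absorbing:
  assumes u: "solves u" and init: "\<And>i. \<bar>u s $ i - u s $ pred_coord i\<bar> \<le> \<rho>" and st: "s \<le> t" and \<rho>: "0 \<le> \<rho>"
  shows "\<bar>u t $ i - u t $ pred_coord i\<bar> \<le> width i * (R t + \<rho> * exp (- k / 2 * (t - s)))"
proof -
  \<comment> \<open>The majorant of \<open>R\<close> plus a term that equals \<open>\<rho>\<close>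
    at time \<open>s\<close>; the excess over the absorbing set thus decays at rate
    \<open>k / 2\<close>.\<close>
  define K where "K = R t * exp (k / 2 * t) + \<rho> * exp (k / 2 * s)"
  have K0: "0 \<le> K" using R_pos[of t] \<rho> by (simp add: K_def)
  have RK: "R x \<le> K * exp (- k / 2 * x)" if "x \<le> t" for x
  proof -
    have "0 \<le> \<rho> * exp (k / 2 * s) * exp (- k / 2 * x)" using \<rho> by simp
    moreover have "R x \<le> R t * exp (k / 2 * t) * exp (- k / 2 * x)"
      using R_growth[OF that] by (simp add: mult_ac right_diff_distrib diff_divide_distrib flip: exp_add)
    ultimately show ?thesis unfolding K_def distrib_right by linarith
  qed
  have "\<bar>u t $ i - u t $ pred_coord i\<bar> \<le> width i * K * exp (- k / 2 * t)"
  proof (rule gap_estimate[OF u K0 _ _ st order_refl])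
    fix i
    have "\<rho> \<le> K * exp (- k / 2 * s)"
      using R_pos[of t] by (simp add: K_def algebra_simps flip: exp_add)
    also have "\<dots> \<le> width i * (K * exp (- k / 2 * s))"
      using mult_right_mono[OF width_ge_1[of i], of "K * exp (- k / 2 * s)"] K0 by simp
    finally show "\<bar>u s $ i - u s $ pred_coord i\<bar> \<le> width i * K * exp (- k / 2 * s)"
      using init[of i] by (simp add: mult.assoc)
  qed (use RK in auto)
  also have "K * exp (- k / 2 * t) = R t + \<rho> * exp (- k / 2 * (t - s))"
    by (simp add: K_def distrib_right mult.assoc right_diff_distrib flip: exp_add)
  then have "width i * K * exp (- k / 2 * t) = width i * (R t + \<rho> * exp (- k / 2 * (t - s)))"
    by (simp only: mult.assoc)
  finally show ?thesis .
qed

section \<open>Limits of solutions and existence of entire solutions\<close>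

lemma solution_subseq_limit:
  assumes u: "\<And>n::nat. solves (u n)" and b: "\<And>n. norm (u n 0) \<le> B"
  obtains r v where "strict_mono r" "solves v" "\<And>t. (\<lambda>n. u (r n) t) \<longlonglongrightarrow> v t"
proof -
  \<comment> \<open>Compactness is needed at time 0 only; \<open>solutions_close\<close> carries the
    convergence to every other time.\<close>
  have "compact (cball (0 :: 'n rvec) B)" by (rule compact_cball)
  then obtain l r where r: "strict_mono r" "((\<lambda>n. u n 0) \<circ> r) \<longlonglongrightarrow> l"
    unfolding compact_def using b by (metis dist_0_norm mem_cball)
  obtain v where v: "solves v" "v 0 = l" using solution_exists by blast
  have "(\<lambda>n. u (r n) t) \<longlonglongrightarrow> v t" for t
  proof -
    have "(\<lambda>n. norm (u (r n) 0 - v 0)) \<longlonglongrightarrow> 0"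
      using r(2) v(2) by (simp add: o_def tendsto_norm_zero_iff LIM_zero_iff)
    then have lim: "(\<lambda>n. exp (lip * \<bar>t - 0\<bar>) * norm (u (r n) 0 - v 0)) \<longlonglongrightarrow> 0"
      by (rule tendsto_mult_right_zero)
    have "(\<lambda>n. u (r n) t - v t) \<longlonglongrightarrow> 0"
      by (rule Lim_null_comparison[OF _ lim]) (intro always_eventually allI solutions_close u v)
    then show ?thesis by (simp add: LIM_zero_iff)
  qed
  then show thesis using that r(1) v(1) by blast
qed

lemma absorbing_closed_limit:
  assumes "\<And>n. n \<ge> n0 \<Longrightarrow> x n \<in> absorbing t" "x \<longlonglongrightarrow> l"
  shows "l \<in> absorbing t"
  unfolding absorbing_def
proof safe
  fix i
  have "(\<lambda>n. \<bar>x n $ i - x n $ pred_coord i\<bar>) \<longlonglongrightarrow> \<bar>l $ i - l $ pred_coord i\<bar>"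
    by (intro tendsto_intros assms(2))
  then show "\<bar>l $ i - l $ pred_coord i\<bar> \<le> width i * R t"
    by (rule tendsto_upperbound) (use assms(1) in \<open>auto simp: absorbing_def eventually_sequentially\<close>)
qed

lemma norm_le_of_gaps:
  fixes x :: "'n rvec"
  assumes "\<And>i. \<bar>x $ i - x $ pred_coord i\<bar> \<le> c"
  shows "norm x \<le> real CARD('n) * (\<bar>x $ coord1\<bar> + real CARD('n) * c)"
proof -
  have c: "0 \<le> c" using assms[of undefined] by linarith
  have "\<bar>x $ i\<bar> \<le> \<bar>x $ coord1\<bar> + real (coord_no i) * c" for i
  proof (induction i rule: coord_induct)
    case (pred i)
    then show ?case using assms[of i] coord_no_pred[OF pred(1)] by (simp add: algebra_simps)
  qed (use c in auto)
  moreover have "real (coord_no i) * c \<le> real CARD('n) * c" for i :: 'n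
    using coord_no_range(2)[of i] c by (intro mult_right_mono) auto
  ultimately show ?thesis by (intro norm_le_of_components) (meson add_left_mono order_trans)
qed

definition max_width :: real where "max_width = (1 + 2 / k) * 3 ^ CARD('n)"

lemma width_le: "width i \<le> max_width"
  unfolding width_def max_width_def using k_pos coord_no_range(2)[of i]
  by (intro mult_left_mono power_increasing) auto

lemma norm_absorbing_le:
  assumes "x \<in> absorbing t"
  shows "norm x \<le> real CARD('n) * (\<bar>x $ coord1\<bar> + real CARD('n) * (max_width * R t))"
proof (rule norm_le_of_gaps)
  fix i
  have "width i * R t \<le> max_width * R t" using width_le R_pos[of t] by (intro mult_right_mono) auto
  then show "\<bar>x $ i - x $ pred_coord i\<bar> \<le> max_width * R t" using assms by (auto simp: absorbing_def intro: order_trans)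
qed

definition slope :: "(real \<Rightarrow> 'n rvec) \<Rightarrow> (real \<Rightarrow> 'n rvec) \<Rightarrow> 'n \<Rightarrow> real \<Rightarrow> real" where
  "slope u v i t = sin_slope (u t $ i + z t $ i) (v t $ i + z t $ i)"

lemma slope_continuous:
  assumes "solves u" "solves v"
  shows "continuous_on UNIV (slope u v i)"
proof -
  have "continuous_on UNIV (\<lambda>t. u t $ i + z t $ i)" "continuous_on UNIV (\<lambda>t. v t $ i + z t $ i)"
    using solves_continuous[OF assms(1)] solves_continuous[OF assms(2)] z_cont by (auto intro!: continuous_intros)
  then show ?thesis unfolding slope_def by (rule continuous_sin_slope)
qed

lemma abs_slope_le: "\<bar>slope u v i t\<bar> \<le> 1"
  by (simp add: slope_def abs_sin_slope_le)

lemma solutions_diff_derivative: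
  assumes u: "solves u" and v: "solves v"
  shows "((\<lambda>t. u t $ i - v t $ i) has_real_derivative
    k * ((u t $ pred_coord i - v t $ pred_coord i) - (u t $ i - v t $ i)) - slope u v i t * (u t $ i - v t $ i)) (at t)"
proof (rule DERIV_cong[OF DERIV_diff[OF solves_component[OF u] solves_component[OF v]]])
  have "slope u v i t * (u t $ i - v t $ i) = sin (u t $ i + z t $ i) - sin (v t $ i + z t $ i)"
    using sin_slope_mult[of "u t $ i + z t $ i" "v t $ i + z t $ i"] by (simp add: slope_def)
  then show "drift k \<alpha> (z t) (u t) $ i - drift k \<alpha> (z t) (v t) $ i = k * ((u t $ pred_coord i - v t $ pred_coord i) - (u t $ i - v t $ i)) - slope u v i t * (u t $ i - v t $ i)"
    by (simp add: drift_def algebra_simps)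
qed

lemma first_diff_formula:
  assumes u: "solves u" and v: "solves v"
  shows "u t $ coord1 - v t $ coord1
    = (u 0 $ coord1 - v 0 $ coord1) * exp (- prim (slope u v coord1) t)"
  by (rule linear_ode_solution[where f = "\<lambda>t. u t $ coord1 - v t $ coord1"])
    (use solutions_diff_derivative[OF u v, of coord1] slope_continuous[OF u v] in auto)

lemma first_diff_zero:
  assumes u: "solves u" and v: "solves v" and eq: "u s $ coord1 = v s $ coord1"
  shows "u t $ coord1 = v t $ coord1"
  using first_diff_formula[OF u v, of s] first_diff_formula[OF u v, of t] eq by auto

lemma fibre_exists: "\<exists>u\<in>entire. u 0 $ coord1 = a"
proof -
  \<comment> \<open>\<open>v\<close> merely records from where the first coordinate must start at
    time \<open>- n\<close> to reach \<open>a\<close> at time 0; as that coordinate obeys an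
    equation of its own, \<open>u n\<close> shares it.\<close>
  obtain v where v: "solves v" "v 0 = (\<chi> i. a)" using solution_exists by blast
  have "\<exists>u. solves u \<and> u (- real n) = (\<chi> i. v (- real n) $ coord1)" for n by (rule solution_exists)
  then obtain u where u: "\<And>n. solves (u n)" "\<And>n. u n (- real n) = (\<chi> i. v (- real n) $ coord1)" by metis
  have first: "u n 0 $ coord1 = a" for n
    using first_diff_zero[OF u(1)[of n] v(1), of "- real n" 0] u(2)[of n] v(2) by simp
  have ab: "u n t \<in> absorbing t" if "- real n \<le> t" for n t
  proof (rule absorbing_forward[OF u(1) _ that])
    show "u n (- real n) \<in> absorbing (- real n)"
      using R_pos[of "- real n"] width_ge_1 by (auto simp: absorbing_def u(2) intro!: mult_nonneg_nonneg order_trans[OF zero_le_one width_ge_1])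
  qed
  have "norm (u n 0) \<le> real CARD('n) * (\<bar>a\<bar> + real CARD('n) * (max_width * R 0))" for n
    using norm_absorbing_le[OF ab[of n 0]] first[of n] by simp
  then obtain r w where r: "strict_mono r" "solves w" "\<And>t. (\<lambda>n. u (r n) t) \<longlonglongrightarrow> w t"
    using solution_subseq_limit[of u, OF u(1)] by metis
  have "w t \<in> absorbing t" for t
  proof (rule absorbing_closed_limit[OF _ r(3)])
    fix n assume "nat \<lceil>- t\<rceil> \<le> n"
    then have "- t \<le> real (r n)" using seq_suble[OF r(1), of n] by linarith
    then show "u (r n) t \<in> absorbing t" by (intro ab) simp
  qed
  moreover have "(\<lambda>n. u (r n) 0 $ coord1) \<longlonglongrightarrow> w 0 $ coord1" by (intro tendsto_intros r(3))
  then have "w 0 $ coord1 = a" using first by (simp add: LIMSEQ_const_iff)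
  ultimately show ?thesis using r(2) by (auto simp: entire_def)
qed

end

section \<open>Strong coupling\<close>

locale strongly_coupled_rde = coupled_rde k \<alpha> z R
  for k :: real and \<alpha> :: "'n::{finite,linorder} rvec" and z R +
  assumes card_ge_2: "2 \<le> CARD('n)" and k_large: "2 * (real CARD('n) - 1) < k"
begin

text \<open>This gives \<open>k - 1 > 1\<close>, the rate demanded by
  \<open>backward_growth_nonneg\<close>, and \<open>k - 2 > 0\<close>, the net decay in
  \<open>cascade_compare\<close>.\<close>

lemma k_gt_2: "2 < k"
  using card_ge_2 k_large by simp

text \<open>
  Satisfied by scaled differences of entire solutions, with \<open>c\<close> the difference quotients of the sine.
  The last conjunct is what the decay rate \<open>k - 1 > 1\<close> beats.
\<close>

definition cascade :: "('n \<Rightarrow> real \<Rightarrow> real) \<Rightarrow> (real \<Rightarrow> 'n rvec) \<Rightarrow> bool" where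
  "cascade c d \<longleftrightarrow>
     (\<forall>i t. ((\<lambda>t. d t $ i) has_real_derivative k * (d t $ pred_coord i - d t $ i) - c i t * d t $ i) (at t)) \<and>
     (\<forall>i. continuous_on UNIV (c i)) \<and> (\<forall>i t. \<bar>c i t\<bar> \<le> 1) \<and>
     (\<exists>M. \<forall>t\<le>0. \<forall>i. \<bar>d t $ i\<bar> \<le> M * exp (- t))"

lemma cascadeD:
  assumes "cascade c d"
  shows "((\<lambda>t. d t $ i) has_real_derivative k * (d t $ pred_coord i - d t $ i) - c i t * d t $ i) (at t)"
    "continuous_on UNIV (c i)" "\<bar>c i t\<bar> \<le> 1"
  using assms by (auto simp: cascade_def)

lemma cascade_first:
  assumes "cascade c d"
  shows "d t $ coord1 = d 0 $ coord1 * exp (- prim (c coord1) t)"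
  by (rule linear_ode_solution[where f = "\<lambda>t. d t $ coord1"])
    (use cascadeD(1)[OF assms, of coord1] cascadeD(2)[OF assms] in auto)

lemma cascade_rate:
  assumes "cascade c d"
  shows "continuous_on UNIV (\<lambda>t. k + c i t)" "k - 1 \<le> k + c i t"
  using cascadeD(2)[OF assms, of i] cascadeD(3)[OF assms, of i t] by (auto intro!: continuous_intros)

text \<open>Once the predecessor vanishes, a component solves a homogeneous equation with rate at
  least \<open>k - 1\<close>, so \<open>backward_growth_nonneg\<close> applies to it and to its
  negative.\<close>

lemma cascade_zero:
  assumes c: "cascade c d" and 0: "d 0 $ coord1 = 0" and t: "t \<le> 0"
  shows "d t $ i = 0"
  using t
proof (induction i arbitrary: t rule: coord_induct)
  case first
  then show ?case using cascade_first[OF c] 0 by simp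
next
  case (pred i)
  obtain M where M: "\<And>t i. t \<le> 0 \<Longrightarrow> \<bar>d t $ i\<bar> \<le> M * exp (- t)" using c unfolding cascade_def by blast
  have "0 \<le> d t $ i"
  proof (rule backward_growth_nonneg[OF _ _ cascade_rate[OF c], of "\<lambda>t. d t $ i"])
    show "- M * exp (- t) \<le> d t $ i" if "t \<le> 0" for t using M[OF that, of i] by linarith
  qed (use cascadeD(1)[OF c, of i] pred k_gt_2 in \<open>auto simp: algebra_simps\<close>)
  moreover have "0 \<le> - d t $ i"
  proof (rule backward_growth_nonneg[OF _ _ cascade_rate[OF c], of "\<lambda>t. - d t $ i"])
    show "- M * exp (- t) \<le> - d t $ i" if "t \<le> 0" for t using M[OF that, of i] by linarith
    show "((\<lambda>t. - d t $ i) has_real_derivative - (k * (d t $ pred_coord i - d t $ i) - c i t * d t $ i)) (at t)" for t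
      by (rule DERIV_minus[OF cascadeD(1)[OF c]])
  qed (use pred k_gt_2 in \<open>auto simp: algebra_simps\<close>)
  ultimately show ?case by simp
qed

lemma coord_no_pred_bound: "i \<noteq> coord1 \<Longrightarrow> 2 * real (coord_no (pred_coord i :: 'n)) < k"
proof -
  assume "i \<noteq> coord1"
  from coord_no_pred[OF this] have "real (coord_no (pred_coord i)) \<le> real CARD('n) - 1"
    using of_nat_mono[OF coord_no_range(2)[of i], where ?'a = real] by simp
  then have "2 * real (coord_no (pred_coord i)) \<le> 2 * (real CARD('n) - 1)" by (rule mult_left_mono) simp
  also have "\<dots> < k" by (rule k_large)
  finally show ?thesis .
qed

lemma cone_gamma_eq: "cone_gamma k m = k / (k + 2 * real m)"
  using k_pos by (simp add: cone_gamma_def field_simps)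

lemma cone_beta_eq: "2 * real m < k \<Longrightarrow> cone_beta k m = k / (k - 2 * real m)"
  using k_pos by (simp add: cone_beta_def field_simps)

text \<open>
  The bounds for the ratio of consecutive components telescope: the gap \<open>2 * (m - 1)\<close> of the
  preceding ratio and the oscillation \<open>2\<close> of the coefficients add up to \<open>2 * m\<close>.
\<close>

lemma cascade_cone:
  assumes c: "cascade c d" and d0: "0 < d 0 $ coord1" and t: "t \<le> 0"
  shows "0 < d t $ i \<and> cone_gamma k (coord_no i - 1) * d t $ pred_coord i \<le> d t $ i
    \<and> d t $ i \<le> cone_beta k (coord_no i - 1) * d t $ pred_coord i"
  using t
proof (induction i arbitrary: t rule: coord_induct)
  case first
  have "0 < d t $ coord1" using cascade_first[OF c, of t] d0 by simp
  \<comment> \<open>The index \<open>coord_no coord1 - 1\<close> is 0: both cone constants are 1 and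
    \<open>coord1\<close> is compared with itself.\<close>
  then show ?case by (simp add: coord_no_first cone_gamma_def cone_beta_def)
next
  case (pred i)
  obtain M where M: "\<And>t i. t \<le> 0 \<Longrightarrow> \<bar>d t $ i\<bar> \<le> M * exp (- t)" using c unfolding cascade_def by blast
  let ?j = "pred_coord i" and ?l = "pred_coord (pred_coord i)"
  define m where "m = coord_no ?j"
  define g where "g = cone_gamma k m"
  define b where "b = cone_beta k m"
  have m: "1 \<le> m" "2 * real m < k" "coord_no i - 1 = m" "real (m - 1) = real m - 1"
    using coord_no_range(1)[of ?j] coord_no_pred_bound[OF pred(1)] coord_no_pred[OF pred(1)] by (auto simp: m_def)
  have g: "g * (k + 2 * real m) = k" "0 < g" using m k_pos by (auto simp: g_def cone_gamma_eq field_simps)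
  have b: "b * (k - 2 * real m) = k" "0 < b" using m k_pos by (auto simp: b_def cone_beta_eq field_simps)
  have IH: "0 < d s $ ?j" "k * d s $ ?l \<le> (k + 2 * (real m - 1)) * d s $ ?j"
     "(k - 2 * (real m - 1)) * d s $ ?j \<le> k * d s $ ?l" if s: "s \<le> 0" for s
  proof -
    have IH: "0 < d s $ ?j" "cone_gamma k (m - 1) * d s $ ?l \<le> d s $ ?j" "d s $ ?j \<le> cone_beta k (m - 1) * d s $ ?l"
      using pred.IH[OF s] by (auto simp: m_def)
    show "0 < d s $ ?j" by (rule IH)
    show "k * d s $ ?l \<le> (k + 2 * (real m - 1)) * d s $ ?j"
      using IH(2) m k_pos by (simp add: cone_gamma_eq field_simps)
    have "2 * real (m - 1) < k" using m by simp
    then show "(k - 2 * (real m - 1)) * d s $ ?j \<le> k * d s $ ?l"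
      using IH(3) m k_pos by (simp add: cone_beta_eq field_simps)
  qed
  have cc: "\<bar>(c i s - c ?j s) * d s $ ?j\<bar> \<le> 2 * d s $ ?j" if s: "s \<le> 0" for s
  proof -
    have "\<bar>c i s - c ?j s\<bar> \<le> 2" using cascadeD(3)[OF c, of i s] cascadeD(3)[OF c, of ?j s] by linarith
    then show ?thesis using IH(1)[OF s] by (simp add: abs_mult)
  qed
  have pos: "0 < d t $ i" if lower: "g * d t $ ?j \<le> d t $ i" and t: "t \<le> 0" for t
    using mult_pos_pos[OF g(2) IH(1)[OF t]] lower by linarith
  \<comment> \<open>For \<open>p = d_i - g * d_j\<close> one has \<open>p' + (k + c_i) * p = k * d_j
    - g * (k * d_l + (c_i - c_j) * d_j)\<close>, which is nonnegative by the induction hypothesis on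
    \<open>d_l\<close> and \<open>d_j\<close>, the bound
    \<open>\<bar>c_i - c_j\<bar> \<le> 2\<close> and \<open>g * (k + 2 * m) = k\<close>. The upper
    estimate is the mirror image with \<open>b * (k - 2 * m) = k\<close>.\<close>
  have lower: "0 \<le> d t $ i - g * d t $ ?j" if t: "t \<le> 0" for t
  proof (rule backward_growth_nonneg[OF _ _ cascade_rate[OF c, of i] _ _ t, where p = "\<lambda>t. d t $ i - g * d t $ ?j"])
    fix s :: real assume s: "s \<le> 0"
    show "((\<lambda>t. d t $ i - g * d t $ ?j) has_real_derivative
       (k * (d s $ ?j - d s $ i) - c i s * d s $ i) - g * (k * (d s $ ?l - d s $ ?j) - c ?j s * d s $ ?j)) (at s)"
      by (intro DERIV_diff DERIV_cmult cascadeD(1)[OF c])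
    have "k * d s $ ?l + (c i s - c ?j s) * d s $ ?j \<le> (k + 2 * real m) * d s $ ?j"
      using IH(2)[OF s] cc[OF s] by (simp add: algebra_simps)
    then have "g * (k * d s $ ?l + (c i s - c ?j s) * d s $ ?j) \<le> g * ((k + 2 * real m) * d s $ ?j)"
      using g(2) by (intro mult_left_mono) auto
    also have "\<dots> = k * d s $ ?j" by (simp only: mult.assoc[symmetric] g(1))
    finally show "- (k + c i s) * (d s $ i - g * d s $ ?j)
       \<le> (k * (d s $ ?j - d s $ i) - c i s * d s $ i) - g * (k * (d s $ ?l - d s $ ?j) - c ?j s * d s $ ?j)"
      by (simp add: algebra_simps)
    have "g * \<bar>d s $ ?j\<bar> \<le> g * (M * exp (- s))" using g(2) M[OF s, of ?j] by (intro mult_left_mono) auto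
    moreover have "g * d s $ ?j \<le> g * \<bar>d s $ ?j\<bar>" using g(2) by (intro mult_left_mono) auto
    ultimately show "- (M + g * M) * exp (- s) \<le> d s $ i - g * d s $ ?j"
      using M[OF s, of i] by (simp add: algebra_simps)
  qed (use k_gt_2 in auto)
  moreover have "0 \<le> b * d t $ ?j - d t $ i" if t: "t \<le> 0" for t
  proof (rule backward_growth_nonneg[OF _ _ cascade_rate[OF c, of i] _ _ t, where p = "\<lambda>t. b * d t $ ?j - d t $ i"])
    fix s :: real assume s: "s \<le> 0"
    show "((\<lambda>t. b * d t $ ?j - d t $ i) has_real_derivative
       b * (k * (d s $ ?l - d s $ ?j) - c ?j s * d s $ ?j) - (k * (d s $ ?j - d s $ i) - c i s * d s $ i)) (at s)"
      by (intro DERIV_diff DERIV_cmult cascadeD(1)[OF c])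
    have "(k - 2 * real m) * d s $ ?j \<le> k * d s $ ?l + (c i s - c ?j s) * d s $ ?j"
      using IH(3)[OF s] cc[OF s] by (simp add: algebra_simps)
    then have "b * ((k - 2 * real m) * d s $ ?j) \<le> b * (k * d s $ ?l + (c i s - c ?j s) * d s $ ?j)"
      using b(2) by (intro mult_left_mono) auto
    moreover have "b * ((k - 2 * real m) * d s $ ?j) = k * d s $ ?j" by (simp only: mult.assoc[symmetric] b(1))
    ultimately show "- (k + c i s) * (b * d s $ ?j - d s $ i)
       \<le> b * (k * (d s $ ?l - d s $ ?j) - c ?j s * d s $ ?j) - (k * (d s $ ?j - d s $ i) - c i s * d s $ i)"
      by (simp add: algebra_simps)
    \<comment> \<open>Positivity of \<open>b * d_j\<close> leaves only \<open>d_i\<close> to be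
      bounded, so \<open>M\<close> itself serves as growth constant.\<close>
    have "0 < b * d s $ ?j" using b(2) IH(1)[OF s] by simp
    then show "- M * exp (- s) \<le> b * d s $ ?j - d s $ i"
      using M[OF s, of i] by linarith
  qed (use k_gt_2 in auto)
  ultimately show ?case using pos[of t] pred.prems unfolding m(3) g_def[symmetric] b_def[symmetric] by simp
qed

text \<open>Dominates the product of the upper cone bounds along the chain from
  \<open>coord1\<close> to any coordinate.\<close>

definition spread :: real where "spread = cone_beta k (CARD('n) - 1) ^ CARD('n)"

lemma cone_beta_le:
  assumes "m \<le> CARD('n) - 1"
  shows "1 \<le> cone_beta k m" "cone_beta k m \<le> cone_beta k (CARD('n) - 1)"
proof -
  have n: "2 * real (CARD('n) - 1) < k" using k_large card_ge_2 by (simp add: of_nat_diff)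
  moreover have m: "2 * real m \<le> 2 * real (CARD('n) - 1)" using assms of_nat_mono[of m "CARD('n) - 1", where ?'a = real] by linarith
  ultimately have "2 * real m < k" by linarith
  then show "1 \<le> cone_beta k m" by (simp add: cone_beta_eq)
  show "cone_beta k m \<le> cone_beta k (CARD('n) - 1)"
    unfolding cone_beta_eq[OF n] cone_beta_eq[OF \<open>2 * real m < k\<close>]
    using n m k_pos by (intro divide_left_mono mult_pos_pos) auto
qed

lemma spread_pos: "0 < spread"
  using cone_beta_le(1)[of "CARD('n) - 1"] by (auto simp: spread_def)

text \<open>The growth constant in \<open>cascade\<close> depends on \<open>d\<close>;
  \<open>spread\<close> is common to all cascades, which makes the later limit arguments uniform.
  The factor \<open>exp (- t)\<close> comes from the first coordinate, whose rate is at most 1 in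
  absolute value.\<close>

lemma cascade_bound:
  assumes c: "cascade c d" and d0: "0 < d 0 $ coord1" and t: "t \<le> 0"
  shows "0 < d t $ i" "d t $ i \<le> spread * d 0 $ coord1 * exp (- t)"
proof -
  let ?b = "cone_beta k (CARD('n) - 1)"
  show "0 < d t $ i" using cascade_cone[OF c d0 t] by blast
  have first: "0 < d t $ coord1" using cascade_cone[OF c d0 t] by blast
  have b1: "1 \<le> ?b" by (rule cone_beta_le) simp
  have "d t $ i \<le> ?b ^ coord_no i * d t $ coord1"
  proof (induction i rule: coord_induct)
    case first
    show ?case using b1 \<open>0 < d t $ coord1\<close> by (simp add: coord_no_first)
  next
    case (pred i)
    have "d t $ i \<le> cone_beta k (coord_no i - 1) * d t $ pred_coord i" using cascade_cone[OF c d0 t] by blast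
    also have "\<dots> \<le> ?b * d t $ pred_coord i"
      using cone_beta_le(2)[of "coord_no i - 1"] coord_no_range(2)[of i] cascade_cone[OF c d0 t, of "pred_coord i"]
      by (intro mult_right_mono) auto
    also have "\<dots> \<le> ?b * (?b ^ coord_no (pred_coord i) * d t $ coord1)"
      using pred.IH b1 by (intro mult_left_mono) auto
    finally show ?case using coord_no_pred[OF pred(1)] by (simp add: mult.assoc)
  qed
  also have "\<dots> \<le> spread * d t $ coord1"
    unfolding spread_def using b1 first coord_no_range(2)[of i]
    by (intro mult_right_mono power_increasing) auto
  also have "\<dots> \<le> spread * (d 0 $ coord1 * exp (- t))"
  proof -
    have "\<bar>prim (c coord1) t\<bar> \<le> \<bar>t\<bar>" by (intro abs_prim_le cascadeD(2,3)[OF c])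
    then have "d 0 $ coord1 * exp (- prim (c coord1) t) \<le> d 0 $ coord1 * exp (- t)"
      using t d0 by (intro mult_left_mono) auto
    then show ?thesis unfolding cascade_first[OF c, of t] by (rule mult_left_mono) (use spread_pos in simp)
  qed
  finally show "d t $ i \<le> spread * d 0 $ coord1 * exp (- t)" by (simp add: mult.assoc)
qed

text \<open>The first coordinates agree at time 0 and are compared backwards from there. A later
  coordinate is followed forwards from a remote time \<open>- T\<close>: its initial difference, of
  order \<open>exp T\<close>, is damped at rate \<open>k - 1\<close>, so
  \<open>exp (- (k - 2) * T)\<close> remains. The induction must therefore allow arbitrarily long
  windows. Two sequences are compared, rather than one with its limit, because no limit cascade has
  been constructed.\<close>

lemma cascade_compare:
  fixes c c' :: "nat \<Rightarrow> 'n \<Rightarrow> real \<Rightarrow> real" and d d' :: "nat \<Rightarrow> real \<Rightarrow> 'n rvec"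
  assumes c: "\<And>n. cascade (c n) (d n)" "\<And>n. cascade (c' n) (d' n)"
    and d0: "\<And>n. d n 0 $ coord1 = 1" "\<And>n. d' n 0 $ coord1 = 1"
    and conv: "\<And>S e i. 0 < e \<Longrightarrow> \<forall>\<^sub>F n in sequentially. \<forall>t\<in>{-S..0}. \<bar>c n i t - c' n i t\<bar> \<le> e"
    and e: "0 < e" and S: "0 \<le> S"
  shows "\<forall>\<^sub>F n in sequentially. \<forall>t\<in>{-S..0}. \<bar>d n t $ i - d' n t $ i\<bar> \<le> e"
  using e S
proof (induction i arbitrary: e S rule: coord_induct)
  case first
  \<comment> \<open>Forcing of size \<open>e1 * (spread * exp S)\<close> accumulates to at most
    \<open>e\<close> over the window by \<open>backward_forced_bound\<close>.\<close>
  define e1 where "e1 = e / (spread * exp S * exp S)"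
  have "0 < e1" using first spread_pos by (simp add: e1_def)
  then have "\<forall>\<^sub>F n in sequentially. \<forall>t\<in>{-S..0}. \<bar>c n coord1 t - c' n coord1 t\<bar> \<le> e1" by (rule conv)
  then show ?case
  proof eventually_elim
    case (elim n)
    show ?case
    proof
      fix t assume t: "t \<in> {-S..0}"
      have "\<bar>d n t $ coord1 - d' n t $ coord1\<bar> \<le> (e1 * (spread * exp S)) * exp S"
      proof (rule backward_forced_bound[where e = "\<lambda>t. d n t $ coord1 - d' n t $ coord1"
            and f = "\<lambda>t. - (c n coord1 t - c' n coord1 t) * d' n t $ coord1" and c = "c n coord1" and S = S])
        fix s
        show "((\<lambda>t. d n t $ coord1 - d' n t $ coord1) has_real_derivative
           - (c n coord1 s - c' n coord1 s) * d' n s $ coord1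
           - c n coord1 s * (d n s $ coord1 - d' n s $ coord1)) (at s)"
          by (rule DERIV_cong[OF DERIV_diff[OF cascadeD(1)[OF c(1)] cascadeD(1)[OF c(2)]]]) (simp add: algebra_simps)
        assume s: "- S \<le> s" "s \<le> 0"
        have "spread * exp (- s) \<le> spread * exp S" using s spread_pos by (intro mult_left_mono) auto
        then have "\<bar>d' n s $ coord1\<bar> \<le> spread * exp S"
          using cascade_bound[OF c(2)[of n] _ s(2), of coord1] d0(2)[of n] by auto
        then show "\<bar>- (c n coord1 s - c' n coord1 s) * d' n s $ coord1\<bar> \<le> e1 * (spread * exp S)"
          unfolding abs_mult using elim s \<open>0 < e1\<close> by (intro mult_mono) (auto simp: abs_minus_commute)
      qed (use t d0 cascadeD(2,3)[OF c(1)] in auto)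
      also have "\<dots> = e" using spread_pos by (simp add: e1_def)
      finally show "\<bar>d n t $ coord1 - d' n t $ coord1\<bar> \<le> e" .
    qed
  qed
next
  case (pred i)
  let ?j = "pred_coord i"
  have "((\<lambda>T. exp (- (k - 2) * T)) \<longlongrightarrow> 0) at_top"
    using k_gt_2 by (intro filterlim_compose[OF exp_at_bot] filterlim_tendsto_neg_mult_at_bot[OF tendsto_const]) (auto simp: filterlim_ident)
  then have "((\<lambda>T. 2 * spread * exp ((k - 1) * S) * exp (- (k - 2) * T)) \<longlongrightarrow> 0) at_top"
    by (rule tendsto_mult_right_zero)
  then have "\<forall>\<^sub>F T in at_top. 2 * spread * exp ((k - 1) * S) * exp (- (k - 2) * T) < e / 2"
    using pred.prems by (intro order_tendstoD(2)[of _ 0]) auto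
  then have "\<forall>\<^sub>F T in at_top. 2 * spread * exp ((k - 1) * S) * exp (- (k - 2) * T) < e / 2 \<and> S \<le> T"
    using eventually_ge_at_top[of S] by (rule eventually_conj)
  from eventually_happens'[OF trivial_limit_at_top_linorder this]
  obtain T where T: "2 * spread * exp ((k - 1) * S) * exp (- (k - 2) * T) < e / 2" "S \<le> T"
    by blast
  \<comment> \<open>Each of the two forcing terms is to contribute at most
    \<open>(k - 1) * e / 4\<close>; division by the rate \<open>k - 1\<close> leaves
    \<open>e / 2\<close> in total.\<close>
  define e1 where "e1 = (k - 1) * e / (4 * spread * exp T)"
  define e2 where "e2 = (k - 1) * e / (4 * k)"
  have e12: "0 < e1" "0 < e2" using pred.prems spread_pos k_gt_2 by (auto simp: e1_def e2_def)
  have "\<forall>\<^sub>F n in sequentially. \<forall>t\<in>{-T..0}. \<bar>d n t $ ?j - d' n t $ ?j\<bar> \<le> e2"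
    using pred.IH[OF e12(2)] T(2) pred.prems by simp
  moreover have "\<forall>\<^sub>F n in sequentially. \<forall>t\<in>{-T..0}. \<bar>c n i t - c' n i t\<bar> \<le> e1" by (rule conv[OF e12(1)])
  ultimately show ?case
  proof eventually_elim
    case (elim n)
    show ?case
    proof
      fix t assume t: "t \<in> {-S..0}"
      let ?e = "\<lambda>t. d n t $ i - d' n t $ i"
      let ?f = "\<lambda>t. k * (d n t $ ?j - d' n t $ ?j) - (c n i t - c' n i t) * d' n t $ i"
      have bd: "0 < d n s $ i" "d n s $ i \<le> spread * exp T" "0 < d' n s $ i" "d' n s $ i \<le> spread * exp T"
        if s: "- T \<le> s" "s \<le> 0" for s
      proof -
        have "spread * exp (- s) \<le> spread * exp T" using s spread_pos by (intro mult_left_mono) auto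
        then show "0 < d n s $ i" "d n s $ i \<le> spread * exp T" "0 < d' n s $ i" "d' n s $ i \<le> spread * exp T"
          using cascade_bound[OF c(1)[of n] _ s(2), of i] cascade_bound[OF c(2)[of n] _ s(2), of i] d0[of n] by auto
      qed
      have "\<bar>?e t\<bar> \<le> \<bar>?e (- T)\<bar> * exp (- (k - 1) * (t - (- T))) + ((k - 1) * e / 2) / (k - 1)"
      proof (rule linear_forced_bound[where e = ?e and f = ?f and a = "\<lambda>t. k + c n i t"])
        fix s assume s: "- T \<le> s" "s \<le> t"
        have s0: "s \<le> 0" using s t by simp
        show "(?e has_real_derivative ?f s - (k + c n i s) * ?e s) (at s)"
          by (rule DERIV_cong[OF DERIV_diff[OF cascadeD(1)[OF c(1)] cascadeD(1)[OF c(2)]]]) (simp add: algebra_simps)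
        have "\<bar>(c n i s - c' n i s) * d' n s $ i\<bar> \<le> e1 * (spread * exp T)"
          unfolding abs_mult using elim s s0 bd[OF s(1) s0] e12 by (intro mult_mono) auto
        also have "\<dots> = (k - 1) * e / 4" using spread_pos by (simp add: e1_def)
        finally have "\<bar>(c n i s - c' n i s) * d' n s $ i\<bar> \<le> (k - 1) * e / 4" .
        moreover have "\<bar>k * (d n s $ ?j - d' n s $ ?j)\<bar> \<le> (k - 1) * e / 4"
        proof -
          have "k * \<bar>d n s $ ?j - d' n s $ ?j\<bar> \<le> k * e2" using elim s s0 k_pos by (intro mult_left_mono) auto
          also have "\<dots> = (k - 1) * e / 4" using k_pos by (simp add: e2_def)
          finally show ?thesis using k_pos by (simp add: abs_mult)
        qed
        ultimately show "\<bar>?f s\<bar> \<le> (k - 1) * e / 2" by linarith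
      next
        show "continuous_on UNIV (\<lambda>t. k + c n i t)" by (rule cascade_rate[OF c(1)])
        show "k - 1 \<le> k + c n i s" for s by (rule cascade_rate[OF c(1)])
      qed (use k_gt_2 t T in auto)
      also have "\<bar>?e (- T)\<bar> * exp (- (k - 1) * (t - (- T))) \<le> 2 * spread * exp ((k - 1) * S) * exp (- (k - 2) * T)"
      proof -
        have "\<bar>?e (- T)\<bar> \<le> 2 * (spread * exp T)" using bd[of "- T"] T(2) pred.prems by auto
        moreover have "(k - 1) * (- S) \<le> (k - 1) * t" using t k_gt_2 by (intro mult_left_mono) auto
        then have "exp (- (k - 1) * (t - (- T))) \<le> exp (- (k - 1) * (- S + T))" by (simp add: algebra_simps)
        ultimately have "\<bar>?e (- T)\<bar> * exp (- (k - 1) * (t - (- T))) \<le> 2 * (spread * exp T) * exp (- (k - 1) * (- S + T))"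
          using spread_pos by (intro mult_mono) auto
        also have "exp T * exp (- (k - 1) * (- S + T)) = exp ((k - 1) * S) * exp (- (k - 2) * T)"
          by (simp add: algebra_simps flip: exp_add)
        then have "2 * (spread * exp T) * exp (- (k - 1) * (- S + T)) = 2 * spread * exp ((k - 1) * S) * exp (- (k - 2) * T)"
          by (simp only: mult.assoc)
        finally show ?thesis .
      qed
      also have "(k - 1) * e / 2 / (k - 1) = e / 2" using k_gt_2 by (simp add: field_simps)
      finally show "\<bar>?e t\<bar> \<le> e" using T(1) by linarith
    qed
  qed
qed

section \<open>Entire solutions as a curve parametrised by the first coordinate\<close>

lemma entire_diff_growth:
  assumes u: "u \<in> entire" and v: "v \<in> entire"
  shows "\<exists>M. \<forall>t\<le>0. \<forall>i. \<bar>(u t - v t) $ i\<bar> \<le> M * exp (- t)"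
proof -
  have su: "solves u" and sv: "solves v" using u v by (auto simp: entire_def)
  \<comment> \<open>Temperedness with exponent 1 matches the growth \<open>exp (- t)\<close> of the
    first coordinate, the rate allowed in \<open>cascade\<close>.\<close>
  obtain M where M: "\<And>t. R t \<le> M * exp (1 * \<bar>t\<bar>)" using R_tempered[of 1] by auto
  let ?c = "\<bar>u 0 $ coord1 - v 0 $ coord1\<bar>" and ?N = "real CARD('n)"
  have mw: "0 \<le> max_width" using width_le[of undefined] width_ge_1[of undefined] by linarith
  have "\<bar>(u t - v t) $ i\<bar> \<le> ?N * (?c + ?N * (2 * max_width * M)) * exp (- t)" if t: "t \<le> 0" for t i
  proof -
    have gap: "\<bar>(u t - v t) $ i - (u t - v t) $ pred_coord i\<bar> \<le> 2 * max_width * (M * exp (- t))" for i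
    proof -
      have "u t \<in> absorbing t" "v t \<in> absorbing t" using u v by (auto simp: entire_def)
      then have "\<bar>u t $ i - u t $ pred_coord i\<bar> \<le> width i * R t" "\<bar>v t $ i - v t $ pred_coord i\<bar> \<le> width i * R t"
        by (auto simp: absorbing_def)
      moreover have "width i * R t \<le> max_width * (M * exp (- t))"
        using width_le[of i] width_ge_1[of i] R_pos[of t] M[of t] t by (intro mult_mono) auto
      moreover have "\<bar>(u t - v t) $ i - (u t - v t) $ pred_coord i\<bar> \<le> \<bar>u t $ i - u t $ pred_coord i\<bar> + \<bar>v t $ i - v t $ pred_coord i\<bar>"
        by simp
      ultimately show ?thesis by linarith
    qed
    have "\<bar>(u t - v t) $ coord1\<bar> \<le> ?c * exp (- t)"
    proof -
      have "\<bar>prim (slope u v coord1) t\<bar> \<le> \<bar>t\<bar>" by (intro abs_prim_le slope_continuous su sv abs_slope_le)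
      then have "exp (- prim (slope u v coord1) t) \<le> exp (- t)" using t by simp
      then show ?thesis using first_diff_formula[OF su sv, of t] by (simp add: abs_mult mult_left_mono)
    qed
    then have "?N * (\<bar>(u t - v t) $ coord1\<bar> + ?N * (2 * max_width * (M * exp (- t))))
      \<le> ?N * (?c * exp (- t) + ?N * (2 * max_width * (M * exp (- t))))"
      by (intro mult_left_mono add_right_mono) auto
    then have "norm (u t - v t) \<le> ?N * (?c * exp (- t) + ?N * (2 * max_width * (M * exp (- t))))"
      using norm_le_of_gaps[OF gap] by linarith
    then show ?thesis using component_le_norm_cart[of "u t - v t" i] by (simp add: algebra_simps)
  qed
  then show ?thesis by blast
qed

lemma entire_diff_cascade:
  assumes u: "u \<in> entire" and v: "v \<in> entire"
  shows "cascade (slope u v) (\<lambda>t. r *\<^sub>R (u t - v t))"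
proof -
  have su: "solves u" and sv: "solves v" using u v by (auto simp: entire_def)
  obtain M where M: "\<And>t i. t \<le> 0 \<Longrightarrow> \<bar>(u t - v t) $ i\<bar> \<le> M * exp (- t)" using entire_diff_growth[OF u v] by blast
  show ?thesis unfolding cascade_def
  proof (intro conjI allI)
    show "((\<lambda>t. (r *\<^sub>R (u t - v t)) $ i) has_real_derivative
       k * ((r *\<^sub>R (u t - v t)) $ pred_coord i - (r *\<^sub>R (u t - v t)) $ i) - slope u v i t * (r *\<^sub>R (u t - v t)) $ i) (at t)" for i t
      using DERIV_cmult[OF solutions_diff_derivative[OF su sv, of i t], of r] by (simp add: algebra_simps)
    have "\<bar>(r *\<^sub>R (u t - v t)) $ i\<bar> \<le> \<bar>r\<bar> * M * exp (- t)" if "t \<le> 0" for t i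
      using mult_left_mono[OF M[OF that, of i], of "\<bar>r\<bar>"] by (simp add: abs_mult)
    then show "\<exists>M. \<forall>t\<le>0. \<forall>i. \<bar>(r *\<^sub>R (u t - v t)) $ i\<bar> \<le> M * exp (- t)" by blast
  qed (use slope_continuous[OF su sv] abs_slope_le in auto)
qed

lemma fibre_unique:
  assumes u: "u \<in> entire" and v: "v \<in> entire" and eq: "u 0 $ coord1 = v 0 $ coord1"
  shows "u = v"
proof -
  have "(1 *\<^sub>R (u 0 - v 0)) $ i = 0" for i
    by (rule cascade_zero[OF entire_diff_cascade[OF u v, of 1]]) (use eq in auto)
  then have "u 0 = v 0" by (simp add: vec_eq_iff)
  then show ?thesis using u v solution_unique by (auto simp: entire_def)
qed

definition strand :: "real \<Rightarrow> real \<Rightarrow> 'n rvec" where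
  "strand a = (THE u. u \<in> entire \<and> u 0 $ coord1 = a)"

lemma strand: "strand a \<in> entire" "strand a 0 $ coord1 = a"
proof -
  obtain u where "u \<in> entire \<and> u 0 $ coord1 = a" using fibre_exists by blast
  then have "strand a \<in> entire \<and> strand a 0 $ coord1 = a"
    unfolding strand_def
    by (rule theI[of "\<lambda>u. u \<in> entire \<and> u 0 $ coord1 = a"])
      (use \<open>u \<in> entire \<and> u 0 $ coord1 = a\<close> fibre_unique in blast)
  then show "strand a \<in> entire" "strand a 0 $ coord1 = a" by auto
qed

lemma strand_unique: "u \<in> entire \<Longrightarrow> strand (u 0 $ coord1) = u"
  using fibre_unique strand by blast

definition quotient :: "real \<Rightarrow> real \<Rightarrow> real \<Rightarrow> 'n rvec" where
  "quotient a b t = (strand a t - strand b t) /\<^sub>R (a - b)"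

lemma quotient_cascade: "cascade (slope (strand a) (strand b)) (quotient a b)"
  unfolding quotient_def by (intro entire_diff_cascade strand)

lemma quotient_first: "a \<noteq> b \<Longrightarrow> quotient a b 0 $ coord1 = 1"
  by (simp add: quotient_def strand)

lemma norm_quotient_le:
  assumes "a \<noteq> b"
  shows "norm (quotient a b 0) \<le> real CARD('n) * spread"
proof (rule norm_le_of_components)
  show "\<bar>quotient a b 0 $ i\<bar> \<le> spread" for i
    using cascade_bound[OF quotient_cascade, of a b 0 i] quotient_first[OF assms] by simp
qed

lemma strand_lipschitz: "norm (strand a 0 - strand b 0) \<le> real CARD('n) * spread * \<bar>a - b\<bar>"
proof (cases "a = b")
  case False
  then have "norm (strand a 0 - strand b 0) = norm (quotient a b 0) * \<bar>a - b\<bar>" by (simp add: quotient_def)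
  also have "\<dots> \<le> real CARD('n) * spread * \<bar>a - b\<bar>" by (intro mult_right_mono norm_quotient_le False) auto
  finally show ?thesis .
qed simp

text \<open>The slopes depend on the strands only through their values, which are Lipschitz in the
  label at time 0 and, by \<open>solutions_close\<close>, on the whole window
  \<open>[-S, 0]\<close>. Both labels may move, as \<open>C1_of_difference_quotients\<close>
  requires.\<close>

lemma strand_slope_converges:
  assumes a: "a \<longlonglongrightarrow> b0" and b: "b \<longlonglongrightarrow> b0" and e: "0 < e"
  shows "\<forall>\<^sub>F n in sequentially. \<forall>t\<in>{-S..0}. \<bar>slope (strand (a n)) (strand (b n)) i t - cos (strand b0 t $ i + z t $ i)\<bar> \<le> e"
proof -
  let ?C = "exp (lip * S) * (real CARD('n) * spread)"
  have "(\<lambda>n. ?C * (\<bar>a n - b0\<bar> + \<bar>b n - b0\<bar>)) \<longlonglongrightarrow> ?C * (\<bar>b0 - b0\<bar> + \<bar>b0 - b0\<bar>)"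
    by (intro tendsto_intros a b)
  then have "\<forall>\<^sub>F n in sequentially. ?C * (\<bar>a n - b0\<bar> + \<bar>b n - b0\<bar>) < e"
    using e by (intro order_tendstoD(2)[where y = 0]) auto
  then show ?thesis
  proof eventually_elim
    case (elim n)
    have near: "\<bar>strand x t $ i - strand b0 t $ i\<bar> \<le> ?C * \<bar>x - b0\<bar>" if t: "t \<in> {-S..0}" for x t
    proof -
      have "norm (strand x t - strand b0 t) \<le> exp (lip * \<bar>t - 0\<bar>) * norm (strand x 0 - strand b0 0)"
        by (intro solutions_close) (use strand(1) in \<open>auto simp: entire_def\<close>)
      also have "\<dots> \<le> exp (lip * S) * (real CARD('n) * spread * \<bar>x - b0\<bar>)"
      proof (intro mult_mono strand_lipschitz)
        show "exp (lip * \<bar>t - 0\<bar>) \<le> exp (lip * S)"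
          using t mult_left_mono[of "\<bar>t\<bar>" S lip] lip_pos by simp
      qed auto
      finally show ?thesis using component_le_norm_cart[of "strand x t - strand b0 t" i] by (simp add: mult.assoc)
    qed
    show ?case
    proof
      fix t assume t: "t \<in> {-S..0}"
      have "\<bar>slope (strand (a n)) (strand (b n)) i t - cos (strand b0 t $ i + z t $ i)\<bar>
        \<le> \<bar>strand (a n) t $ i - strand b0 t $ i\<bar> + \<bar>strand (b n) t $ i - strand b0 t $ i\<bar>"
        using sin_slope_near_cos[of "strand (a n) t $ i + z t $ i" "strand (b n) t $ i + z t $ i" "strand b0 t $ i + z t $ i"]
        by (simp add: slope_def)
      also have "\<dots> \<le> ?C * \<bar>a n - b0\<bar> + ?C * \<bar>b n - b0\<bar>" by (intro add_mono near t)
      finally show "\<bar>slope (strand (a n)) (strand (b n)) i t - cos (strand b0 t $ i + z t $ i)\<bar> \<le> e"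
        using elim by (simp add: algebra_simps)
    qed
  qed
qed

text \<open>Both families of slopes approach the cosine along the strand of \<open>b0\<close>, hence
  each other, and \<open>cascade_compare\<close> applies.\<close>

lemma quotient_compare:
  assumes lim: "a \<longlonglongrightarrow> b0" "b \<longlonglongrightarrow> b0" "a' \<longlonglongrightarrow> b0" "b' \<longlonglongrightarrow> b0"
    and ne: "\<And>n. a n \<noteq> b n" "\<And>n. a' n \<noteq> b' n"
  shows "(\<lambda>n. quotient (a n) (b n) 0 - quotient (a' n) (b' n) 0) \<longlonglongrightarrow> 0"
proof (rule vec_tendstoI, rule tendstoI)
  fix i and e :: real assume e: "0 < e"
  have conv: "\<forall>\<^sub>F n in sequentially. \<forall>t\<in>{-S..0}. \<bar>slope (strand (a n)) (strand (b n)) i t - slope (strand (a' n)) (strand (b' n)) i t\<bar> \<le> e"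
    if e: "0 < e" for S e i
  proof -
    have e2: "0 < e / 2" using e by simp
    show ?thesis
      using strand_slope_converges[OF lim(1,2) e2, of S i] strand_slope_converges[OF lim(3,4) e2, of S i]
    proof eventually_elim
      case (elim n)
      show ?case
      proof
        fix t assume "t \<in> {-S..0}"
        with elim have "\<bar>slope (strand (a n)) (strand (b n)) i t - cos (strand b0 t $ i + z t $ i)\<bar> \<le> e / 2"
          "\<bar>slope (strand (a' n)) (strand (b' n)) i t - cos (strand b0 t $ i + z t $ i)\<bar> \<le> e / 2" by auto
        then show "\<bar>slope (strand (a n)) (strand (b n)) i t - slope (strand (a' n)) (strand (b' n)) i t\<bar> \<le> e" by linarith
      qed
    qed
  qed
  have "\<forall>\<^sub>F n in sequentially. \<forall>t\<in>{-0..0}. \<bar>quotient (a n) (b n) t $ i - quotient (a' n) (b' n) t $ i\<bar> \<le> e / 2"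
    by (rule cascade_compare[OF quotient_cascade quotient_cascade]) (use ne conv e quotient_first in auto)
  then show "\<forall>\<^sub>F n in sequentially. dist ((quotient (a n) (b n) 0 - quotient (a' n) (b' n) 0) $ i) (0 $ i) < e"
    by eventually_elim (use e in \<open>simp add: dist_real_def\<close>)
qed

lemma strand_C1:
  obtains h' where "continuous_on UNIV h'" "\<And>b. ((\<lambda>a. strand a 0) has_vector_derivative h' b) (at b)"
proof -
  have "\<exists>l. \<forall>a b. a \<longlonglongrightarrow> b0 \<longrightarrow> b \<longlonglongrightarrow> b0 \<longrightarrow> (\<forall>n. a n \<noteq> b n) \<longrightarrow> (\<lambda>n. quotient (a n) (b n) 0) \<longlonglongrightarrow> l" for b0
  proof -
    \<comment> \<open>One reference sequence of quotients has a convergent subsequence; by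
      \<open>quotient_compare\<close> every other sequence must share its limit.\<close>
    define c where "c = (\<lambda>n. b0 + inverse (real (Suc n)))"
    have "\<forall>n. quotient (c n) b0 0 \<in> cball 0 (real CARD('n) * spread)" by (simp add: c_def norm_quotient_le)
    then obtain l r where r: "strict_mono r" "(\<lambda>n. quotient (c (r n)) b0 0) \<longlonglongrightarrow> l"
      using compact_cball[of "0 :: 'n rvec"] unfolding compact_def o_def by meson
    have "c \<longlonglongrightarrow> b0" using tendsto_add[OF tendsto_const LIMSEQ_inverse_real_of_nat, of b0] by (simp add: c_def)
    then have c: "(\<lambda>n. c (r n)) \<longlonglongrightarrow> b0" using LIMSEQ_subseq_LIMSEQ[OF _ r(1)] by (simp add: o_def)
    have "(\<lambda>n. quotient (a n) (b n) 0) \<longlonglongrightarrow> l"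
      if "a \<longlonglongrightarrow> b0" "b \<longlonglongrightarrow> b0" "\<And>n. a n \<noteq> b n" for a b
      using tendsto_add[OF quotient_compare[OF that(1,2) c tendsto_const that(3)] r(2)] by (simp add: c_def)
    then show ?thesis by blast
  qed
  then obtain h' where h': "\<And>b0 a b. a \<longlonglongrightarrow> b0 \<Longrightarrow> b \<longlonglongrightarrow> b0 \<Longrightarrow> (\<And>n. a n \<noteq> b n) \<Longrightarrow> (\<lambda>n. quotient (a n) (b n) 0) \<longlonglongrightarrow> h' b0"
    by metis
  show thesis
    using that C1_of_difference_quotients[of "\<lambda>a. strand a 0" h', OF h'[unfolded quotient_def]] by blast
qed

text \<open>The cone is closed, so the estimate of \<open>cascade_cone\<close> at time 0 passes from
  the quotients to the derivative.\<close>

lemma strand_derivative_cone: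
  assumes h': "((\<lambda>a. strand a 0) has_vector_derivative v) (at b)" and i: "coord_no j = Suc (coord_no i)"
  shows "cone_gamma k (coord_no i) * v $ i \<le> v $ j \<and> v $ j \<le> cone_beta k (coord_no i) * v $ i"
proof -
  have "j \<noteq> coord1" using i coord_no_first[where ?'n = 'n] coord_no_range(1)[of i] by auto
  then have pj: "pred_coord j = i" using coord_no_pred[of j] i by (metis coord_no_inj nat.inject)
  have lim: "((\<lambda>a. quotient a b 0) \<longlongrightarrow> v) (at b)"
    using h' by (simp add: has_vector_derivative_iff_quotient quotient_def)
  have cone: "cone_gamma k (coord_no i) * quotient a b 0 $ i \<le> quotient a b 0 $ j
     \<and> quotient a b 0 $ j \<le> cone_beta k (coord_no i) * quotient a b 0 $ i" if "a \<noteq> b" for a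
    using cascade_cone[OF quotient_cascade, of a b 0 j] quotient_first[OF that] i by (simp add: pj)
  have ev: "\<forall>\<^sub>F a in at b. a \<noteq> b" by (simp add: eventually_at_filter)
  show ?thesis
  proof
    show "cone_gamma k (coord_no i) * v $ i \<le> v $ j"
      by (rule tendsto_le[of "at b" "\<lambda>a. quotient a b 0 $ j" _ "\<lambda>a. cone_gamma k (coord_no i) * quotient a b 0 $ i"])
        (auto intro!: tendsto_intros lim eventually_mono[OF ev] simp: cone)
    show "v $ j \<le> cone_beta k (coord_no i) * v $ i"
      by (rule tendsto_le[of "at b" "\<lambda>a. cone_beta k (coord_no i) * quotient a b 0 $ i" _ "\<lambda>a. quotient a b 0 $ j"])
        (auto intro!: tendsto_intros lim eventually_mono[OF ev] simp: cone)
  qed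
qed

end

section \<open>The quotient manifold\<close>

abbreviation period :: "int \<Rightarrow> real^'n" where
  "period m \<equiv> (2 * pi * of_int m) *\<^sub>R diag_vec"

lemma cyl_proj_eq_iff: "cyl_proj x = cyl_proj y \<longleftrightarrow> (\<exists>m::int. x - y = period m)"
  by (simp add: cylinder.abs_eq_iff cyl_rel_def)

lemma cyl_proj_shift [simp]: "cyl_proj (x + period m) = cyl_proj x"
  by (auto simp: cyl_proj_eq_iff)

lemma cyl_proj_surj: obtains x where "cyl_proj x = p"
  by (induction p rule: cylinder.abs_induct) auto

lemma dist_cyl_proj: "dist (cyl_proj x) (cyl_proj y) = (INF m. cyl_norm (x - y) m)"
  by (rule dist_cylinder.abs_eq)

lemma dist_cyl_proj_le: "dist (cyl_proj x) (cyl_proj y) \<le> norm (x - y)"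
  unfolding dist_cyl_proj using cINF_lower[OF cyl_norm_bdd[of "x - y"], of 0] by simp

text \<open>The distance is an infimum over translates, so a strict inequality yields one translate
  that is close enough.\<close>

lemma dist_cyl_lift:
  assumes "dist (cyl_proj x) p < c"
  obtains y where "cyl_proj y = p" "norm (x - y) < c"
proof -
  obtain y where y: "cyl_proj y = p" by (rule cyl_proj_surj)
  have "(INF m. cyl_norm (x - y) m) < c" using assms y dist_cyl_proj by metis
  then obtain m where "cyl_norm (x - y) m < c"
    using cINF_less_iff[OF _ cyl_norm_bdd[of "x - y"], of c] by auto
  then have "norm (x - (y + period m)) < c" by (simp add: algebra_simps)
  moreover have "cyl_proj (y + period m) = p" using y by simp
  ultimately show thesis using that by blast
qed

lemma continuous_cyl_proj: "continuous_on S (cyl_proj :: real^'n \<Rightarrow> 'n cylinder)"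
  unfolding continuous_on_iff
proof (intro ballI allI impI)
  fix x :: "real^'n" and e :: real assume "0 < e"
  then show "\<exists>d>0. \<forall>x'\<in>S. dist x' x < d \<longrightarrow> dist (cyl_proj x') (cyl_proj x) < e"
    using dist_cyl_proj_le by (intro exI[of _ e]) (auto simp: dist_norm intro: le_less_trans)
qed

lemma drift_shift: "drift k \<alpha> z (x + period m) = drift k \<alpha> z x"
proof -
  have "sin (a + (2 * pi * of_int m + b)) = sin (a + b)" for a b :: real
  proof -
    have "sin (a + (2 * pi * of_int m + b)) = sin ((a + b) + 2 * pi * of_int m)" by (simp add: algebra_simps)
    then show ?thesis by (simp add: sin_add)
  qed
  then show ?thesis by (simp add: vec_eq_iff drift_def diag_vec_def add.assoc)
qed

section \<open>The attractor along one noise path\<close>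

context coupled_rde
begin

lemma solves_shift: "solves u \<Longrightarrow> solves (\<lambda>t. u t + period m)"
  unfolding solves_def drift_shift by (auto intro!: derivative_eq_intros)

lemma absorbing_shift: "x + period m \<in> absorbing t \<longleftrightarrow> x \<in> absorbing t"
  by (simp add: absorbing_def diag_vec_def)

lemma entire_shift: "u \<in> entire \<Longrightarrow> (\<lambda>t. u t + period m) \<in> entire"
  using solves_shift by (simp add: entire_def absorbing_shift)

lemma shift_into_period:
  obtains m :: int where "0 \<le> (x + period m :: 'n rvec) $ coord1"
    "(x + period m) $ coord1 \<le> 2 * pi"
proof
  let ?q = "\<lfloor>x $ coord1 / (2 * pi)\<rfloor>"
  have "of_int ?q \<le> x $ coord1 / (2 * pi)" "x $ coord1 / (2 * pi) \<le> of_int ?q + 1" by linarith+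
  then have "of_int ?q * (2 * pi) \<le> x $ coord1" "x $ coord1 \<le> (of_int ?q + 1) * (2 * pi)"
    by (simp_all only: pos_le_divide_eq pos_divide_le_eq pi_gt_zero mult_pos_pos zero_less_numeral)
  then show "0 \<le> (x + period (- ?q)) $ coord1"
    "(x + period (- ?q)) $ coord1 \<le> 2 * pi"
    by (simp_all add: diag_vec_def algebra_simps)
qed

definition attractor_fibre :: "'n cylinder set" where
  "attractor_fibre = (\<lambda>u. cyl_proj (u 0)) ` entire"

lemma attractor_fibre_nonempty: "attractor_fibre \<noteq> {}"
  using fibre_exists[of 0] by (auto simp: attractor_fibre_def)

lemma attractor_fibre_lift:
  assumes "p \<in> attractor_fibre"
  obtains u where "u \<in> entire" "cyl_proj (u 0) = p" "0 \<le> u 0 $ coord1" "u 0 $ coord1 \<le> 2 * pi"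
proof -
  obtain u where u: "u \<in> entire" "cyl_proj (u 0) = p" using assms by (auto simp: attractor_fibre_def)
  obtain m :: int where "0 \<le> (u 0 + period m) $ coord1"
    "(u 0 + period m) $ coord1 \<le> 2 * pi" by (rule shift_into_period)
  then show thesis using that[OF entire_shift[OF u(1), of m]] u(2) by simp
qed

lemma attractor_fibre_lift_norm:
  assumes "u \<in> entire" "0 \<le> u 0 $ coord1" "u 0 $ coord1 \<le> 2 * pi"
  shows "norm (u 0) \<le> real CARD('n) * (2 * pi + real CARD('n) * (max_width * R 0))"
proof -
  have "norm (u 0) \<le> real CARD('n) * (\<bar>u 0 $ coord1\<bar> + real CARD('n) * (max_width * R 0))"
    using assms(1) by (intro norm_absorbing_le) (auto simp: entire_def)
  also have "\<dots> \<le> real CARD('n) * (2 * pi + real CARD('n) * (max_width * R 0))"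
    using assms by (intro mult_left_mono) auto
  finally show ?thesis .
qed

text \<open>Every point has a lift with first coordinate in the closed domain
  \<open>[0, 2 * pi]\<close>, and limits of entire solutions started there are again of this
  kind.\<close>

lemma compact_attractor_fibre: "compact attractor_fibre"
proof -
  let ?S = "{u 0 |u. u \<in> entire \<and> 0 \<le> u 0 $ coord1 \<and> u 0 $ coord1 \<le> 2 * pi}"
  have "seq_compact ?S" unfolding seq_compact_def
  proof (intro allI impI)
    fix f :: "nat \<Rightarrow> 'n rvec" assume "\<forall>n. f n \<in> ?S"
    then have "\<forall>n. \<exists>u. f n = u 0 \<and> u \<in> entire \<and> 0 \<le> u 0 $ coord1 \<and> u 0 $ coord1 \<le> 2 * pi" by blast
    then obtain u where u: "\<And>n. f n = u n 0" "\<And>n. u n \<in> entire" "\<And>n. 0 \<le> u n 0 $ coord1"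
      "\<And>n. u n 0 $ coord1 \<le> 2 * pi" by metis
    obtain r v where r: "strict_mono r" "solves v" "\<And>t. (\<lambda>n. u (r n) t) \<longlonglongrightarrow> v t"
      using solution_subseq_limit[of u, OF _ attractor_fibre_lift_norm[OF u(2-4)]] u(2) by (auto simp: entire_def)
    have "v t \<in> absorbing t" for t
      using u(2) by (intro absorbing_closed_limit[OF _ r(3)]) (auto simp: entire_def)
    then have "v \<in> entire" using r(2) by (simp add: entire_def)
    moreover have lim: "(\<lambda>n. u (r n) 0 $ coord1) \<longlonglongrightarrow> v 0 $ coord1" by (intro tendsto_intros r(3))
    have "0 \<le> v 0 $ coord1" by (rule tendsto_lowerbound[OF lim]) (use u(3) in auto)
    moreover have "v 0 $ coord1 \<le> 2 * pi" by (rule tendsto_upperbound[OF lim]) (use u(4) in auto)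
    ultimately have "v 0 \<in> ?S" by blast
    moreover have "(f \<circ> r) \<longlonglongrightarrow> v 0" using r(3)[of 0] by (simp add: o_def u(1))
    ultimately show "\<exists>l\<in>?S. \<exists>r. strict_mono r \<and> (f \<circ> r) \<longlonglongrightarrow> l" using r(1) by blast
  qed
  then have "compact (cyl_proj ` ?S)"
    by (intro compact_continuous_image continuous_cyl_proj) (simp add: compact_eq_seq_compact_metric)
  moreover have "cyl_proj ` ?S = attractor_fibre"
  proof (intro equalityI subsetI)
    fix p assume "p \<in> attractor_fibre"
    then show "p \<in> cyl_proj ` ?S" by (rule attractor_fibre_lift) blast
  qed (auto simp: attractor_fibre_def)
  ultimately show ?thesis by simp
qed

text \<open>The absorbing set at time \<open>- n\<close>, transported to time 0: the pullback
  approximation through which the attractor becomes measurable.\<close>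

definition stage :: "nat \<Rightarrow> 'n cylinder set" where
  "stage n = {cyl_proj (u 0) |u. solves u \<and> u (- real n) \<in> absorbing (- real n)}"

text \<open>Near-minimisers chosen from the successive stages have a subsequence converging at all
  times. Its limit is absorbing at every \<open>t\<close>, as \<open>u (r n)\<close> is so once
  \<open>- r n \<le> t\<close>, and therefore entire. This reduces the distance to countably many
  conditions.\<close>

lemma infdist_attractor_fibre_le_iff:
  "infdist p attractor_fibre \<le> c \<longleftrightarrow> (\<forall>n. infdist p (stage n) \<le> c)"
proof (intro iffI allI)
  fix n
  assume "infdist p attractor_fibre \<le> c"
  moreover have "attractor_fibre \<subseteq> stage n" by (auto simp: attractor_fibre_def stage_def entire_def)
  ultimately show "infdist p (stage n) \<le> c"
    using infdist_mono[OF _ attractor_fibre_nonempty, of "stage n" p] by linarith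
next
  assume *: "\<forall>n. infdist p (stage n) \<le> c"
  obtain x where x: "cyl_proj x = p" by (rule cyl_proj_surj)
  have ne: "stage n \<noteq> {}" for n
    using attractor_fibre_nonempty by (auto simp: attractor_fibre_def stage_def entire_def)
  have "\<exists>u. solves u \<and> u (- real n) \<in> absorbing (- real n) \<and> norm (x - u 0) < c + inverse (real (Suc n))" for n
  proof -
    have "infdist p (stage n) < c + inverse (real (Suc n))"
      using *[rule_format, of n] inverse_positive_iff_positive[of "real (Suc n)"] by linarith
    then have "\<exists>q\<in>stage n. dist p q < c + inverse (real (Suc n))"
      unfolding infdist_notempty[OF ne] by (subst (asm) cINF_less_iff) (auto simp: ne)
    then obtain u where u: "solves u" "u (- real n) \<in> absorbing (- real n)"
      "dist (cyl_proj x) (cyl_proj (u 0)) < c + inverse (real (Suc n))"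
      using x by (auto simp: stage_def)
    obtain y where y: "cyl_proj y = cyl_proj (u 0)" "norm (x - y) < c + inverse (real (Suc n))"
      using dist_cyl_lift[OF u(3)] by blast
    then obtain m :: int where "y - u 0 = period m" by (auto simp: cyl_proj_eq_iff)
    then have "u 0 + period m = y" by (simp add: algebra_simps)
    then show ?thesis using solves_shift[OF u(1), of m] u(2) y(2)
      by (intro exI[of _ "\<lambda>t. u t + period m"]) (simp add: absorbing_shift)
  qed
  then obtain u where u: "\<And>n. solves (u n)" "\<And>n. u n (- real n) \<in> absorbing (- real n)"
    "\<And>n. norm (x - u n 0) < c + inverse (real (Suc n))" by metis
  have "norm (u n 0) \<le> norm x + (c + 1)" for n
  proof -
    have "inverse (real (Suc n)) \<le> 1" by (simp add: field_simps)
    then show ?thesis using u(3)[of n] norm_triangle_ineq3[of x "u n 0"] by linarith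
  qed
  then obtain r v where r: "strict_mono r" "solves v" "\<And>t. (\<lambda>n. u (r n) t) \<longlonglongrightarrow> v t"
    using solution_subseq_limit[of u, OF u(1)] by metis
  have "v t \<in> absorbing t" for t
  proof (rule absorbing_closed_limit[OF _ r(3)])
    fix n assume "nat \<lceil>- t\<rceil> \<le> n"
    then have "- t \<le> real (r n)" using seq_suble[OF r(1), of n] by linarith
    then show "u (r n) t \<in> absorbing t" using absorbing_forward[OF u(1,2)[of "r n"]] by simp
  qed
  then have v: "v \<in> entire" using r(2) by (simp add: entire_def)
  have "norm (x - v 0) \<le> c"
  proof (rule LIMSEQ_le)
    show "(\<lambda>n. norm (x - u (r n) 0)) \<longlonglongrightarrow> norm (x - v 0)" by (intro tendsto_intros r(3))
    have "(\<lambda>n. c + inverse (real (Suc (r n)))) \<longlonglongrightarrow> c + 0"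
      using LIMSEQ_subseq_LIMSEQ[OF LIMSEQ_inverse_real_of_nat r(1)] by (intro tendsto_intros) (simp add: o_def)
    then show "(\<lambda>n. c + inverse (real (Suc (r n)))) \<longlonglongrightarrow> c" by simp
    show "\<exists>N. \<forall>n\<ge>N. norm (x - u (r n) 0) \<le> c + inverse (real (Suc (r n)))"
      using u(3) by (auto intro!: less_imp_le simp del: of_nat_Suc)
  qed
  moreover have "infdist p attractor_fibre \<le> dist p (cyl_proj (v 0))"
    using v by (intro infdist_le) (auto simp: attractor_fibre_def)
  ultimately show "infdist p attractor_fibre \<le> c" using dist_cyl_proj_le[of x "v 0"] x by simp
qed

text \<open>To be applied by contradiction to solutions kept away from the attractor, so a single
  index suffices. By \<open>approach_absorbing\<close> the excess over the absorbing radius at a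
  fixed time is a multiple of \<open>\<rho> n * exp (- k / 2 * \<tau> n)\<close> and vanishes in the
  limit, which is therefore entire.\<close>

lemma attraction:
  assumes u: "\<And>n::nat. solves (u n)" and gaps: "\<And>n i. \<bar>u n (- \<tau> n) $ i - u n (- \<tau> n) $ pred_coord i\<bar> \<le> \<rho> n"
    and \<tau>: "filterlim \<tau> at_top sequentially" "\<And>n. 0 \<le> \<tau> n" and \<rho>: "\<And>n. 0 \<le> \<rho> n"
      "(\<lambda>n. \<rho> n * exp (- k / 2 * \<tau> n)) \<longlonglongrightarrow> 0" and e: "0 < e"
  shows "\<exists>n. infdist (cyl_proj (u n 0)) attractor_fibre < e"
proof -
  have "\<exists>m::int. 0 \<le> (u n 0 + period m) $ coord1
    \<and> (u n 0 + period m) $ coord1 \<le> 2 * pi" for n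
    using shift_into_period[of "u n 0"] by blast
  then obtain m :: "nat \<Rightarrow> int" where m: "\<And>n. 0 \<le> (u n 0 + period (m n)) $ coord1"
    "\<And>n. (u n 0 + period (m n)) $ coord1 \<le> 2 * pi" by metis
  \<comment> \<open>Translation by periods confines the first coordinate at time 0, which the gaps
    leave unbounded.\<close>
  define w where "w = (\<lambda>n t. u n t + period (m n))"
  have w: "solves (w n)" for n unfolding w_def by (rule solves_shift[OF u])
  have gap: "\<bar>w n t $ i - w n t $ pred_coord i\<bar> \<le> width i * (R t + \<rho> n * exp (- k / 2 * \<tau> n) * exp (- k / 2 * t))"
    if "- \<tau> n \<le> t" for n t i
  proof -
    have "\<bar>w n t $ i - w n t $ pred_coord i\<bar> \<le> width i * (R t + \<rho> n * exp (- k / 2 * (t - (- \<tau> n))))"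
      by (rule approach_absorbing[OF w _ that \<rho>(1)]) (use gaps in \<open>simp add: w_def diag_vec_def\<close>)
    also have "exp (- k / 2 * (t - (- \<tau> n))) = exp (- k / 2 * \<tau> n) * exp (- k / 2 * t)"
      by (simp add: algebra_simps add_divide_distrib flip: exp_add)
    finally show ?thesis by (simp only: mult.assoc)
  qed
  obtain B where B: "\<And>n. \<bar>\<rho> n * exp (- k / 2 * \<tau> n)\<bar> \<le> B"
    using convergent_imp_Bseq[OF convergentI[OF \<rho>(2)]] unfolding Bseq_def by auto
  have "norm (w n 0) \<le> real CARD('n) * (2 * pi + real CARD('n) * (max_width * (R 0 + B)))" for n
  proof -
    have "norm (w n 0) \<le> real CARD('n) * (\<bar>w n 0 $ coord1\<bar> + real CARD('n) * (max_width * (R 0 + B)))"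
    proof (rule norm_le_of_gaps)
      fix i
      have "\<bar>w n 0 $ i - w n 0 $ pred_coord i\<bar> \<le> width i * (R 0 + \<rho> n * exp (- k / 2 * \<tau> n) * exp (- k / 2 * 0))"
        by (rule gap) (use \<tau>(2) in simp)
      also have "\<dots> \<le> max_width * (R 0 + B)"
        using B[of n] \<rho>(1)[of n] R_pos[of 0] width_le[of i] width_ge_1[of i] by (intro mult_mono) auto
      finally show "\<bar>w n 0 $ i - w n 0 $ pred_coord i\<bar> \<le> max_width * (R 0 + B)" .
    qed
    also have "\<dots> \<le> real CARD('n) * (2 * pi + real CARD('n) * (max_width * (R 0 + B)))"
      using m[of n] by (intro mult_left_mono) (auto simp: w_def)
    finally show ?thesis .
  qed
  then obtain r v where r: "strict_mono r" "solves v" "\<And>t. (\<lambda>n. w (r n) t) \<longlonglongrightarrow> v t"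
    using solution_subseq_limit[of w, OF w] by metis
  have "v t \<in> absorbing t" for t
    unfolding absorbing_def
  proof safe
    fix i
    show "\<bar>v t $ i - v t $ pred_coord i\<bar> \<le> width i * R t"
    proof (rule tendsto_le)
      show "(\<lambda>n. \<bar>w (r n) t $ i - w (r n) t $ pred_coord i\<bar>) \<longlonglongrightarrow> \<bar>v t $ i - v t $ pred_coord i\<bar>"
        by (intro tendsto_intros r(3))
      have "(\<lambda>n. width i * (R t + \<rho> (r n) * exp (- k / 2 * \<tau> (r n)) * exp (- k / 2 * t))) \<longlonglongrightarrow> width i * (R t + 0 * exp (- k / 2 * t))"
        using LIMSEQ_subseq_LIMSEQ[OF \<rho>(2) r(1)] by (intro tendsto_intros) (simp add: o_def)
      then show "(\<lambda>n. width i * (R t + \<rho> (r n) * exp (- k / 2 * \<tau> (r n)) * exp (- k / 2 * t))) \<longlonglongrightarrow> width i * R t" by simp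
      have "filterlim (\<lambda>n. \<tau> (r n)) at_top sequentially"
        by (rule filterlim_compose[OF \<tau>(1) filterlim_subseq[OF r(1)]])
      then have "\<forall>\<^sub>F n in sequentially. - t \<le> \<tau> (r n)" by (simp add: filterlim_at_top)
      then show "\<forall>\<^sub>F n in sequentially. \<bar>w (r n) t $ i - w (r n) t $ pred_coord i\<bar>
          \<le> width i * (R t + \<rho> (r n) * exp (- k / 2 * \<tau> (r n)) * exp (- k / 2 * t))"
        by eventually_elim (rule gap, simp)
    qed simp
  qed
  then have v: "v \<in> entire" using r(2) by (simp add: entire_def)
  have "(\<lambda>n. w (r n) 0 - v 0) \<longlonglongrightarrow> 0" using r(3)[of 0] by (simp add: LIM_zero_iff)
  then have "\<forall>\<^sub>F n in sequentially. norm (w (r n) 0 - v 0) < e"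
    using e by (simp add: tendsto_iff dist_norm)
  then obtain n where n: "norm (w (r n) 0 - v 0) < e" unfolding eventually_sequentially by blast
  have "infdist (cyl_proj (w (r n) 0)) attractor_fibre \<le> dist (cyl_proj (w (r n) 0)) (cyl_proj (v 0))"
    using v by (intro infdist_le) (auto simp: attractor_fibre_def)
  also have "\<dots> \<le> norm (w (r n) 0 - v 0)" by (rule dist_cyl_proj_le)
  also have "\<dots> < e" by (rule n)
  finally have "infdist (cyl_proj (w (r n) 0)) attractor_fibre < e" .
  then show ?thesis by (intro exI[of _ "r n"]) (simp add: w_def)
qed

end

section \<open>Recognising a topological circle\<close>

lemma homeomorphic_imp_homeomorphic_space:
  assumes "S homeomorphic T"
  shows "top_of_set S homeomorphic_space top_of_set T"
proof -
  obtain f g where "homeomorphism S T f g" using assms by (auto simp: homeomorphic_def)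
  then have "homeomorphic_maps (top_of_set S) (top_of_set T) f g"
    by (auto simp: homeomorphic_maps_def homeomorphism_def)
  then show ?thesis by (rule homeomorphic_maps_imp_homeomorphic_space)
qed

lemma second_countable_euclidean: "second_countable (euclidean :: 'a::second_countable_topology topology)"
proof -
  obtain B :: "'a set set" where B: "countable B" "topological_basis B" using ex_countable_basis by blast
  show ?thesis unfolding second_countable_def
  proof (intro exI[of _ B] conjI ballI allI impI)
    show "openin euclidean V" if "V \<in> B" for V using topological_basis_open[OF B(2) that] by simp
    fix U :: "'a set" and x assume "openin euclidean U \<and> x \<in> U"
    then have "open U" "x \<in> U" by auto
    then show "\<exists>V\<in>B. x \<in> V \<and> V \<subseteq> U" by (rule topological_basisE[OF B(2)]) blast
  qed (rule B(1))
qed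

lemma one_dim_manifold_of_circle:
  fixes A :: "'a::metric_space set"
  assumes A: "compact A" and f: "continuous_on A f" "inj_on f A" "f ` A = sphere (0::complex) 1"
  shows "one_dim_manifold (top_of_set A)"
proof -
  obtain g where g: "homeomorphism A (sphere (0::complex) 1) f g"
    using homeomorphism_compact[OF A f(1) f(3) f(2)] by blast
  have hs: "top_of_set A homeomorphic_space top_of_set (sphere (0::complex) 1)"
    using g by (intro homeomorphic_imp_homeomorphic_space) (auto simp: homeomorphic_def)
  have sc: "second_countable (top_of_set (sphere (0::complex) 1))"
    by (intro second_countable_subtopology) (simp add: second_countable_euclidean)
  show ?thesis unfolding one_dim_manifold_def
  proof (intro conjI ballI)
    show "Hausdorff_space (top_of_set A)" by (simp add: Hausdorff_space_subtopology)
    show "second_countable (top_of_set A)" using homeomorphic_space_second_countability[OF hs] sc by simp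
    fix x assume "x \<in> topspace (top_of_set A)"
    then have x: "x \<in> A" by simp
    define b where "b = - f x"
    have "norm (f x) = 1" using f(3) x by (metis imageI mem_sphere_0)
    then have b: "norm b = 1" "f x \<noteq> b" by (auto simp: b_def)
    let ?U = "A \<inter> f -` (- {b})"
    have "openin (top_of_set A) ?U"
      by (rule continuous_openin_preimage_gen[OF f(1)]) (simp add: open_Compl)
    moreover have "x \<in> ?U" using x b by simp
    moreover have "top_of_set ?U homeomorphic_space top_of_set (UNIV :: real set)"
    proof -
      have "homeomorphism ?U (f ` ?U) f g" by (rule homeomorphism_of_subsets[OF g]) auto
      moreover have "f ` ?U = sphere (0::complex) 1 - {b}" using f(3) by auto
      ultimately have "?U homeomorphic (sphere (0::complex) 1 - {b})" unfolding homeomorphic_def by auto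
      also have "\<dots> homeomorphic (UNIV :: real set)"
        using b by (intro homeomorphic_punctured_sphere_affine) auto
      finally show ?thesis by (rule homeomorphic_imp_homeomorphic_space)
    qed
    moreover have "subtopology (top_of_set A) ?U = top_of_set ?U"
      by (simp add: subtopology_subtopology Int_absorb1)
    ultimately show "\<exists>U V. openin (top_of_set A) U \<and> x \<in> U \<and> open (V :: real set) \<and>
        subtopology (top_of_set A) U homeomorphic_space top_of_set V"
      by (intro exI[of _ ?U] exI[of _ "UNIV :: real set"]) simp
  qed
qed

section \<open>The random attractor\<close>

lemma path_shift_add: "path_shift s (path_shift t \<omega>) = path_shift (s + t) \<omega>"
  by (simp add: path_shift_def fun_eq_iff algebra_simps)

lemma topspace_compact_open_subset: "topspace compact_open_topology \<subseteq> path_space"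
  unfolding compact_open_topology_def by auto

lemma sets_path_borel: "sets path_borel = sigma_sets path_space {U. openin compact_open_topology U}"
proof -
  have "{U. openin compact_open_topology U} \<subseteq> Pow path_space"
    using topspace_compact_open_subset openin_subset by blast
  then show ?thesis unfolding path_borel_def by (rule sets_measure_of)
qed

lemma evaluation_measurable:
  fixes P :: "'n::finite sample measure"
  assumes "wiener_measure P"
  shows "(\<lambda>\<omega>. \<omega> t) \<in> borel_measurable P"
proof (rule borel_measurableI)
  have P: "space P = path_space" "sets P = sigma_sets path_space {U. openin compact_open_topology U}"
    using assms by (auto simp: wiener_measure_def sets_path_borel)
  fix S :: "'n rvec set" assume "open S"
  \<comment> \<open>With the compact set \<open>{t}\<close>, preimages of open sets under evaluation
    at \<open>t\<close> are subbasic.\<close>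
  then have "openin compact_open_topology {\<omega> \<in> path_space. \<omega> ` {t} \<subseteq> S}"
    unfolding compact_open_topology_def
    by (intro topology_generated_by_Basis CollectI exI[of _ "{t}"] exI[of _ S]) simp
  moreover have "(\<lambda>\<omega>. \<omega> t) -` S \<inter> space P = {\<omega> \<in> path_space. \<omega> ` {t} \<subseteq> S}" by (auto simp: P)
  ultimately show "(\<lambda>\<omega>. \<omega> t) -` S \<inter> space P \<in> sets P" by (simp add: P sigma_sets.Basic)
qed

text \<open>The gauge integral over an unbounded set is by definition a limit over growing boxes,
  whether or not it converges absolutely.\<close>

lemma integral_atMost_0_limit:
  fixes f :: "real \<Rightarrow> real"
  assumes "f integrable_on {..0}"
  shows "(\<lambda>n. integral {- real n..0} f) \<longlonglongrightarrow> integral {..0} f"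
proof (rule LIMSEQ_I)
  fix e :: real assume "0 < e"
  with assms obtain B where B: "0 < B" "\<And>a b. ball 0 B \<subseteq> cbox a b \<Longrightarrow>
      norm (integral (cbox a b) (\<lambda>x. if x \<in> {..0} then f x else 0) - integral {..0} f) < e"
    using integrable_integral[OF assms] unfolding has_integral_alt'[of f] by metis
  show "\<exists>n0. \<forall>n\<ge>n0. norm (integral {- real n..0} f - integral {..0} f) < e"
  proof (intro exI allI impI)
    fix n assume n: "nat \<lceil>B\<rceil> \<le> n"
    then have "B \<le> real n" by linarith
    then have "ball 0 B \<subseteq> cbox (- real n) (real n)" by (auto simp: dist_real_def)
    then have "norm (integral (cbox (- real n) (real n)) (\<lambda>x. if x \<in> {..0} then f x else 0) - integral {..0} f) < e"
      by (rule B(2))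
    moreover have "integral (cbox (- real n) (real n)) (\<lambda>x. if x \<in> {..0} then f x else 0) = integral ({..0} \<inter> cbox (- real n) (real n)) f"
      by (rule integral_restrict_Int)
    moreover have "{..0} \<inter> cbox (- real n) (real n) = {- real n..0}" by auto
    ultimately show "norm (integral {- real n..0} f - integral {..0} f) < e" by simp
  qed
qed

lemma subexponential_of_sublinear:
  fixes f :: "real \<Rightarrow> real"
  assumes cont: "continuous_on UNIV f"
    and top: "((\<lambda>t. \<bar>f t\<bar> / t) \<longlongrightarrow> 0) at_top" and bot: "((\<lambda>t. \<bar>f t\<bar> / t) \<longlongrightarrow> 0) at_bot" and \<delta>: "0 < \<delta>"
  shows "\<exists>M. \<forall>t. \<bar>f t\<bar> \<le> M * exp (\<delta> * \<bar>t\<bar>)"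
proof -
  obtain a where a: "\<And>t. a \<le> t \<Longrightarrow> \<bar>f t\<bar> / t < 1"
    using order_tendstoD(2)[OF top, of 1] by (auto simp: eventually_at_top_linorder)
  \<comment> \<open>For negative \<open>t\<close> the quotient is nonpositive, so
    \<open>\<bar>f t\<bar> \<le> \<bar>t\<bar>\<close> comes from the lower bound -1.\<close>
  obtain b where b: "\<And>t. t \<le> b \<Longrightarrow> - 1 < \<bar>f t\<bar> / t"
    using order_tendstoD(1)[OF bot, of "- 1"] by (auto simp: eventually_at_bot_linorder)
  define T where "T = \<bar>a\<bar> + \<bar>b\<bar> + 1"
  have lin: "\<bar>f t\<bar> \<le> \<bar>t\<bar>" if "T \<le> \<bar>t\<bar>" for t
  proof (cases "0 \<le> t")
    case True
    then have "a \<le> t" "0 < t" using that by (auto simp: T_def)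
    then show ?thesis using a[of t] by (simp add: pos_divide_less_eq)
  next
    case False
    then have "t \<le> b" "t < 0" using that by (auto simp: T_def)
    then show ?thesis using b[of t] by (simp add: neg_less_divide_eq)
  qed
  have "bounded (f ` {-T..T})"
    by (intro compact_imp_bounded compact_continuous_image continuous_on_subset[OF cont]) auto
  then obtain B where B: "0 < B" "\<And>t. t \<in> {-T..T} \<Longrightarrow> \<bar>f t\<bar> \<le> B"
    unfolding bounded_pos by auto
  have "\<bar>f t\<bar> \<le> (B + 1 / \<delta>) * exp (\<delta> * \<bar>t\<bar>)" for t
  proof (cases "T \<le> \<bar>t\<bar>")
    case True
    have "\<delta> * \<bar>t\<bar> \<le> exp (\<delta> * \<bar>t\<bar>)" using exp_ge_add_one_self[of "\<delta> * \<bar>t\<bar>"] by linarith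
    then have "\<bar>t\<bar> \<le> 1 / \<delta> * exp (\<delta> * \<bar>t\<bar>)" using \<delta> by (simp add: field_simps)
    moreover have "0 \<le> B * exp (\<delta> * \<bar>t\<bar>)" using B(1) by simp
    ultimately show ?thesis using lin[OF True] by (simp add: distrib_right)
  next
    case False
    have "B * 1 \<le> B * exp (\<delta> * \<bar>t\<bar>)" using B(1) \<delta> by (intro mult_left_mono) auto
    moreover have "0 \<le> 1 / \<delta> * exp (\<delta> * \<bar>t\<bar>)" using \<delta> by simp
    moreover have "\<bar>f t\<bar> \<le> B" using False by (intro B(2)) auto
    ultimately show ?thesis unfolding distrib_right by linarith
  qed
  then show ?thesis by blast
qed

text \<open>An attractor is itself a tempered random set, so the other one attracts it; by
  invariance its pullback images are constantly \<open>A \<omega>\<close>, which must then have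
  semidistance 0 from the closed set \<open>B \<omega>\<close>.\<close>

lemma global_random_attractor_subset:
  assumes A: "global_random_attractor Q \<theta> \<Phi> A" and B: "global_random_attractor Q \<theta> \<Phi> B"
    and \<theta>: "\<And>t \<omega>. \<omega> \<in> space Q \<Longrightarrow> \<theta> t \<omega> \<in> space Q" "\<And>t \<omega>. \<omega> \<in> space Q \<Longrightarrow> \<theta> t (\<theta> (- t) \<omega>) = \<omega>"
    and \<omega>: "\<omega> \<in> space Q"
  shows "A \<omega> \<subseteq> B \<omega>"
proof
  fix x assume x: "x \<in> A \<omega>"
  have "((\<lambda>t. semidist ((\<lambda>p. \<Phi> t p (\<theta> (- t) \<omega>)) ` A (\<theta> (- t) \<omega>)) (B \<omega>)) \<longlongrightarrow> 0) at_top"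
    using A B \<omega> unfolding global_random_attractor_def random_compact_set_def by blast
  moreover have "(\<lambda>p. \<Phi> t p (\<theta> (- t) \<omega>)) ` A (\<theta> (- t) \<omega>) = A \<omega>" for t
  proof -
    have "(\<lambda>p. \<Phi> t p (\<theta> (- t) \<omega>)) ` A (\<theta> (- t) \<omega>) = A (\<theta> t (\<theta> (- t) \<omega>))"
      using A \<theta>(1)[OF \<omega>] unfolding global_random_attractor_def by blast
    then show ?thesis by (simp add: \<theta>(2)[OF \<omega>])
  qed
  ultimately have "((\<lambda>t::real. semidist (A \<omega>) (B \<omega>)) \<longlongrightarrow> 0) at_top" by simp
  then have "semidist (A \<omega>) (B \<omega>) = 0" by (simp add: tendsto_const_iff)
  then have "ennreal (infdist x (B \<omega>)) \<le> 0"
    using x by (metis SUP_upper semidist_def)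
  then have "infdist x (B \<omega>) = 0" using infdist_nonneg[of x "B \<omega>"] by simp
  moreover have "compact (B \<omega>)" "B \<omega> \<noteq> {}"
    using B \<omega> by (auto simp: global_random_attractor_def random_compact_set_def random_set_def)
  ultimately show "x \<in> B \<omega>" using in_closed_iff_infdist_zero compact_imp_closed by blast
qed

section \<open>The noise path and the random radius\<close>

definition ou_path :: "'n rvec \<Rightarrow> 'n sample \<Rightarrow> real \<Rightarrow> 'n::{finite,linorder} rvec" where
  "ou_path \<epsilon> \<omega> t = (\<chi> i. ou \<epsilon> i (path_shift t \<omega>))"

text \<open>The smallest radius compatible with \<open>R_ge\<close> and \<open>R_growth\<close>: the
  term \<open>s = 0\<close> gives the former, the weight \<open>exp (k / 2 * s)\<close> on the past
  gives the latter.\<close>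

definition radius :: "real \<Rightarrow> 'n::{finite,linorder} rvec \<Rightarrow> 'n rvec \<Rightarrow> 'n sample \<Rightarrow> real" where
  "radius k \<alpha> \<epsilon> \<omega> = (SUP s\<in>{..0}. exp (k / 2 * s) * (2 * norm \<alpha> + 2 + (4 * k + 2) * norm (ou_path \<epsilon> \<omega> s)))"

definition radius_path :: "real \<Rightarrow> 'n::{finite,linorder} rvec \<Rightarrow> 'n rvec \<Rightarrow> 'n sample \<Rightarrow> real \<Rightarrow> real" where
  "radius_path k \<alpha> \<epsilon> \<omega> t = radius k \<alpha> \<epsilon> (path_shift t \<omega>)"

lemma ou_path_shift: "ou_path \<epsilon> (path_shift s \<omega>) t = ou_path \<epsilon> \<omega> (t + s)"
  by (simp add: ou_path_def path_shift_add)

lemma radius_path_shift: "radius_path k \<alpha> \<epsilon> (path_shift s \<omega>) t = radius_path k \<alpha> \<epsilon> \<omega> (t + s)"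
  by (simp add: radius_path_def path_shift_add)

locale driven_system =
  fixes k :: real and \<alpha> \<epsilon> :: "'n::{finite,linorder} rvec" and P :: "'n sample measure" and \<Omega> :: "'n sample set"
  assumes k_pos: "0 < k" and wiener: "wiener_measure P" and noise: "admissible_noise_set P \<epsilon> \<Omega>"
begin

abbreviation M :: "'n sample measure" where "M \<equiv> restrict_space P \<Omega>"

abbreviation \<zeta> :: "'n sample \<Rightarrow> real \<Rightarrow> 'n rvec" where "\<zeta> \<equiv> ou_path \<epsilon>"

abbreviation R :: "'n sample \<Rightarrow> real \<Rightarrow> real" where "R \<equiv> radius_path k \<alpha> \<epsilon>"

abbreviation pullback :: "nat \<Rightarrow> 'n sample \<Rightarrow> 'n cylinder set" where
  "pullback n \<omega> \<equiv> coupled_rde.stage k \<alpha> (\<zeta> \<omega>) (R \<omega>) n"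

lemma space_M [simp]: "space M = \<Omega>"
  using noise sets.sets_into_space[of \<Omega> P] by (auto simp: admissible_noise_set_def space_restrict_space)

lemma shift_in [intro]: "\<omega> \<in> \<Omega> \<Longrightarrow> path_shift t \<omega> \<in> \<Omega>"
  using noise by (auto simp: admissible_noise_set_def)

lemma path_at_0: "\<omega> \<in> \<Omega> \<Longrightarrow> \<omega> 0 = 0"
  and path_continuous: "\<omega> \<in> \<Omega> \<Longrightarrow> continuous_on UNIV \<omega>"
proof -
  assume "\<omega> \<in> \<Omega>"
  then have "\<omega> \<in> path_space"
    using noise wiener sets.sets_into_space[of \<Omega> P] by (auto simp: admissible_noise_set_def wiener_measure_def)
  then show "\<omega> 0 = 0" "continuous_on UNIV \<omega>" by (auto simp: path_space_def)
qed

lemma path_shift_0: "\<omega> \<in> \<Omega> \<Longrightarrow> path_shift 0 \<omega> = \<omega>"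
  by (simp add: path_shift_def path_at_0)

lemma ou_path_continuous: "\<omega> \<in> \<Omega> \<Longrightarrow> continuous_on UNIV (\<zeta> \<omega>)"
  using noise unfolding ou_path_def admissible_noise_set_def by (auto intro!: continuous_on_vec_lambda)

definition bound :: "'n sample \<Rightarrow> real \<Rightarrow> real" where
  "bound \<omega> t = 2 * norm \<alpha> + 2 + (4 * k + 2) * norm (\<zeta> \<omega> t)"

lemma bound_growth:
  assumes \<omega>: "\<omega> \<in> \<Omega>" and \<delta>: "0 < \<delta>"
  obtains C where "0 \<le> C" "\<And>t. bound \<omega> t \<le> C * exp (\<delta> * \<bar>t\<bar>)"
proof -
  have "\<exists>C. \<forall>t. \<bar>ou \<epsilon> i (path_shift t \<omega>)\<bar> \<le> C * exp (\<delta> * \<bar>t\<bar>)" for i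
    using noise \<omega> by (intro subexponential_of_sublinear[OF _ _ _ \<delta>]) (auto simp: admissible_noise_set_def)
  then obtain C where C: "\<And>i t. \<bar>ou \<epsilon> i (path_shift t \<omega>)\<bar> \<le> C i * exp (\<delta> * \<bar>t\<bar>)" by metis
  have C0: "0 \<le> C i" for i using order_trans[OF abs_ge_zero C[of i 0]] by simp
  show thesis
  proof
    show "0 \<le> 2 * norm \<alpha> + 2 + (4 * k + 2) * (\<Sum>i\<in>UNIV. C i)" using k_pos C0 by (intro add_nonneg_nonneg mult_nonneg_nonneg sum_nonneg) auto
    fix t
    have "norm (\<zeta> \<omega> t) \<le> (\<Sum>i\<in>UNIV. \<bar>\<zeta> \<omega> t $ i\<bar>)" by (rule norm_le_l1_cart)
    also have "\<dots> \<le> (\<Sum>i\<in>UNIV. C i * exp (\<delta> * \<bar>t\<bar>))" using C by (intro sum_mono) (simp add: ou_path_def)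
    also have "\<dots> = (\<Sum>i\<in>UNIV. C i) * exp (\<delta> * \<bar>t\<bar>)" by (simp add: sum_distrib_right)
    finally have "(4 * k + 2) * norm (\<zeta> \<omega> t) \<le> (4 * k + 2) * ((\<Sum>i\<in>UNIV. C i) * exp (\<delta> * \<bar>t\<bar>))"
      using k_pos by (intro mult_left_mono) auto
    moreover have "(2 * norm \<alpha> + 2) * 1 \<le> (2 * norm \<alpha> + 2) * exp (\<delta> * \<bar>t\<bar>)" using \<delta> by (intro mult_left_mono) auto
    ultimately show "bound \<omega> t \<le> (2 * norm \<alpha> + 2 + (4 * k + 2) * (\<Sum>i\<in>UNIV. C i)) * exp (\<delta> * \<bar>t\<bar>)"
      unfolding bound_def by (simp add: algebra_simps)
  qed
qed

lemma radius_path_eq: "R \<omega> t = (SUP s\<in>{..0}. exp (k / 2 * s) * bound \<omega> (s + t))"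
  by (simp add: radius_path_def radius_def bound_def ou_path_shift)

text \<open>Growth of the noise at rate \<open>\<delta>\<close> into the past is absorbed by the
  weight as long as \<open>\<delta> \<le> k / 2\<close>, leaving only growth in \<open>t\<close>.
  This yields both finiteness of the supremum and temperedness of the radius.\<close>

lemma weighted_bound_le:
  assumes \<omega>: "\<omega> \<in> \<Omega>" and \<delta>: "0 < \<delta>" "\<delta> \<le> k / 2"
  obtains C where "0 \<le> C" "\<And>s t. s \<le> 0 \<Longrightarrow> exp (k / 2 * s) * bound \<omega> (s + t) \<le> C * exp (\<delta> * \<bar>t\<bar>)"
proof -
  obtain C where C: "0 \<le> C" "\<And>t. bound \<omega> t \<le> C * exp (\<delta> * \<bar>t\<bar>)" using bound_growth[OF \<omega> \<delta>(1)] by blast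
  have "exp (k / 2 * s) * bound \<omega> (s + t) \<le> C * exp (\<delta> * \<bar>t\<bar>)" if s: "s \<le> 0" for s t
  proof -
    have "exp (k / 2 * s) * bound \<omega> (s + t) \<le> exp (k / 2 * s) * (C * exp (\<delta> * \<bar>s + t\<bar>))"
      by (intro mult_left_mono C) auto
    also have "\<dots> = C * exp (k / 2 * s + \<delta> * \<bar>s + t\<bar>)" by (simp add: exp_add)
    also have "\<dots> \<le> C * exp (\<delta> * \<bar>t\<bar>)"
    proof -
      have "\<delta> * \<bar>s + t\<bar> \<le> \<delta> * (\<bar>s\<bar> + \<bar>t\<bar>)" using \<delta>(1) by (intro mult_left_mono) auto
      moreover have "(k / 2) * s \<le> \<delta> * s" using \<delta>(2) s by (intro mult_right_mono_neg) auto
      ultimately have "k / 2 * s + \<delta> * \<bar>s + t\<bar> \<le> \<delta> * \<bar>t\<bar>" using s by (simp add: algebra_simps)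
      then show ?thesis using C(1) by (intro mult_left_mono) auto
    qed
    finally show ?thesis .
  qed
  then show thesis using that C(1) by blast
qed

lemma weighted_bound_bdd:
  assumes "\<omega> \<in> \<Omega>"
  shows "bdd_above ((\<lambda>s. exp (k / 2 * s) * bound \<omega> (s + t)) ` {..0})"
proof -
  obtain C where "\<And>s t. s \<le> 0 \<Longrightarrow> exp (k / 2 * s) * bound \<omega> (s + t) \<le> C * exp (k / 2 * \<bar>t\<bar>)"
    using weighted_bound_le[OF assms half_gt_zero[OF k_pos] order_refl] by blast
  then show ?thesis by (intro bdd_aboveI[of _ "C * exp (k / 2 * \<bar>t\<bar>)"]) auto
qed

lemma radius_path_tempered:
  assumes \<omega>: "\<omega> \<in> \<Omega>" and \<delta>: "0 < \<delta>"
  shows "\<exists>C. \<forall>t. R \<omega> t \<le> C * exp (\<delta> * \<bar>t\<bar>)"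
proof -
  \<comment> \<open>The weight tolerates rates up to \<open>k / 2\<close> only; for larger
    \<open>\<delta>\<close> the bound at rate \<open>k / 2\<close> is stronger than
    required.\<close>
  have "0 < min \<delta> (k / 2)" using k_pos \<delta> by simp
  then obtain C where C: "0 \<le> C" "\<And>s t. s \<le> 0 \<Longrightarrow> exp (k / 2 * s) * bound \<omega> (s + t) \<le> C * exp (min \<delta> (k / 2) * \<bar>t\<bar>)"
    using weighted_bound_le[OF \<omega> _ min.cobounded2] by blast
  have "R \<omega> t \<le> C * exp (\<delta> * \<bar>t\<bar>)" for t
    unfolding radius_path_eq
  proof (rule cSUP_least)
    fix s :: real assume "s \<in> {..0}"
    then have "exp (k / 2 * s) * bound \<omega> (s + t) \<le> C * exp (min \<delta> (k / 2) * \<bar>t\<bar>)" by (intro C) simp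
    also have "\<dots> \<le> C * exp (\<delta> * \<bar>t\<bar>)"
      using C(1) by (intro mult_left_mono) (auto intro!: mult_right_mono)
    finally show "exp (k / 2 * s) * bound \<omega> (s + t) \<le> C * exp (\<delta> * \<bar>t\<bar>)" .
  qed auto
  then show ?thesis by blast
qed

lemma coupled_rde_path:
  assumes \<omega>: "\<omega> \<in> \<Omega>"
  shows "coupled_rde k \<alpha> (\<zeta> \<omega>) (R \<omega>)"
proof
  show "0 < k" by (rule k_pos)
  show "continuous_on UNIV (\<zeta> \<omega>)" by (rule ou_path_continuous[OF \<omega>])
  show "2 * norm \<alpha> + 2 + (4 * k + 2) * norm (\<zeta> \<omega> t) \<le> R \<omega> t" for t
    unfolding radius_path_eq
    by (rule cSUP_upper2[OF weighted_bound_bdd[OF \<omega>], of 0]) (auto simp: bound_def)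
  show "R \<omega> s \<le> exp (k / 2 * (t - s)) * R \<omega> t" if st: "s \<le> t" for s t
    unfolding radius_path_eq[of _ s]
  proof (rule cSUP_least)
    fix r :: real assume r: "r \<in> {..0}"
    \<comment> \<open>The past of \<open>s\<close> is part of the past of \<open>t\<close>: the
      index \<open>r\<close> relative to \<open>s\<close> is \<open>r + s - t\<close> relative to
      \<open>t\<close>.\<close>
    have "exp (k / 2 * (r + s - t)) * bound \<omega> ((r + s - t) + t) \<le> R \<omega> t"
      unfolding radius_path_eq using r st by (intro cSUP_upper weighted_bound_bdd[OF \<omega>]) auto
    then have "exp (k / 2 * (t - s)) * (exp (k / 2 * (r + s - t)) * bound \<omega> ((r + s - t) + t))
       \<le> exp (k / 2 * (t - s)) * R \<omega> t"
      by (intro mult_left_mono) auto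
    moreover have "exp (k / 2 * (t - s)) * exp (k / 2 * (r + s - t)) = exp (k / 2 * r)"
      by (simp add: algebra_simps diff_divide_distrib add_divide_distrib flip: exp_add)
    then have "exp (k / 2 * (t - s)) * (exp (k / 2 * (r + s - t)) * bound \<omega> ((r + s - t) + t)) = exp (k / 2 * r) * bound \<omega> (r + s)"
      by (simp only: mult.assoc[symmetric]) simp
    ultimately show "exp (k / 2 * r) * bound \<omega> (r + s) \<le> exp (k / 2 * (t - s)) * R \<omega> t" by (simp only:)
  qed auto
  show "\<exists>C. \<forall>t. R \<omega> t \<le> C * exp (\<delta> * \<bar>t\<bar>)" if "0 < \<delta>" for \<delta>
    by (rule radius_path_tempered[OF \<omega> that])
qed

section \<open>The flow on the cylinder\<close>

lemma flow_eqI: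
  assumes \<omega>: "\<omega> \<in> \<Omega>" and u: "coupled_rde.solves k \<alpha> (\<zeta> \<omega>) u"
  shows "flow k \<alpha> \<epsilon> t (u 0) \<omega> = u t"
proof -
  interpret coupled_rde k \<alpha> "\<zeta> \<omega>" "R \<omega>" by (rule coupled_rde_path[OF \<omega>])
  have eq: "(\<forall>s. (w has_vector_derivative rde_field k \<alpha> \<epsilon> (path_shift s \<omega>) (w s)) (at s)) \<longleftrightarrow> solves w" for w
    by (simp add: solves_def rde_field_eq_drift ou_path_def)
  have "(THE w. w 0 = u 0 \<and> solves w) = u"
    by (rule the_equality) (use u solution_unique in auto)
  then show ?thesis unfolding flow_def eq by simp
qed

lemma solves_shifted:
  assumes \<omega>: "\<omega> \<in> \<Omega>" and u: "coupled_rde.solves k \<alpha> (\<zeta> \<omega>) u"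
  shows "coupled_rde.solves k \<alpha> (\<zeta> (path_shift s \<omega>)) (\<lambda>t. u (t + s))"
proof -
  interpret coupled_rde k \<alpha> "\<zeta> \<omega>" "R \<omega>" by (rule coupled_rde_path[OF \<omega>])
  interpret S: coupled_rde k \<alpha> "\<zeta> (path_shift s \<omega>)" "R (path_shift s \<omega>)"
    by (rule coupled_rde_path[OF shift_in[OF \<omega>]])
  show ?thesis unfolding S.solves_def ou_path_shift
  proof
    fix t
    have "((\<lambda>t. t + s) has_vector_derivative 1) (at t)" by (auto intro!: derivative_eq_intros)
    from vector_diff_chain_at[OF this, of u] solvesD[OF u, of "t + s"]
    show "((\<lambda>t. u (t + s)) has_vector_derivative drift k \<alpha> (\<zeta> \<omega> (t + s)) (u (t + s))) (at t)" by (simp add: o_def)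
  qed
qed

lemma flow_eqI':
  assumes \<omega>: "\<omega> \<in> \<Omega>" and u: "coupled_rde.solves k \<alpha> (\<zeta> \<omega>) u"
  shows "flow k \<alpha> \<epsilon> t (u s) (path_shift s \<omega>) = u (t + s)"
  using flow_eqI[OF shift_in[OF \<omega>] solves_shifted[OF \<omega> u]] by simp

lemma entire_shifted:
  assumes \<omega>: "\<omega> \<in> \<Omega>" and u: "u \<in> coupled_rde.entire k \<alpha> (\<zeta> \<omega>) (R \<omega>)"
  shows "(\<lambda>t. u (t + s)) \<in> coupled_rde.entire k \<alpha> (\<zeta> (path_shift s \<omega>)) (R (path_shift s \<omega>))"
proof -
  interpret coupled_rde k \<alpha> "\<zeta> \<omega>" "R \<omega>" by (rule coupled_rde_path[OF \<omega>])
  interpret S: coupled_rde k \<alpha> "\<zeta> (path_shift s \<omega>)" "R (path_shift s \<omega>)"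
    by (rule coupled_rde_path[OF shift_in[OF \<omega>]])
  show ?thesis using solves_shifted[OF \<omega>, of u s] u
    by (simp add: S.entire_def entire_def S.absorbing_def absorbing_def radius_path_shift)
qed

lemma cyl_flow_proj:
  assumes \<omega>: "\<omega> \<in> \<Omega>"
  shows "cyl_flow k \<alpha> \<epsilon> t (cyl_proj x) \<omega> = cyl_proj (flow k \<alpha> \<epsilon> t x \<omega>)"
  unfolding cyl_flow_def
proof (rule the_equality)
  interpret coupled_rde k \<alpha> "\<zeta> \<omega>" "R \<omega>" by (rule coupled_rde_path[OF \<omega>])
  show "\<forall>y. cyl_proj y = cyl_proj x \<longrightarrow> cyl_proj (flow k \<alpha> \<epsilon> t x \<omega>) = cyl_proj (flow k \<alpha> \<epsilon> t y \<omega>)"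
  proof (intro allI impI)
    fix y assume "cyl_proj y = cyl_proj x"
    then obtain m :: int where "y - x = period m" by (auto simp: cyl_proj_eq_iff)
    then have m: "y = x + period m" by (simp add: algebra_simps)
    obtain u where u: "solves u" "u 0 = x" using solution_exists by blast
    show "cyl_proj (flow k \<alpha> \<epsilon> t x \<omega>) = cyl_proj (flow k \<alpha> \<epsilon> t y \<omega>)"
      using flow_eqI[OF \<omega> u(1), of t] flow_eqI[OF \<omega> solves_shift[OF u(1), of m], of t] by (simp add: u(2) m)
  qed
qed auto

lemma cyl_flow_solution:
  assumes \<omega>: "\<omega> \<in> \<Omega>" and u: "coupled_rde.solves k \<alpha> (\<zeta> \<omega>) u"
  shows "cyl_flow k \<alpha> \<epsilon> t (cyl_proj (u s)) (path_shift s \<omega>) = cyl_proj (u (t + s))"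
  using cyl_flow_proj[OF shift_in[OF \<omega>]] flow_eqI'[OF \<omega> u] by simp

section \<open>Invariance and measurability of the attractor\<close>

definition attractor :: "'n sample \<Rightarrow> 'n cylinder set" where
  "attractor \<omega> = coupled_rde.attractor_fibre k \<alpha> (\<zeta> \<omega>) (R \<omega>)"

lemma attractor_invariant_subset:
  assumes \<omega>: "\<omega> \<in> \<Omega>"
  shows "(\<lambda>p. cyl_flow k \<alpha> \<epsilon> t p \<omega>) ` attractor \<omega> \<subseteq> attractor (path_shift t \<omega>)"
proof
  interpret coupled_rde k \<alpha> "\<zeta> \<omega>" "R \<omega>" by (rule coupled_rde_path[OF \<omega>])
  interpret S: coupled_rde k \<alpha> "\<zeta> (path_shift t \<omega>)" "R (path_shift t \<omega>)"
    by (rule coupled_rde_path[OF shift_in[OF \<omega>]])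
  fix q assume "q \<in> (\<lambda>p. cyl_flow k \<alpha> \<epsilon> t p \<omega>) ` attractor \<omega>"
  then obtain u where u: "u \<in> entire" "q = cyl_flow k \<alpha> \<epsilon> t (cyl_proj (u 0)) \<omega>"
    by (auto simp: attractor_def attractor_fibre_def)
  then have "q = cyl_proj (u (0 + t))"
    using cyl_flow_solution[OF \<omega>, of u t 0] path_shift_0[OF \<omega>] by (simp add: entire_def)
  then show "q \<in> attractor (path_shift t \<omega>)"
    using entire_shifted[OF \<omega> u(1), of t] unfolding attractor_def S.attractor_fibre_def by (intro image_eqI)
qed

text \<open>The reverse inclusion is the proved one for time \<open>- t\<close> and the shifted
  noise, transported back by the flow.\<close>

lemma attractor_invariant:
  assumes \<omega>: "\<omega> \<in> \<Omega>"
  shows "(\<lambda>p. cyl_flow k \<alpha> \<epsilon> t p \<omega>) ` attractor \<omega> = attractor (path_shift t \<omega>)"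
proof (rule equalityI[OF attractor_invariant_subset[OF \<omega>]])
  let ?\<omega> = "path_shift t \<omega>"
  have \<omega>': "?\<omega> \<in> \<Omega>" using \<omega> by blast
  have unshift: "path_shift (- t) ?\<omega> = \<omega>" using path_shift_0[OF \<omega>] by (simp add: path_shift_add)
  interpret S: coupled_rde k \<alpha> "\<zeta> ?\<omega>" "R ?\<omega>" by (rule coupled_rde_path[OF \<omega>'])
  show "attractor ?\<omega> \<subseteq> (\<lambda>p. cyl_flow k \<alpha> \<epsilon> t p \<omega>) ` attractor \<omega>"
  proof
    fix q assume "q \<in> attractor ?\<omega>"
    then obtain u where u: "u \<in> S.entire" "q = cyl_proj (u 0)" by (auto simp: attractor_def S.attractor_fibre_def)
    have "cyl_flow k \<alpha> \<epsilon> (- t) q ?\<omega> = cyl_proj (u (- t))"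
      using cyl_flow_solution[OF \<omega>', of u "- t" 0] path_shift_0[OF \<omega>'] u by (simp add: S.entire_def)
    moreover have "cyl_flow k \<alpha> \<epsilon> (- t) q ?\<omega> \<in> attractor \<omega>"
      using attractor_invariant_subset[OF \<omega>', of "- t"] \<open>q \<in> attractor ?\<omega>\<close> unshift by auto
    moreover have "cyl_flow k \<alpha> \<epsilon> t (cyl_proj (u (- t))) \<omega> = q"
      using cyl_flow_solution[OF \<omega>', of u t "- t"] unshift u by (simp add: S.entire_def)
    ultimately show "q \<in> (\<lambda>p. cyl_flow k \<alpha> \<epsilon> t p \<omega>) ` attractor \<omega>" by (metis imageI)
  qed
qed

lemma ou_measurable: "(\<lambda>\<omega>. ou \<epsilon> i (path_shift t \<omega>)) \<in> borel_measurable M"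
proof -
  have ev: "(\<lambda>\<omega>. \<omega> s) \<in> borel_measurable M" for s
    by (rule measurable_restrict_space1[OF evaluation_measurable[OF wiener]])
  let ?f = "\<lambda>\<omega> s. exp s * path_shift t \<omega> s $ i"
  have "(\<lambda>\<omega>. integral {..0} (?f \<omega>)) \<in> borel_measurable M"
  proof (rule borel_measurable_LIMSEQ_metric)
    show "(\<lambda>\<omega>. integral {- real n..0} (?f \<omega>)) \<in> borel_measurable M" for n
    proof (rule measurable_integral_of_continuous_paths)
      have "(\<lambda>\<omega>. (\<omega> (s + t) - \<omega> t) $ i) \<in> borel_measurable M" for s
        by (rule measurable_compose[OF borel_measurable_diff[OF ev ev]])
          (intro borel_measurable_continuous_onI continuous_intros)
      then show "(\<lambda>\<omega>. ?f \<omega> s) \<in> borel_measurable M" for s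
        unfolding path_shift_def by (intro borel_measurable_times borel_measurable_const) auto
      fix \<omega> assume "\<omega> \<in> space M"
      then have "continuous_on UNIV (path_shift t \<omega>)" by (intro path_continuous) auto
      then show "continuous_on UNIV (?f \<omega>)" by (intro continuous_intros)
    qed
    fix \<omega> assume "\<omega> \<in> space M"
    then have "path_shift t \<omega> \<in> \<Omega>" by auto
    then have "?f \<omega> integrable_on {..0}" using noise by (auto simp: admissible_noise_set_def)
    then show "(\<lambda>n. integral {- real n..0} (?f \<omega>)) \<longlonglongrightarrow> integral {..0} (?f \<omega>)"
      by (rule integral_atMost_0_limit)
  qed
  then show ?thesis unfolding ou_def by (intro borel_measurable_times borel_measurable_const)
qed

lemma ou_path_measurable: "(\<lambda>\<omega>. \<zeta> \<omega> t) \<in> borel_measurable M"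
proof -
  have "\<zeta> \<omega> t = (\<Sum>i\<in>UNIV. ou \<epsilon> i (path_shift t \<omega>) *\<^sub>R axis i 1)" for \<omega>
    by (simp add: vec_eq_iff ou_path_def axis_def if_distrib cong: if_cong)
  then show ?thesis using ou_measurable by (auto intro!: borel_measurable_sum borel_measurable_scaleR)
qed

text \<open>Continuity of the noise path reduces the supremum to rational times.\<close>

lemma radius_path_measurable: "(\<lambda>\<omega>. R \<omega> t) \<in> borel_measurable M"
  unfolding borel_measurable_iff_le
proof
  fix c
  have "{\<omega> \<in> space M. R \<omega> t \<le> c} = (\<Inter>q\<in>\<rat>\<inter>{..0}. {\<omega> \<in> space M. exp (k / 2 * q) * bound \<omega> (q + t) \<le> c})"
    (is "?L = ?R")
  proof (intro equalityI subsetI)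
    fix \<omega> assume \<omega>: "\<omega> \<in> ?L"
    have "exp (k / 2 * q) * bound \<omega> (q + t) \<le> R \<omega> t" if "q \<le> 0" for q
      unfolding radius_path_eq using that \<omega> weighted_bound_bdd[of \<omega> t] by (intro cSUP_upper) auto
    then show "\<omega> \<in> ?R" using \<omega> by force
  next
    fix \<omega> assume R: "\<omega> \<in> ?R"
    have "0 \<in> \<rat> \<inter> {..0::real}" by simp
    then have \<omega>: "\<omega> \<in> \<Omega>" using R by force
    have cont: "continuous_on UNIV (\<lambda>s. exp (k / 2 * s) * bound \<omega> (s + t))"
      unfolding bound_def by (intro continuous_intros continuous_on_compose2[OF ou_path_continuous[OF \<omega>]]) auto
    have "exp (k / 2 * s) * bound \<omega> (s + t) \<le> c" if s: "s \<le> 0" for s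
    proof (rule ccontr)
      assume "\<not> ?thesis"
      then have "\<forall>\<^sub>F x in at s. c < exp (k / 2 * x) * bound \<omega> (x + t)"
        using cont by (intro order_tendstoD(1)[of _ "exp (k / 2 * s) * bound \<omega> (s + t)"]) (auto simp: continuous_on_def)
      then obtain d where d: "0 < d" "\<And>x. x \<noteq> s \<Longrightarrow> dist x s < d \<Longrightarrow> c < exp (k / 2 * x) * bound \<omega> (x + t)"
        by (auto simp: eventually_at)
      \<comment> \<open>\<open>q\<close> is taken to the left of \<open>s\<close> so that it remains
        in \<open>{..0}\<close>.\<close>
      obtain q where q: "q \<in> \<rat>" "s - d < q" "q < s" using Rats_dense_in_real[of "s - d" s] d by auto
      then have "exp (k / 2 * q) * bound \<omega> (q + t) \<le> c" using R s by auto
      then show False using d(2)[of q] q by (auto simp: dist_real_def)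
    qed
    then have "R \<omega> t \<le> c" unfolding radius_path_eq by (intro cSUP_least) auto
    then show "\<omega> \<in> ?L" using \<omega> by simp
  qed
  moreover have "?R \<in> sets M"
  proof (rule sets.countable_INT')
    show "countable (\<rat> \<inter> {..0::real})" using countable_rat by blast
    show "\<rat> \<inter> {..0::real} \<noteq> {}" by (auto intro: exI[of _ 0])
    have "(\<lambda>\<omega>. exp (k / 2 * q) * bound \<omega> (q + t)) \<in> borel_measurable M" for q
      unfolding bound_def
      by (intro borel_measurable_times borel_measurable_add borel_measurable_const measurable_compose[OF ou_path_measurable borel_measurable_norm])
    then show "(\<lambda>q. {\<omega> \<in> space M. exp (k / 2 * q) * bound \<omega> (q + t) \<le> c}) ` (\<rat> \<inter> {..0}) \<subseteq> sets M"
      unfolding borel_measurable_iff_le by blast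
  qed
  ultimately show "{\<omega> \<in> space M. R \<omega> t \<le> c} \<in> sets M" by simp
qed

lemma radius_measurable: "radius k \<alpha> \<epsilon> \<in> borel_measurable M"
proof -
  have "radius k \<alpha> \<epsilon> \<omega> = R \<omega> 0" if "\<omega> \<in> \<Omega>" for \<omega>
    using path_shift_0[OF that] by (simp add: radius_path_def)
  then have "radius k \<alpha> \<epsilon> \<in> borel_measurable M \<longleftrightarrow> (\<lambda>\<omega>. R \<omega> 0) \<in> borel_measurable M"
    by (intro measurable_cong) simp
  then show ?thesis using radius_path_measurable by simp
qed

text \<open>Each Picard iterate arises from its predecessor by a continuous field and a time
  integral, so it is measurable, and the solution is the pointwise limit. The initial value may
  depend on the noise, as the scaling by the random radius in \<open>stage_eq\<close>
  requires.\<close>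

lemma flow_measurable:
  assumes x: "x \<in> borel_measurable M"
  shows "(\<lambda>\<omega>. flow k \<alpha> \<epsilon> t (x \<omega>) (path_shift s \<omega>)) \<in> borel_measurable M"
proof (rule borel_measurable_LIMSEQ_metric)
  let ?F = "\<lambda>\<omega> \<tau> y. drift k \<alpha> (\<zeta> \<omega> (\<tau> + s)) y"
  have F: "continuous_on UNIV (\<lambda>(\<tau>, y). ?F \<omega> \<tau> y)" if "\<omega> \<in> \<Omega>" for \<omega>
    unfolding split_beta
    by (intro continuous_drift continuous_on_compose2[OF ou_path_continuous[OF that]] continuous_intros) auto
  have cd: "continuous_on UNIV (\<lambda>p. drift k \<alpha> (fst p) (snd p))"
    by (intro continuous_drift continuous_intros)
  have "(\<lambda>\<omega>. picard (?F \<omega>) (x \<omega>) n \<tau>) \<in> borel_measurable M" for n \<tau>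
  proof (induction n arbitrary: \<tau>)
    case (Suc n)
    have "(\<lambda>\<omega>. prim (\<lambda>\<tau>. ?F \<omega> \<tau> (picard (?F \<omega>) (x \<omega>) n \<tau>)) \<tau>) \<in> borel_measurable M"
    proof (rule measurable_prim_of_continuous_paths)
      show "(\<lambda>\<omega>. ?F \<omega> \<tau> (picard (?F \<omega>) (x \<omega>) n \<tau>)) \<in> borel_measurable M" for \<tau>
        by (rule borel_measurable_continuous_Pair[OF ou_path_measurable Suc.IH cd])
      fix \<omega> assume "\<omega> \<in> space M"
      then have "\<omega> \<in> \<Omega>" by simp
      from continuous_on_field_compose[OF F[OF this] continuous_picard[OF F[OF this]]]
      show "continuous_on UNIV (\<lambda>\<tau>. ?F \<omega> \<tau> (picard (?F \<omega>) (x \<omega>) n \<tau>))" .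
    qed
    then show ?case using x by simp
  qed (use x in simp)
  then show "(\<lambda>\<omega>. picard (?F \<omega>) (x \<omega>) n t) \<in> borel_measurable M" for n .
  fix \<omega> assume "\<omega> \<in> space M"
  then have \<omega>: "\<omega> \<in> \<Omega>" by simp
  interpret S: coupled_rde k \<alpha> "\<zeta> (path_shift s \<omega>)" "R (path_shift s \<omega>)"
    by (rule coupled_rde_path[OF shift_in[OF \<omega>]])
  obtain u where u: "u 0 = x \<omega>" "\<And>\<tau>. (u has_vector_derivative ?F \<omega> \<tau> (u \<tau>)) (at \<tau>)"
    "\<And>\<tau>. (\<lambda>n. picard (?F \<omega>) (x \<omega>) n \<tau>) \<longlonglongrightarrow> u \<tau>"
    using picard_lindeloef[OF F[OF \<omega>] drift_lipschitz[where k = k and \<alpha> = \<alpha>, folded S.lip_def] S.lip_pos] by blast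
  have "S.solves u" using u(2) by (simp add: S.solves_def ou_path_shift)
  from flow_eqI[OF shift_in[OF \<omega>] this, of t] u
  show "(\<lambda>n. picard (?F \<omega>) (x \<omega>) n t) \<longlonglongrightarrow> flow k \<alpha> \<epsilon> t (x \<omega>) (path_shift s \<omega>)" by simp
qed

definition unit_absorbing :: "'n rvec set" where
  "unit_absorbing = {w. \<forall>i. \<bar>w $ i - w $ pred_coord i\<bar> \<le> (1 + 2 / k) * 3 ^ coord_no i}"

text \<open>
  The absorbing set is the deterministic set \<open>unit_absorbing\<close> scaled by the random radius, so a
  countable dense subset of the former yields countably many measurable selections of each stage.
\<close>

lemma stage_eq:
  fixes n :: nat and \<omega> :: "'n sample"
  assumes \<omega>: "\<omega> \<in> \<Omega>"
  defines "\<omega>' \<equiv> path_shift (- real n) \<omega>"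
  shows "pullback n \<omega>
    = (\<lambda>w. cyl_proj (flow k \<alpha> \<epsilon> (real n) (radius k \<alpha> \<epsilon> \<omega>' *\<^sub>R w) \<omega>')) ` unit_absorbing" (is "?L = ?R")
proof -
  interpret coupled_rde k \<alpha> "\<zeta> \<omega>" "R \<omega>" by (rule coupled_rde_path[OF \<omega>])
  let ?r = "radius k \<alpha> \<epsilon> \<omega>'"
  have r: "R \<omega> (- real n) = ?r" by (simp add: radius_path_def \<omega>'_def)
  have r0: "0 < ?r" using R_pos[of "- real n"] r by simp
  have flow: "flow k \<alpha> \<epsilon> (real n) (u (- real n)) \<omega>' = u 0" if "solves u" for u
    using flow_eqI'[OF \<omega> that, of "real n" "- real n"] by (simp add: \<omega>'_def)
  have ab: "?r *\<^sub>R w \<in> absorbing (- real n) \<longleftrightarrow> w \<in> unit_absorbing" for w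
  proof -
    have "\<bar>(?r *\<^sub>R w) $ i - (?r *\<^sub>R w) $ pred_coord i\<bar> = \<bar>w $ i - w $ pred_coord i\<bar> * ?r" for i
      using r0 by (simp add: abs_mult flip: right_diff_distrib)
    then show ?thesis using r0 by (simp add: absorbing_def unit_absorbing_def width_def r)
  qed
  show ?thesis
  proof (intro equalityI subsetI)
    fix p assume "p \<in> ?L"
    then obtain u where u: "solves u" "u (- real n) \<in> absorbing (- real n)" "p = cyl_proj (u 0)"
      by (auto simp: stage_def)
    let ?w = "u (- real n) /\<^sub>R ?r"
    have w: "?r *\<^sub>R ?w = u (- real n)" using r0 by simp
    then have "?w \<in> unit_absorbing" using ab[of ?w] u(2) by simp
    moreover have "p = cyl_proj (flow k \<alpha> \<epsilon> (real n) (?r *\<^sub>R ?w) \<omega>')" unfolding w flow[OF u(1)] by (rule u(3))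
    ultimately show "p \<in> ?R" by blast
  next
    fix p assume "p \<in> ?R"
    then obtain w where w: "w \<in> unit_absorbing" "p = cyl_proj (flow k \<alpha> \<epsilon> (real n) (?r *\<^sub>R w) \<omega>')" by blast
    obtain u where u: "solves u" "u (- real n) = ?r *\<^sub>R w" using solution_exists by blast
    then show "p \<in> ?L" using w flow[OF u(1)] ab[of w] by (auto simp: stage_def)
  qed
qed

lemma unit_absorbing_nonempty: "unit_absorbing \<noteq> {}"
proof -
  have "0 \<in> unit_absorbing" using k_pos by (simp add: unit_absorbing_def)
  then show ?thesis by blast
qed

lemma flow_continuous:
  assumes \<omega>: "\<omega> \<in> \<Omega>"
  shows "continuous_on UNIV (\<lambda>x. flow k \<alpha> \<epsilon> t x \<omega>)"
proof -
  interpret coupled_rde k \<alpha> "\<zeta> \<omega>" "R \<omega>" by (rule coupled_rde_path[OF \<omega>])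
  have "(exp (lip * \<bar>t\<bar>))-lipschitz_on UNIV (\<lambda>x. flow k \<alpha> \<epsilon> t x \<omega>)"
  proof (rule lipschitz_onI)
    fix x y
    obtain u v where uv: "solves u" "u 0 = x" "solves v" "v 0 = y" using solution_exists by metis
    then show "dist (flow k \<alpha> \<epsilon> t x \<omega>) (flow k \<alpha> \<epsilon> t y \<omega>) \<le> exp (lip * \<bar>t\<bar>) * dist x y"
      using flow_eqI[OF \<omega>, of u t] flow_eqI[OF \<omega>, of v t] solutions_close[OF uv(1,3), of t 0]
      by (simp add: dist_norm)
  qed simp
  then show ?thesis by (rule lipschitz_on_continuous_on)
qed

lemma infdist_stage_measurable:
  "(\<lambda>\<omega>. infdist p (pullback n \<omega>)) \<in> borel_measurable M"
proof -
  obtain T where T: "countable T" "T \<subseteq> unit_absorbing" "unit_absorbing \<subseteq> closure T"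
    by (rule separable)
  define f where "f = (\<lambda>w \<omega>. dist p (cyl_proj (flow k \<alpha> \<epsilon> (real n)
     (radius k \<alpha> \<epsilon> (path_shift (- real n) \<omega>) *\<^sub>R w) (path_shift (- real n) \<omega>))))"
  have rm: "(\<lambda>\<omega>. radius k \<alpha> \<epsilon> (path_shift (- real n) \<omega>)) \<in> borel_measurable M"
    using radius_path_measurable[of "- real n"] by (simp add: radius_path_def)
  have fm: "f w \<in> borel_measurable M" for w
  proof -
    have "(\<lambda>\<omega>. flow k \<alpha> \<epsilon> (real n) (radius k \<alpha> \<epsilon> (path_shift (- real n) \<omega>) *\<^sub>R w) (path_shift (- real n) \<omega>)) \<in> borel_measurable M"
      by (intro flow_measurable borel_measurable_scaleR rm borel_measurable_const)
    moreover have "(\<lambda>x. dist p (cyl_proj x)) \<in> borel_measurable borel"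
      by (intro borel_measurable_continuous_onI continuous_intros continuous_cyl_proj)
    ultimately show ?thesis unfolding f_def by (rule measurable_compose)
  qed
  show ?thesis unfolding borel_measurable_iff_less
  proof
    fix c
    have "infdist p (pullback n \<omega>) < c \<longleftrightarrow> (\<exists>w\<in>T. f w \<omega> < c)"
      if \<omega>: "\<omega> \<in> \<Omega>" for \<omega>
    proof -
      have "infdist p (pullback n \<omega>) < c
         \<longleftrightarrow> (\<exists>w\<in>unit_absorbing. f w \<omega> < c)"
      proof -
        have "infdist p (pullback n \<omega>) = (INF w\<in>unit_absorbing. f w \<omega>)"
          unfolding stage_eq[OF \<omega>] using unit_absorbing_nonempty by (simp add: infdist_notempty image_image f_def)
        moreover have "bdd_below ((\<lambda>w. f w \<omega>) ` unit_absorbing)"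
          by (rule bdd_belowI[of _ 0]) (auto simp: f_def)
        ultimately show ?thesis by (simp only: cINF_less_iff[OF unit_absorbing_nonempty])
      qed
      \<comment> \<open>A strict inequality defines an open set of \<open>w\<close>, which meets
        \<open>T\<close> as soon as it meets the closure of \<open>T\<close>.\<close>
      also have "\<dots> \<longleftrightarrow> (\<exists>w\<in>T. f w \<omega> < c)"
      proof
        assume "\<exists>w\<in>unit_absorbing. f w \<omega> < c"
        then obtain w where w: "w \<in> closure T" "f w \<omega> < c" using T(3) by blast
        have "continuous_on UNIV (\<lambda>w. f w \<omega>)" unfolding f_def
          by (intro continuous_intros continuous_on_compose2[OF continuous_cyl_proj[of UNIV]]
            continuous_on_compose2[OF flow_continuous[OF shift_in[OF \<omega>]]]) auto
        then have "open {w. f w \<omega> < c}" by (intro open_Collect_less continuous_on_const)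
        then have "{w. f w \<omega> < c} \<inter> T \<noteq> {}" using w open_Int_closure_eq_empty by blast
        then show "\<exists>w\<in>T. f w \<omega> < c" by blast
      qed (use T(2) in blast)
      finally show ?thesis .
    qed
    then have "{\<omega> \<in> space M. infdist p (pullback n \<omega>) < c}
       = (\<Union>w\<in>T. {\<omega> \<in> space M. f w \<omega> < c})" by auto
    also have "\<dots> \<in> sets M"
      using fm T(1) unfolding borel_measurable_iff_less by (intro sets.countable_UN') auto
    finally show "{\<omega> \<in> space M. infdist p (pullback n \<omega>) < c} \<in> sets M" .
  qed
qed

lemma attractor_random_compact_set: "random_compact_set M attractor"
  unfolding random_compact_set_def random_set_def
proof (intro conjI ballI allI)
  fix \<omega> assume "\<omega> \<in> space M"
  then have \<omega>: "\<omega> \<in> \<Omega>" by simp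
  show "attractor \<omega> \<noteq> {}" "compact (attractor \<omega>)"
    unfolding attractor_def
    by (rule coupled_rde.attractor_fibre_nonempty[OF coupled_rde_path[OF \<omega>]],
        rule coupled_rde.compact_attractor_fibre[OF coupled_rde_path[OF \<omega>]])
next
  fix p
  show "(\<lambda>\<omega>. infdist p (attractor \<omega>)) \<in> borel_measurable M"
    unfolding borel_measurable_iff_le
  proof
    fix c
    have "{\<omega> \<in> space M. infdist p (attractor \<omega>) \<le> c}
      = (\<Inter>n. {\<omega> \<in> space M. infdist p (pullback n \<omega>) \<le> c})"
      using coupled_rde.infdist_attractor_fibre_le_iff[OF coupled_rde_path] by (auto simp: attractor_def)
    also have "\<dots> \<in> sets M"
      using infdist_stage_measurable unfolding borel_measurable_iff_le by (intro sets.countable_INT) auto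
    finally show "{\<omega> \<in> space M. infdist p (attractor \<omega>) \<le> c} \<in> sets M" .
  qed
qed

section \<open>Temperedness and attraction\<close>

lemma attractor_tempered: "tempered M path_shift attractor"
  unfolding tempered_def
proof (intro exI conjI ballI allI impI)
  let ?N = "real CARD('n)" and ?w = "(1 + 2 / k) * 3 ^ CARD('n)"
  let ?r = "\<lambda>\<omega>. ?N * (2 * pi + ?N * (?w * radius k \<alpha> \<epsilon> \<omega>))"
  show "?r \<in> borel_measurable M"
    by (intro borel_measurable_times borel_measurable_add borel_measurable_const radius_measurable)
  fix \<omega> assume "\<omega> \<in> space M"
  then have \<omega>: "\<omega> \<in> \<Omega>" by simp
  interpret coupled_rde k \<alpha> "\<zeta> \<omega>" "R \<omega>" by (rule coupled_rde_path[OF \<omega>])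
  have r: "radius k \<alpha> \<epsilon> (path_shift t \<omega>) = R \<omega> t" for t by (simp add: radius_path_def)
  have r0: "radius k \<alpha> \<epsilon> \<omega> = R \<omega> 0" using r[of 0] path_shift_0[OF \<omega>] by simp
  show "0 \<le> ?r \<omega>" using R_pos[of 0] k_pos unfolding r0 by (intro mult_nonneg_nonneg add_nonneg_nonneg) auto
  show "attractor \<omega> \<subseteq> cball (cyl_proj 0) (?r \<omega>)"
  proof
    fix p assume "p \<in> attractor \<omega>"
    then obtain u where u: "u \<in> entire" "cyl_proj (u 0) = p" "0 \<le> u 0 $ coord1" "u 0 $ coord1 \<le> 2 * pi"
      unfolding attractor_def by (rule attractor_fibre_lift)
    have "dist (cyl_proj 0) (cyl_proj (u 0)) \<le> norm (0 - u 0)" by (rule dist_cyl_proj_le)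
    also have "\<dots> \<le> ?r \<omega>" using attractor_fibre_lift_norm[OF u(1,3,4)] by (simp add: r0 max_width_def)
    finally show "p \<in> cball (cyl_proj 0) (?r \<omega>)" using u(2) by simp
  qed
  fix \<delta> :: real assume \<delta>: "0 < \<delta>"
  obtain C where C: "\<And>t. R \<omega> t \<le> C * exp (\<delta> * \<bar>t\<bar>)" using R_tempered[OF \<delta>] by blast
  show "bdd_above (range (\<lambda>t. exp (- \<delta> * \<bar>t\<bar>) * ?r (path_shift t \<omega>)))"
  proof (rule bdd_aboveI)
    fix x assume "x \<in> range (\<lambda>t. exp (- \<delta> * \<bar>t\<bar>) * ?r (path_shift t \<omega>))"
    then obtain t where x: "x = exp (- \<delta> * \<bar>t\<bar>) * ?r (path_shift t \<omega>)" by blast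
    have e: "exp (- \<delta> * \<bar>t\<bar>) \<le> 1" using \<delta> by simp
    have "exp (- \<delta> * \<bar>t\<bar>) * R \<omega> t \<le> exp (- \<delta> * \<bar>t\<bar>) * (C * exp (\<delta> * \<bar>t\<bar>))"
      by (intro mult_left_mono C) auto
    also have "\<dots> = C" by (simp add: mult.left_commute flip: exp_add)
    finally have c: "?N * (?N * (?w * (exp (- \<delta> * \<bar>t\<bar>) * R \<omega> t))) \<le> ?N * (?N * (?w * C))"
      using k_pos by (intro mult_left_mono) auto
    have "?N * (2 * pi) * exp (- \<delta> * \<bar>t\<bar>) \<le> ?N * (2 * pi) * 1" by (intro mult_left_mono e) auto
    moreover have expand: "e * (n * (a + n * (w * y))) = n * a * e + n * (n * (w * (e * y)))" for e n a w y :: real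
      by (simp add: algebra_simps)
    ultimately show "x \<le> ?N * (2 * pi) + ?N * (?N * (?w * C))"
      using c unfolding x r expand by linarith
  qed
qed

lemma attractor_attracts:
  assumes D: "tempered M path_shift D" and \<omega>: "\<omega> \<in> \<Omega>"
  shows "((\<lambda>t. semidist ((\<lambda>p. cyl_flow k \<alpha> \<epsilon> t p (path_shift (- t) \<omega>)) ` D (path_shift (- t) \<omega>)) (attractor \<omega>)) \<longlongrightarrow> 0) at_top"
    (is "(?s \<longlongrightarrow> 0) at_top")
proof (rule order_tendstoI)
  interpret coupled_rde k \<alpha> "\<zeta> \<omega>" "R \<omega>" by (rule coupled_rde_path[OF \<omega>])
  fix a :: ennreal assume a: "0 < a"
  from D[unfolded tempered_def space_M] obtain q r where
    qr: "\<forall>\<omega>\<in>\<Omega>. 0 \<le> r \<omega> \<and> D \<omega> \<subseteq> cball q (r \<omega>) \<and>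
           (\<forall>\<delta>>0. bdd_above (range (\<lambda>t::real. exp (- \<delta> * \<bar>t\<bar>) * r (path_shift t \<omega>))))"
    by (elim exE conjE) (rule that)
  have r_nonneg: "0 \<le> r \<omega>" if "\<omega> \<in> \<Omega>" for \<omega>
    using bspec[OF qr that] by (rule conjunct1)
  have D_ball: "D \<omega> \<subseteq> cball q (r \<omega>)" if "\<omega> \<in> \<Omega>" for \<omega>
    using bspec[OF qr that] by (elim conjE)
  have r_bdd: "bdd_above (range (\<lambda>t::real. exp (- \<delta> * \<bar>t\<bar>) * r (path_shift t \<omega>)))" if "\<omega> \<in> \<Omega>" "0 < \<delta>" for \<omega> \<delta>
    using bspec[OF qr that(1)] that(2) by (elim conjE) (elim allE impE)
  \<comment> \<open>Temperedness at rate \<open>k / 4\<close> costs half of the decay rate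
    \<open>k / 2\<close>; the other half drives \<open>\<rho> n * exp (- k / 2 * \<tau> n)\<close>
    to 0.\<close>
  have k4: "0 < k / 4" using k_pos by simp
  obtain C where C: "\<And>t. exp (- (k / 4) * \<bar>t\<bar>) * r (path_shift t \<omega>) \<le> C"
    using r_bdd[OF \<omega> k4] unfolding bdd_above_def by auto
  obtain x where x: "cyl_proj x = q" by (rule cyl_proj_surj)
  show "\<forall>\<^sub>F t in at_top. ?s t < a"
  proof (rule ccontr)
    assume "\<not> ?thesis"
    then have "\<exists>t\<ge>real n. a \<le> ?s t" for n unfolding eventually_at_top_linorder by (auto simp: not_less)
    then obtain \<tau> where \<tau>: "\<And>n. real n \<le> \<tau> n" "\<And>n. a \<le> ?s (\<tau> n)" by metis
    \<comment> \<open>\<open>a\<close> may be infinite; a finite positive level below it turns the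
      lower bound into one for real distances.\<close>
    obtain b where b: "0 < b" "b < a" using dense[OF a] by blast
    then obtain e where e: "b = ennreal e" "0 \<le> e" by (cases b) auto
    have e: "ennreal e < a" "0 < e" using b e by (auto simp: ennreal_less_zero_iff)
    have "\<exists>u. solves u \<and> norm (x - u (- \<tau> n)) < r (path_shift (- \<tau> n) \<omega>) + 1 \<and> e \<le> infdist (cyl_proj (u 0)) attractor_fibre" for n
    proof -
      let ?\<omega> = "path_shift (- \<tau> n) \<omega>"
      have \<omega>': "?\<omega> \<in> \<Omega>" using \<omega> by blast
      have "ennreal e < ?s (\<tau> n)" using e(1) \<tau>(2)[of n] by (rule less_le_trans)
      then obtain d where d: "d \<in> D ?\<omega>" "ennreal e < ennreal (infdist (cyl_flow k \<alpha> \<epsilon> (\<tau> n) d ?\<omega>) attractor_fibre)"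
        unfolding semidist_def less_SUP_iff attractor_def by auto
      \<comment> \<open>The added 1 makes the bound strict, as \<open>dist_cyl_lift\<close>
        requires.\<close>
      have "dist (cyl_proj x) d < r ?\<omega> + 1" using subsetD[OF D_ball[OF \<omega>'] d(1)] x by simp
      then obtain y where y: "cyl_proj y = d" "norm (x - y) < r ?\<omega> + 1" by (rule dist_cyl_lift)
      obtain u where u: "solves u" "u (- \<tau> n) = y" using solution_exists by blast
      have "cyl_flow k \<alpha> \<epsilon> (\<tau> n) d ?\<omega> = cyl_proj (u 0)"
        using cyl_flow_solution[OF \<omega> u(1), of "\<tau> n" "- \<tau> n"] u(2) y(1) by simp
      then have "e \<le> infdist (cyl_proj (u 0)) attractor_fibre"
        using d(2) e(2) by (simp add: ennreal_less_iff)
      then show ?thesis using u y(2) by auto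
    qed
    then obtain u where u: "\<And>n. solves (u n)" "\<And>n. norm (x - u n (- \<tau> n)) < r (path_shift (- \<tau> n) \<omega>) + 1"
      "\<And>n. e \<le> infdist (cyl_proj (u n 0)) attractor_fibre" by metis
    define \<rho> where "\<rho> = (\<lambda>n. 2 * (norm x + 1 + r (path_shift (- \<tau> n) \<omega>)))"
    have "\<exists>n. infdist (cyl_proj (u n 0)) attractor_fibre < e"
    proof (rule attraction[where \<tau> = \<tau> and \<rho> = \<rho>, OF u(1)])
      fix n
      have r0: "0 \<le> r (path_shift (- \<tau> n) \<omega>)" by (rule r_nonneg[OF shift_in[OF \<omega>]])
      then show "0 \<le> \<rho> n" by (simp add: \<rho>_def)
      show "0 \<le> \<tau> n" using \<tau>(1)[of n] by linarith
      have u_norm: "norm (u n (- \<tau> n)) \<le> norm x + 1 + r (path_shift (- \<tau> n) \<omega>)"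
        using u(2)[of n] norm_triangle_ineq3[of x "u n (- \<tau> n)"] by linarith
      show "\<bar>u n (- \<tau> n) $ i - u n (- \<tau> n) $ pred_coord i\<bar> \<le> \<rho> n" for i
      proof -
        have "\<bar>u n (- \<tau> n) $ i - u n (- \<tau> n) $ pred_coord i\<bar> \<le> norm (u n (- \<tau> n)) + norm (u n (- \<tau> n))"
          by (intro order_trans[OF abs_triangle_ineq4] add_mono component_le_norm_cart)
        then show ?thesis
          using u_norm by (simp add: \<rho>_def)
      qed
    next
      show top: "filterlim \<tau> at_top sequentially"
        by (rule filterlim_at_top_mono[OF filterlim_real_sequentially]) (use \<tau>(1) in auto)
      have t0: "0 \<le> \<tau> n" for n using \<tau>(1)[of n] by linarith
      have "filterlim (\<lambda>n. - (k / 4) * \<tau> n) at_bot sequentially"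
        using k4 by (intro filterlim_tendsto_neg_mult_at_bot[OF tendsto_const _ top]) auto
      then have "(\<lambda>n. exp (- (k / 4) * \<tau> n)) \<longlonglongrightarrow> 0" by (rule filterlim_compose[OF exp_at_bot])
      then have lim: "(\<lambda>n. 2 * (norm x + 1 + C) * exp (- (k / 4) * \<tau> n)) \<longlonglongrightarrow> 0" by (rule tendsto_mult_right_zero)
      show "(\<lambda>n. \<rho> n * exp (- k / 2 * \<tau> n)) \<longlonglongrightarrow> 0"
      proof (rule Lim_null_comparison[OF always_eventually[OF allI] lim])
        fix n
        let ?E = "exp (- (k / 4) * \<tau> n)" and ?r = "r (path_shift (- \<tau> n) \<omega>)"
        have r0: "0 \<le> ?r" by (rule r_nonneg[OF shift_in[OF \<omega>]])
        have E: "exp (- k / 2 * \<tau> n) = ?E * ?E" by (simp add: algebra_simps flip: exp_add)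
        have E1: "?E \<le> 1" using t0[of n] k_pos by simp
        have "?E * ?r \<le> C" using C[of "- \<tau> n"] t0[of n] by simp
        moreover have "?E * (norm x + 1) \<le> 1 * (norm x + 1)" using E1 by (intro mult_right_mono) auto
        ultimately have "2 * (?E * (norm x + 1) + ?E * ?r) * ?E \<le> 2 * (norm x + 1 + C) * ?E"
          by (intro mult_right_mono) auto
        moreover have "norm (\<rho> n * exp (- k / 2 * \<tau> n)) = 2 * (?E * (norm x + 1) + ?E * ?r) * ?E"
          using r0 unfolding E by (simp add: \<rho>_def abs_mult algebra_simps)
        ultimately show "norm (\<rho> n * exp (- k / 2 * \<tau> n)) \<le> 2 * (norm x + 1 + C) * ?E" by simp
      qed
    qed (rule e(2))
    then show False using u(3) not_less by blast
  qed
qed (auto simp: not_less)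

lemma attractor_global: "global_random_attractor M path_shift (cyl_flow k \<alpha> \<epsilon>) attractor"
  unfolding global_random_attractor_def
  using attractor_random_compact_set attractor_tempered attractor_invariant attractor_attracts by auto

lemma attractor_unique:
  assumes A: "global_random_attractor M path_shift (cyl_flow k \<alpha> \<epsilon>) A" and \<omega>: "\<omega> \<in> \<Omega>"
  shows "A \<omega> = attractor \<omega>"
proof -
  have \<theta>: "path_shift t \<omega> \<in> space M" "path_shift t (path_shift (- t) \<omega>) = \<omega>" if "\<omega> \<in> space M" for t \<omega>
    using that by (auto simp: path_shift_add path_shift_0)
  show ?thesis
    using global_random_attractor_subset[OF A attractor_global \<theta>] global_random_attractor_subset[OF attractor_global A \<theta>] \<omega>
    by auto
qed

end

text \<open>\<open>random_conal_curve\<close> quantifies over every derivative in the sense of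
  \<open>cyl_has_derivative\<close>, so the cone condition calls for uniqueness. Two lifts differ by
  periods; continuity at \<open>s\<close> and \<open>cyl_norm_unique\<close> make the period
  constant near \<open>s\<close>.\<close>

lemma cyl_has_derivative_unique:
  assumes s: "s \<in> {a..b}" "a < b"
    and g: "\<And>r. r \<in> {a..b} \<Longrightarrow> cyl_proj (g r) = c r" "(g has_vector_derivative v) (at s within {a..b})"
    and w: "cyl_has_derivative c w s {a..b}"
  shows "w = v"
proof -
  obtain h where h: "cyl_proj (h s) = c s" "\<forall>\<^sub>F r in at s within {a..b}. cyl_proj (h r) = c r"
    "(h has_vector_derivative w) (at s within {a..b})" using w by (auto simp: cyl_has_derivative_def)
  obtain m :: int where m: "h s - g s = period m"
    using h(1) g(1)[OF s(1)] cyl_proj_eq_iff[of "h s" "g s"] by auto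
  have "((\<lambda>r. h r - g r - (h s - g s)) \<longlongrightarrow> h s - g s - (h s - g s)) (at s within {a..b})"
    using has_vector_derivative_continuous[OF h(3)] has_vector_derivative_continuous[OF g(2)]
    by (intro tendsto_diff tendsto_const) (auto simp: continuous_within)
  then have "\<forall>\<^sub>F r in at s within {a..b}. norm (h r - g r - (h s - g s)) < 1"
    by (simp add: tendsto_iff dist_norm)
  moreover have "\<forall>\<^sub>F r in at s within {a..b}. r \<in> {a..b}" by (simp add: eventually_at_filter)
  ultimately have "\<forall>\<^sub>F r in at s within {a..b}. h r = g r + period m"
    using h(2)
  proof eventually_elim
    case (elim r)
    then obtain l :: int where l: "h r - g r = period l"
      using g(1) cyl_proj_eq_iff[of "h r" "g r"] by auto
    have "cyl_norm (h r - g r) m < 1" "cyl_norm (h r - g r) l < 1" using elim(1) m l by simp_all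
    then have "m = l" by (rule cyl_norm_unique)
    then show ?case using l by (simp add: algebra_simps)
  qed
  moreover have "h s = g s + period m" using m by (simp add: diff_eq_eq add.commute)
  ultimately have "((\<lambda>r. g r + period m) has_vector_derivative w) (at s within {a..b})"
    using h(3) s(1) unfolding has_vector_derivative_def by (blast intro: has_derivative_transform_eventually)
  moreover have "((\<lambda>r. g r + period m) has_vector_derivative v) (at s within {a..b})"
    using has_vector_derivative_add[OF g(2) has_vector_derivative_const] by simp
  moreover have "at s within {a..b} \<noteq> bot" using s by (auto simp: trivial_limit_within islimpt_Icc)
  ultimately show ?thesis using vector_derivative_unique_within by blast
qed

text \<open>A period changes the first coordinate by a multiple of \<open>2 * pi\<close>, so the
  choice made by \<open>cyl_rep\<close> is immaterial; this is the projection of the cylinder to its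
  circle factor.\<close>

definition cyl_angle :: "'n::{finite,linorder} cylinder \<Rightarrow> complex" where
  "cyl_angle p = cis (cyl_rep p $ coord1)"

lemma cyl_angle_proj: "cyl_angle (cyl_proj x) = cis (x $ coord1)"
proof -
  have "cyl_proj (cyl_rep (cyl_proj x)) = cyl_proj x"
    by (rule Quotient3_abs_rep[OF Quotient3_cylinder])
  then obtain m :: int where "cyl_rep (cyl_proj x) - x = period m" by (auto simp: cyl_proj_eq_iff)
  then have "cyl_rep (cyl_proj x) $ coord1 - x $ coord1 = 2 * pi * of_int m"
    by (simp add: diag_vec_def flip: vector_minus_component)
  then have "sin (cyl_rep (cyl_proj x) $ coord1) = sin (x $ coord1)
      \<and> cos (cyl_rep (cyl_proj x) $ coord1) = cos (x $ coord1)"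
    unfolding sin_cos_eq_iff by (intro exI[of _ m]) linarith
  then show ?thesis by (simp add: cyl_angle_def complex_eq_iff)
qed

lemma continuous_cyl_angle: "continuous_on UNIV (cyl_angle :: 'n::{finite,linorder} cylinder \<Rightarrow> complex)"
  unfolding continuous_on_iff
proof (intro ballI allI impI)
  fix p :: "'n cylinder" and e :: real assume e: "0 < e"
  obtain x where x: "cyl_proj x = p" by (rule cyl_proj_surj)
  have "continuous_on UNIV (\<lambda>y :: 'n rvec. cis (y $ coord1))" by (intro continuous_intros)
  then obtain d where d: "0 < d" "\<And>y. dist y x < d \<Longrightarrow> dist (cis (y $ coord1)) (cis (x $ coord1)) < e"
    using e unfolding continuous_on_iff by blast
  show "\<exists>d>0. \<forall>q\<in>UNIV. dist q p < d \<longrightarrow> dist (cyl_angle q) (cyl_angle p) < e"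
  proof (intro exI conjI ballI impI)
    fix q assume "dist q p < d"
    then have "dist (cyl_proj x) q < d" using x by (simp add: dist_commute)
    then obtain y where "cyl_proj y = q" "norm (x - y) < d" by (rule dist_cyl_lift)
    then show "dist (cyl_angle q) (cyl_angle p) < e"
      using d(2)[of y] x by (auto simp: cyl_angle_proj dist_norm norm_minus_commute)
  qed (rule d(1))
qed

section \<open>The attractor as a circle and as a conal curve\<close>

context strongly_coupled_rde
begin

lemma strand_shift: "strand (a + 2 * pi * of_int m) 0 = strand a 0 + period m"
proof -
  have "(\<lambda>t. strand a t + period m) \<in> entire" by (rule entire_shift[OF strand(1)])
  from strand_unique[OF this] show ?thesis by (simp add: strand(2) diag_vec_def)
qed

lemma attractor_fibre_eq: "attractor_fibre = (\<lambda>a. cyl_proj (strand a 0)) ` {0..2 * pi}"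
proof (intro equalityI subsetI)
  fix p assume "p \<in> attractor_fibre"
  then obtain u where u: "u \<in> entire" "cyl_proj (u 0) = p" "0 \<le> u 0 $ coord1" "u 0 $ coord1 \<le> 2 * pi"
    by (rule attractor_fibre_lift)
  then show "p \<in> (\<lambda>a. cyl_proj (strand a 0)) ` {0..2 * pi}"
    using strand_unique[OF u(1)] by (intro image_eqI[of _ _ "u 0 $ coord1"]) auto
qed (auto simp: attractor_fibre_def strand)

lemma cyl_angle_strand: "cyl_angle (cyl_proj (strand a 0)) = cis a"
  by (simp add: cyl_angle_proj strand)

text \<open>\<open>cyl_angle\<close> sends the point labelled \<open>a\<close> to
  \<open>cis a\<close>, and labels differing by multiples of \<open>2 * pi\<close> give the same
  point by \<open>strand_shift\<close>; it is thus a continuous bijection from a compact set to the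
  unit circle.\<close>

lemma attractor_fibre_manifold: "one_dim_manifold (top_of_set attractor_fibre)"
proof (rule one_dim_manifold_of_circle[OF compact_attractor_fibre])
  show "continuous_on attractor_fibre cyl_angle" by (rule continuous_on_subset[OF continuous_cyl_angle]) simp
  show "inj_on cyl_angle attractor_fibre"
  proof (rule inj_onI)
    fix p q assume "p \<in> attractor_fibre" "q \<in> attractor_fibre" and eq: "cyl_angle p = cyl_angle q"
    then obtain a b where ab: "p = cyl_proj (strand a 0)" "q = cyl_proj (strand b 0)" unfolding attractor_fibre_eq by blast
    then have "cis a = cis b" using eq by (simp add: cyl_angle_strand)
    then have "cos a = cos b" "sin a = sin b" by (auto simp: complex_eq_iff)
    then obtain m :: int where "a = b + 2 * pi * of_int m" using sin_cos_eq_iff[of a b] by blast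
    then show "p = q" by (simp add: ab strand_shift)
  qed
  show "cyl_angle ` attractor_fibre = sphere 0 1"
  proof (intro equalityI subsetI)
    fix c :: complex assume "c \<in> sphere 0 1"
    then have "cis (Arg2pi c) = c" using complex_norm_eq_1_exp[of c] by (simp add: cis_conv_exp)
    moreover have "Arg2pi c \<in> {0..2 * pi}" using Arg2pi[of c] by simp
    ultimately show "c \<in> cyl_angle ` attractor_fibre"
      unfolding attractor_fibre_eq image_image cyl_angle_strand by (intro image_eqI) auto
  qed (auto simp: attractor_fibre_eq cyl_angle_strand)
qed

end

context driven_system
begin

definition strand_curve :: "real \<Rightarrow> 'n sample \<Rightarrow> 'n cylinder" where
  "strand_curve s \<omega> = cyl_proj (strongly_coupled_rde.strand k \<alpha> (\<zeta> \<omega>) (R \<omega>) s 0)"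

context
  assumes card: "2 \<le> CARD('n)" and large: "2 * (real CARD('n) - 1) < k"
begin

lemma strongly_coupled_path:
  assumes "\<omega> \<in> \<Omega>"
  shows "strongly_coupled_rde k \<alpha> (\<zeta> \<omega>) (R \<omega>)"
  using coupled_rde_path[OF assms] card large
  by (simp add: strongly_coupled_rde_def strongly_coupled_rde_axioms_def)

lemma attractor_eq_strand_curve:
  assumes "\<omega> \<in> \<Omega>"
  shows "attractor \<omega> = (\<lambda>s. strand_curve s \<omega>) ` {0..2 * pi}"
  unfolding attractor_def strand_curve_def
  by (rule strongly_coupled_rde.attractor_fibre_eq[OF strongly_coupled_path[OF assms]])

lemma attractor_manifold: "\<omega> \<in> \<Omega> \<Longrightarrow> one_dim_manifold (top_of_set (attractor \<omega>))"
  unfolding attractor_def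
  by (rule strongly_coupled_rde.attractor_fibre_manifold[OF strongly_coupled_path])

lemma strand_curve_conal:
  assumes \<omega>: "\<omega> \<in> \<Omega>"
  obtains \<eta>' where "continuous_on {0..2 * pi} \<eta>'"
    "\<And>s. s \<in> {0..2 * pi} \<Longrightarrow> cyl_has_derivative (\<lambda>s. strand_curve s \<omega>) (\<eta>' s) s {0..2 * pi}"
    "\<And>s v. s \<in> {0..2 * pi} \<Longrightarrow> cyl_has_derivative (\<lambda>s. strand_curve s \<omega>) v s {0..2 * pi} \<Longrightarrow>
       v \<in> cone_field k \<omega> (strand_curve s \<omega>)"
proof -
  interpret S: strongly_coupled_rde k \<alpha> "\<zeta> \<omega>" "R \<omega>"
    by (rule strongly_coupled_path[OF \<omega>])
  obtain h' where h': "continuous_on UNIV h'" "\<And>b. ((\<lambda>a. S.strand a 0) has_vector_derivative h' b) (at b)"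
    by (rule S.strand_C1) (rule that)
  have within: "((\<lambda>a. S.strand a 0) has_vector_derivative h' s) (at s within {0..2 * pi})" for s
    by (rule has_vector_derivative_at_within[OF h'(2)])
  have lift: "cyl_proj (S.strand s 0) = strand_curve s \<omega>" for s by (simp add: strand_curve_def)
  show thesis
  proof
    show "continuous_on {0..2 * pi} h'" by (rule continuous_on_subset[OF h'(1)]) simp
    fix s :: real assume s: "s \<in> {0..2 * pi}"
    show "cyl_has_derivative (\<lambda>s. strand_curve s \<omega>) (h' s) s {0..2 * pi}"
      unfolding cyl_has_derivative_def
      by (intro exI[of _ "\<lambda>a. S.strand a 0"] conjI always_eventually allI lift within)
    fix v assume "cyl_has_derivative (\<lambda>s. strand_curve s \<omega>) v s {0..2 * pi}"
    then have "v = h' s" by (intro cyl_has_derivative_unique[OF s _ lift within]) auto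
    then show "v \<in> cone_field k \<omega> (strand_curve s \<omega>)"
      using S.strand_derivative_cone[OF h'(2)[of s]] by (simp add: cone_field_def)
  qed
qed

lemma strand_curve_closed: "\<omega> \<in> \<Omega> \<Longrightarrow> strand_curve 0 \<omega> = strand_curve (2 * pi) \<omega>"
  using strongly_coupled_rde.strand_shift[OF strongly_coupled_path, of \<omega> 0 1]
  by (simp add: strand_curve_def cyl_proj_eq_iff) (metis mult.right_neutral of_int_1 of_int_minus mult_minus_right scaleR_minus_left)

lemma strand_curve_closed_conal: "closed_random_conal_curve M (cone_field k) 0 (2 * pi) strand_curve"
  unfolding closed_random_conal_curve_def random_conal_curve_def space_M
proof (intro conjI ballI allI impI)
  fix \<omega> assume \<omega>: "\<omega> \<in> \<Omega>"
  obtain \<eta>' where \<eta>': "continuous_on {0..2 * pi} \<eta>'"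
    "\<And>s. s \<in> {0..2 * pi} \<Longrightarrow> cyl_has_derivative (\<lambda>s. strand_curve s \<omega>) (\<eta>' s) s {0..2 * pi}"
    "\<And>s v. s \<in> {0..2 * pi} \<Longrightarrow> cyl_has_derivative (\<lambda>s. strand_curve s \<omega>) v s {0..2 * pi} \<Longrightarrow>
       v \<in> cone_field k \<omega> (strand_curve s \<omega>)"
    by (rule strand_curve_conal[OF \<omega>]) (rule that)
  show "\<exists>\<eta>'. continuous_on {0..2 * pi} \<eta>' \<and>
      (\<forall>s\<in>{0..2 * pi}. cyl_has_derivative (\<lambda>s. strand_curve s \<omega>) (\<eta>' s) s {0..2 * pi})"
    using \<eta>'(1,2) by blast
  show "strand_curve 0 \<omega> = strand_curve (2 * pi) \<omega>" by (rule strand_curve_closed[OF \<omega>])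
  fix s v assume "s \<in> {0..2 * pi}" "cyl_has_derivative (\<lambda>s. strand_curve s \<omega>) v s {0..2 * pi}"
  then show "v \<in> cone_field k \<omega> (strand_curve s \<omega>)" by (rule \<eta>'(3))
next
  \<comment> \<open>The image of the curve is the attractor, whose measurability is already
    known.\<close>
  have "random_set M attractor" using attractor_random_compact_set by (simp add: random_compact_set_def)
  moreover have "random_set M attractor \<longleftrightarrow> random_set M (\<lambda>\<omega>. (\<lambda>s. strand_curve s \<omega>) ` {0..2 * pi})"
    unfolding random_set_def
    by (intro arg_cong2[where f = "(\<and>)"] ball_cong arg_cong[where f = All] ext measurable_cong)
      (auto simp: attractor_eq_strand_curve)
  ultimately show "random_set M (\<lambda>\<omega>. (\<lambda>s. strand_curve s \<omega>) ` {0..2 * pi})" by simp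
qed simp

end

end

theorem theorem1p1:
  fixes \<alpha> \<epsilon> :: "'n::{finite,linorder} rvec"
    and P :: "'n sample measure"
    and \<Omega> :: "'n sample set"
  assumes "2 \<le> CARD('n)"
    and "\<And>i. 0 < \<epsilon> $ i"
    and "wiener_measure P"
    and "admissible_noise_set P \<epsilon> \<Omega>"
  shows "(\<forall>k>0. \<exists>A. global_random_attractor (restrict_space P \<Omega>) path_shift (cyl_flow k \<alpha> \<epsilon>) A) \<and>
    (\<exists>k0 \<ge> 2 * (real CARD('n) - 1). \<forall>k>k0. \<forall>A.
       global_random_attractor (restrict_space P \<Omega>) path_shift (cyl_flow k \<alpha> \<epsilon>) A \<longrightarrow>
         (\<forall>\<omega>\<in>\<Omega>. one_dim_manifold (top_of_set (A \<omega>))) \<and>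
         (\<exists>s0 s1 \<eta>. closed_random_conal_curve (restrict_space P \<Omega>) (cone_field k) s0 s1 \<eta> \<and>
            (\<forall>\<omega>\<in>\<Omega>. A \<omega> = (\<lambda>s. \<eta> s \<omega>) ` {s0..s1})))"
proof
  show "\<forall>k>0. \<exists>A. global_random_attractor (restrict_space P \<Omega>) path_shift (cyl_flow k \<alpha> \<epsilon>) A"
  proof (intro allI impI)
    fix k :: real assume "0 < k"
    then interpret driven_system k \<alpha> \<epsilon> P \<Omega> using assms(3,4) by unfold_locales
    show "\<exists>A. global_random_attractor (restrict_space P \<Omega>) path_shift (cyl_flow k \<alpha> \<epsilon>) A"
      using attractor_global by blast
  qed
  have "(\<forall>\<omega>\<in>\<Omega>. one_dim_manifold (top_of_set (A \<omega>))) \<and>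
         (\<exists>s0 s1 \<eta>. closed_random_conal_curve (restrict_space P \<Omega>) (cone_field k) s0 s1 \<eta> \<and>
            (\<forall>\<omega>\<in>\<Omega>. A \<omega> = (\<lambda>s. \<eta> s \<omega>) ` {s0..s1}))"
    if k: "2 * (real CARD('n) - 1) < k"
      and A: "global_random_attractor (restrict_space P \<Omega>) path_shift (cyl_flow k \<alpha> \<epsilon>) A" for k A
  proof
    have "0 \<le> 2 * (real CARD('n) - 1)" using assms(1) by simp
    with k have "0 < k" by (rule le_less_trans[rotated])
    then interpret driven_system k \<alpha> \<epsilon> P \<Omega> using assms(3,4) by unfold_locales
    \<comment> \<open>The claim concerns an arbitrary attractor; uniqueness identifies it with the
      constructed one.\<close>
    note A_eq = attractor_unique[OF A]
    show "\<forall>\<omega>\<in>\<Omega>. one_dim_manifold (top_of_set (A \<omega>))"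
      using attractor_manifold[OF assms(1) k] A_eq by simp
    show "\<exists>s0 s1 \<eta>. closed_random_conal_curve (restrict_space P \<Omega>) (cone_field k) s0 s1 \<eta> \<and>
            (\<forall>\<omega>\<in>\<Omega>. A \<omega> = (\<lambda>s. \<eta> s \<omega>) ` {s0..s1})"
      using strand_curve_closed_conal[OF assms(1) k] attractor_eq_strand_curve[OF assms(1) k] A_eq
      by (intro exI[of _ 0] exI[of _ "2 * pi"] exI[of _ strand_curve]) simp
  qed
  \<comment> \<open>The threshold chosen here depends on the number of coordinates only.\<close>
  then show "\<exists>k0 \<ge> 2 * (real CARD('n) - 1). \<forall>k>k0. \<forall>A.
       global_random_attractor (restrict_space P \<Omega>) path_shift (cyl_flow k \<alpha> \<epsilon>) A \<longrightarrow>
         (\<forall>\<omega>\<in>\<Omega>. one_dim_manifold (top_of_set (A \<omega>))) \<and>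
         (\<exists>s0 s1 \<eta>. closed_random_conal_curve (restrict_space P \<Omega>) (cone_field k) s0 s1 \<eta> \<and>
            (\<forall>\<omega>\<in>\<Omega>. A \<omega> = (\<lambda>s. \<eta> s \<omega>) ` {s0..s1}))"
    by (intro exI[of _ "2 * (real CARD('n) - 1)"] conjI[OF order_refl] allI impI)
qed

end
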